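(* Let $\ell,\xi,\eta,\kappa>0$, let $M_1,M_2,M_3$ be nonzero real numbers and let $\alpha_0\in(-\pi,\pi)$. Consider the control system of the bent 3-link magnetic microswimmer, with state $Z=(x,y,\theta,\alpha_1,\alpha_2)^T\in\mathbb{R}^5$ and control $(H_\parallel,H_\perp)\in\mathbb{R}^2$, $$R_{-\theta}\,\dot Z=\mathbf{F}_0(\alpha_1,\alpha_2)+H_\parallel(t)\,\mathbf{F}_1(\alpha_1,\alpha_2)+H_\perp(t)\,\mathbf{F}_2(\alpha_1,\alpha_2),$$ where $R_{-\theta},\mathbf{F}_0,\mathbf{F}_1,\mathbf{F}_2$ are as defined in the context. If $\alpha_0\neq 0$, then this system is small-time locally partially controllable with respect to $(x,y)$ at every equilibrium point $(x^e,y^e,\theta^e,0,\alpha_0)$, $(x^e,y^e,\theta^e)\in\mathbb{R}^3$, with equilibrium control $(H_\parallel,H_\perp)=(0,0)$.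
   Context: **Geometry.** The swimmer consists of three rigid segments $S_1,S_2,S_3$ of length $\ell$ moving in the plane spanned by the orthonormal vectors $\mathbf{e}_x,\mathbf{e}_y$, with $\mathbf{e}_z=\mathbf{e}_x\times\mathbf{e}_y$. Put $\theta_1=\theta$, $\theta_2=\theta+\alpha_1$, $\theta_3=\theta+\alpha_1+\alpha_2$, and for $i=1,2,3$ $$\mathbf{e}_{i,\parallel}=(\cos\theta_i,\sin\theta_i),\qquad \mathbf{e}_{i,\perp}=(-\sin\theta_i,\cos\theta_i).$$ Let $\mathbf{x}_1=\mathbf{x}=(x,y)$ (the free end of $S_1$), $\mathbf{x}_2=\mathbf{x}_1+\ell\,\mathbf{e}_{1,\parallel}$, $\mathbf{x}_3=\mathbf{x}_2+\ell\,\mathbf{e}_{2,\parallel}$, and $S_i=\{\mathbf{x}_i+s\,\mathbf{e}_{i,\parallel}: s\in[0,\ell]\}$. **Hydrodynamic forces and torques (Resistive Force Theory).** The point $\mathbf{x}_i+s\,\mathbf{e}_{i,\parallel}$ has velocity $\mathbf{u}_i(s)=\dot{\mathbf{x}}_i+s\dot\theta_i\,\mathbf{e}_{i,\perp}$. The drag force density there is $$\mathbf{f}_i(s)=-\xi\,(\mathbf{u}_i(s)\cdot\mathbf{e}_{i,\parallel})\,\mathbf{e}_{i,\parallel}-\eta\,(\mathbf{u}_i(s)\cdot\mathbf{e}_{i,\perp})\,\mathbf{e}_{i,\perp}.$$ Put $\mathbf{F}^h_i=\int_0^\ell\mathbf{f}_i(s)\,ds$ and, for a point $\mathbf{p}$,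 let $T^h_{i,\mathbf{p}}$ be the $\mathbf{e}_z$-component of $\int_0^\ell(\mathbf{x}_i+s\,\mathbf{e}_{i,\parallel}-\mathbf{p})\times\mathbf{f}_i(s)\,ds$. **The matrix $M$.** Let $$R_{-\theta}=\begin{pmatrix} r_{-\theta} & 0\\ 0 & I_3\end{pmatrix}\in\mathbb{R}^{5\times5},\qquad r_{-\theta}=\begin{pmatrix}\cos\theta&\sin\theta\\-\sin\theta&\cos\theta\end{pmatrix}.$$ The vector $$\Big(\textstyle\sum_{i=1}^3\mathbf{F}^h_i\cdot\mathbf{e}_{1,\parallel},\ \sum_{i=1}^3\mathbf{F}^h_i\cdot\mathbf{e}_{1,\perp},\ \sum_{i=1}^3T^h_{i,\mathbf{x}_1},\ T^h_{2,\mathbf{x}_2}+T^h_{3,\mathbf{x}_2},\ T^h_{3,\mathbf{x}_3}\Big)^T$$ is linear in $R_{-\theta}\dot Z$ and equals $M(\alpha_1,\alpha_2)\,R_{-\theta}\dot Z$ for a $5\times5$ matrix $M$ depending only on $(\alpha_1,\alpha_2)$; this defines $M$. The matrix $M(\alpha_1,\alpha_2)$ is invertible for all $(\alpha_1,\alpha_2)$. Let $\mathbf{X}_3,\mathbf{X}_4,\mathbf{X}_5$ denote the third, fourth and fifth columns of $M(\alpha_1,\alpha_2)^{-1}$. **The vector fields.** $$\mathbf{F}_0=-\kappa\big(\alpha_1\mathbf{X}_4+(\alpha_2-\alpha_0)\mathbf{X}_5\big),$$ $$\mathbf{F}_1=\big(M_2\sin\alpha_1+M_3\sin(\alpha_1+\alpha_2)\big)(\mathbf{X}_3+\mathbf{X}_4)+M_3\sin(\alpha_1+\alpha_2)\,\mathbf{X}_5,$$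 $$\mathbf{F}_2=-M_1\mathbf{X}_3-\big(M_2\cos\alpha_1+M_3\cos(\alpha_1+\alpha_2)\big)(\mathbf{X}_3+\mathbf{X}_4)-M_3\cos(\alpha_1+\alpha_2)\,\mathbf{X}_5.$$ (Here $\kappa$ is the stiffness of the two torsional springs, $M_i$ is the magnetic moment of $S_i$, and $H_\parallel,H_\perp$ are the components of the external magnetic field in the frame $(\mathbf{e}_{1,\parallel},\mathbf{e}_{1,\perp})$. The spring between $S_2$ and $S_3$ is at rest when $\alpha_2=\alpha_0$. With zero magnetic field the equilibrium points are exactly the points $(x,y,\theta,0,\alpha_0)$.) **Small-time local partial controllability.** Let $(\dot y_1,\dot y_2)=f(y_1,y_2,u)$ be a control system with $y_1\in\mathbb{R}^p$, $y_2\in\mathbb{R}^{n-p}$, $u\in\mathbb{R}^m$, and let $(y_1^e,y_2^e,u^e)$ be an equilibrium, i.e. $f(y_1^e,y_2^e,u^e)=0$. The system is small-time locally partially controllable at $(y_1^e,y_2^e,u^e)$ with respect to $y_1$ if for every $\epsilon>0$ there exists $\delta>0$ such that for every $(y_1^0,y_2^0,y_1^f)\in B_\delta(y_1^e)\times B_\delta(y_2^e)\times B_\delta(y_1^e)$ there exists $u\in L^2([0,\epsilon];\mathbb{R}^m)$ such that the solution $(y_1,y_2)$ of the system on $[0,\epsilon]$ with control $u$ and initial condition $(y_1,y_2)(0)=(y_1^0,y_2^0)$ satisfies (i) $|u(t)-u^e|\le\epsilon$ for (almost) all $t\in[0,\epsilon]$; (ii) $y_1(\epsilon)=y_1^f$.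 Here $B_\delta(\cdot)$ denotes the ball of radius $\delta$. In the claim, $n=5$, $p=2$, $m=2$, $y_1=(x,y)$, $y_2=(\theta,\alpha_1,\alpha_2)$ and $u=(H_\parallel,H_\perp)$. *)

theory Defs
  imports "HOL-Analysis.Analysis"
begin

text \<open>
  A configuration is \<open>Z = (x, y, \<theta>, \<alpha>\<^sub>1, \<alpha>\<^sub>2)\<close> and \<open>V\<close> stands for its time derivative. Segments are
  numbered by the naturals 1, 2, 3.
\<close>

definition e_par :: "real \<Rightarrow> real^2" where
  "e_par \<phi> = vector [cos \<phi>, sin \<phi>]"

definition e_perp :: "real \<Rightarrow> real^2" where
  "e_perp \<phi> = vector [- sin \<phi>, cos \<phi>]"

definition link_angle :: "real^5 \<Rightarrow> nat \<Rightarrow> real" where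
  "link_angle Z i = Z$3 + (if 2 \<le> i then Z$4 else 0) + (if 3 \<le> i then Z$5 else 0)"

definition link_start :: "real \<Rightarrow> real^5 \<Rightarrow> nat \<Rightarrow> real^2" where
  "link_start l Z i = vector [Z$1, Z$2] + (\<Sum>j\<in>{1..<i}. l *\<^sub>R e_par (link_angle Z j))"

text \<open>
  \<open>link_angle\<close> is linear, so \<open>link_angle V i\<close> is the angular velocity of segment \<open>i\<close>. The next
  function is the velocity of \<open>link_start l Z i\<close>; see \<open>link_start_has_velocity\<close> below.
\<close>

definition link_start_vel :: "real \<Rightarrow> real^5 \<Rightarrow> real^5 \<Rightarrow> nat \<Rightarrow> real^2" where
  "link_start_vel l Z V i =
     vector [V$1, V$2] + (\<Sum>j\<in>{1..<i}. (l * link_angle V j) *\<^sub>R e_perp (link_angle Z j))"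

definition point_vel :: "real \<Rightarrow> real^5 \<Rightarrow> real^5 \<Rightarrow> nat \<Rightarrow> real \<Rightarrow> real^2" where
  "point_vel l Z V i s =
     link_start_vel l Z V i + (s * link_angle V i) *\<^sub>R e_perp (link_angle Z i)"

definition drag_density ::
  "real \<Rightarrow> real \<Rightarrow> real \<Rightarrow> real^5 \<Rightarrow> real^5 \<Rightarrow> nat \<Rightarrow> real \<Rightarrow> real^2" where
  "drag_density l \<xi> \<eta> Z V i s =
     - (\<xi> * (point_vel l Z V i s \<bullet> e_par (link_angle Z i))) *\<^sub>R e_par (link_angle Z i)
     - (\<eta> * (point_vel l Z V i s \<bullet> e_perp (link_angle Z i))) *\<^sub>R e_perp (link_angle Z i)"

definition drag_force ::
  "real \<Rightarrow> real \<Rightarrow> real \<Rightarrow> real^5 \<Rightarrow> real^5 \<Rightarrow> nat \<Rightarrow> real^2" where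
  "drag_force l \<xi> \<eta> Z V i = integral {0..l} (drag_density l \<xi> \<eta> Z V i)"

definition cross_z :: "real^2 \<Rightarrow> real^2 \<Rightarrow> real" where
  "cross_z a b = a$1 * b$2 - a$2 * b$1"

definition drag_torque ::
  "real \<Rightarrow> real \<Rightarrow> real \<Rightarrow> real^5 \<Rightarrow> real^5 \<Rightarrow> nat \<Rightarrow> real^2 \<Rightarrow> real" where
  "drag_torque l \<xi> \<eta> Z V i p =
     integral {0..l} (\<lambda>s. cross_z (link_start l Z i + s *\<^sub>R e_par (link_angle Z i) - p)
                                  (drag_density l \<xi> \<eta> Z V i s))"

definition drag_vector :: "real \<Rightarrow> real \<Rightarrow> real \<Rightarrow> real^5 \<Rightarrow> real^5 \<Rightarrow> real^5" where
  "drag_vector l \<xi> \<eta> Z V = vector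
     [(\<Sum>i=1..3. drag_force l \<xi> \<eta> Z V i) \<bullet> e_par (link_angle Z 1),
      (\<Sum>i=1..3. drag_force l \<xi> \<eta> Z V i) \<bullet> e_perp (link_angle Z 1),
      \<Sum>i=1..3. drag_torque l \<xi> \<eta> Z V i (link_start l Z 1),
      \<Sum>i=2..3. drag_torque l \<xi> \<eta> Z V i (link_start l Z 2),
      drag_torque l \<xi> \<eta> Z V 3 (link_start l Z 3)]"

definition R_minus :: "real \<Rightarrow> real^5^5" where
  "R_minus \<theta> = vector
     [vector [cos \<theta>, sin \<theta>, 0, 0, 0],
      vector [- sin \<theta>, cos \<theta>, 0, 0, 0],
      vector [0, 0, 1, 0, 0],
      vector [0, 0, 0, 1, 0],
      vector [0, 0, 0, 0, 1]]"

text \<open>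
  Existence and uniqueness of the matrix described here are proved in \<open>drag_matrix_ex1\<close> below.
\<close>

definition drag_matrix :: "real \<Rightarrow> real \<Rightarrow> real \<Rightarrow> real \<Rightarrow> real \<Rightarrow> real^5^5" where
  "drag_matrix l \<xi> \<eta> \<alpha>1 \<alpha>2 =
     (THE A. \<forall>x y \<theta> V. drag_vector l \<xi> \<eta> (vector [x, y, \<theta>, \<alpha>1, \<alpha>2]) V = A *v (R_minus \<theta> *v V))"

text \<open>The vectors \<open>\<^bold>X\<^sub>3\<close>, \<open>\<^bold>X\<^sub>4\<close>, \<open>\<^bold>X\<^sub>5\<close> are obtained for \<open>k = 3, 4, 5\<close>.\<close>

definition X_col :: "real \<Rightarrow> real \<Rightarrow> real \<Rightarrow> 5 \<Rightarrow> real \<Rightarrow> real \<Rightarrow> real^5" where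
  "X_col l \<xi> \<eta> k \<alpha>1 \<alpha>2 = column k (matrix_inv (drag_matrix l \<xi> \<eta> \<alpha>1 \<alpha>2))"

definition F0 :: "real \<Rightarrow> real \<Rightarrow> real \<Rightarrow> real \<Rightarrow> real \<Rightarrow> real \<Rightarrow> real \<Rightarrow> real^5" where
  "F0 l \<xi> \<eta> \<kappa> \<alpha>0 \<alpha>1 \<alpha>2 =
     - \<kappa> *\<^sub>R (\<alpha>1 *\<^sub>R X_col l \<xi> \<eta> 4 \<alpha>1 \<alpha>2 + (\<alpha>2 - \<alpha>0) *\<^sub>R X_col l \<xi> \<eta> 5 \<alpha>1 \<alpha>2)"

definition F1 :: "real \<Rightarrow> real \<Rightarrow> real \<Rightarrow> real \<Rightarrow> real \<Rightarrow> real \<Rightarrow> real \<Rightarrow> real^5" where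
  "F1 l \<xi> \<eta> M2 M3 \<alpha>1 \<alpha>2 =
     (M2 * sin \<alpha>1 + M3 * sin (\<alpha>1 + \<alpha>2)) *\<^sub>R (X_col l \<xi> \<eta> 3 \<alpha>1 \<alpha>2 + X_col l \<xi> \<eta> 4 \<alpha>1 \<alpha>2)
     + (M3 * sin (\<alpha>1 + \<alpha>2)) *\<^sub>R X_col l \<xi> \<eta> 5 \<alpha>1 \<alpha>2"

definition F2 :: "real \<Rightarrow> real \<Rightarrow> real \<Rightarrow> real \<Rightarrow> real \<Rightarrow> real \<Rightarrow> real \<Rightarrow> real \<Rightarrow> real^5" where
  "F2 l \<xi> \<eta> M1 M2 M3 \<alpha>1 \<alpha>2 =
     - M1 *\<^sub>R X_col l \<xi> \<eta> 3 \<alpha>1 \<alpha>2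
     - (M2 * cos \<alpha>1 + M3 * cos (\<alpha>1 + \<alpha>2)) *\<^sub>R (X_col l \<xi> \<eta> 3 \<alpha>1 \<alpha>2 + X_col l \<xi> \<eta> 4 \<alpha>1 \<alpha>2)
     - (M3 * cos (\<alpha>1 + \<alpha>2)) *\<^sub>R X_col l \<xi> \<eta> 5 \<alpha>1 \<alpha>2"

text \<open>
  The equation \<open>R\<^sub>-\<^sub>\<theta> Z' = F\<^sub>0 + H\<^sub>\<parallel> F\<^sub>1 + H\<^sub>\<bottom> F\<^sub>2\<close> solved for \<open>Z'\<close>, with \<open>Z\<close> split into \<open>q = (x, y)\<close> and
  \<open>p = (\<theta>, \<alpha>\<^sub>1, \<alpha>\<^sub>2)\<close>, and \<open>u = (H\<^sub>\<parallel>, H\<^sub>\<bottom>)\<close>.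
\<close>

definition state :: "real^2 \<Rightarrow> real^3 \<Rightarrow> real^5" where
  "state q p = vector [q$1, q$2, p$1, p$2, p$3]"

definition state_xy :: "real^5 \<Rightarrow> real^2" where
  "state_xy Z = vector [Z$1, Z$2]"

definition state_angles :: "real^5 \<Rightarrow> real^3" where
  "state_angles Z = vector [Z$3, Z$4, Z$5]"

definition swimmer_field ::
  "real \<Rightarrow> real \<Rightarrow> real \<Rightarrow> real \<Rightarrow> real \<Rightarrow> real \<Rightarrow> real \<Rightarrow> real
    \<Rightarrow> real^2 \<Rightarrow> real^3 \<Rightarrow> real^2 \<Rightarrow> (real^2) \<times> (real^3)" where
  "swimmer_field l \<xi> \<eta> \<kappa> M1 M2 M3 \<alpha>0 q p u =
     (let V = matrix_inv (R_minus (p$1)) *v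
                (F0 l \<xi> \<eta> \<kappa> \<alpha>0 (p$2) (p$3)
                 + (u$1) *\<^sub>R F1 l \<xi> \<eta> M2 M3 (p$2) (p$3)
                 + (u$2) *\<^sub>R F2 l \<xi> \<eta> M1 M2 M3 (p$2) (p$3))
      in (state_xy V, state_angles V))"

definition L2_control :: "real \<Rightarrow> (real \<Rightarrow> 'c::euclidean_space) \<Rightarrow> bool" where
  "L2_control T u \<longleftrightarrow>
     u \<in> borel_measurable (lebesgue_on {0..T}) \<and>
     integrable (lebesgue_on {0..T}) (\<lambda>t. (norm (u t))\<^sup>2)"

text \<open>
  Controls are only measurable, so solutions are understood in the sense of Caratheodory, in
  integrated form.
\<close>

definition solves_on ::
  "real \<Rightarrow> ('a::euclidean_space \<Rightarrow> 'b::euclidean_space \<Rightarrow> 'c::euclidean_space \<Rightarrow> 'a \<times> 'b)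
    \<Rightarrow> (real \<Rightarrow> 'c) \<Rightarrow> 'a \<Rightarrow> 'b \<Rightarrow> (real \<Rightarrow> 'a \<times> 'b) \<Rightarrow> bool" where
  "solves_on T f u y10 y20 y \<longleftrightarrow>
     continuous_on {0..T} y \<and>
     (\<lambda>s. f (fst (y s)) (snd (y s)) (u s)) absolutely_integrable_on {0..T} \<and>
     (\<forall>t\<in>{0..T}. y t = (y10, y20) + integral {0..t} (\<lambda>s. f (fst (y s)) (snd (y s)) (u s)))"

text \<open>
  ``The solution satisfies \<open>y\<^sub>1(\<epsilon>) = y\<^sub>1\<^sup>f\<close>'' is rendered as: a solution on \<open>[0, \<epsilon>]\<close> exists, and every
  solution on \<open>[0, \<epsilon>]\<close> satisfies it.
\<close>

definition small_time_locally_partially_controllable ::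
  "('a::euclidean_space \<Rightarrow> 'b::euclidean_space \<Rightarrow> 'c::euclidean_space \<Rightarrow> 'a \<times> 'b)
    \<Rightarrow> 'a \<Rightarrow> 'b \<Rightarrow> 'c \<Rightarrow> bool" where
  "small_time_locally_partially_controllable f y1e y2e ue \<longleftrightarrow>
     f y1e y2e ue = 0 \<and>
     (\<forall>\<epsilon>>0. \<exists>\<delta>>0. \<forall>y10\<in>ball y1e \<delta>. \<forall>y20\<in>ball y2e \<delta>. \<forall>y1f\<in>ball y1e \<delta>.
        \<exists>u. L2_control \<epsilon> u \<and>
            (AE t in lebesgue_on {0..\<epsilon>}. norm (u t - ue) \<le> \<epsilon>) \<and>
            (\<exists>y. solves_on \<epsilon> f u y10 y20 y) \<and>
            (\<forall>y. solves_on \<epsilon> f u y10 y20 y \<longrightarrow> fst (y \<epsilon>) = y1f))"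

lemma exhaust_5: "x = 1 \<or> x = 2 \<or> x = 3 \<or> x = 4 \<or> x = 5" for x :: 5
proof (induct x)
  case (of_int z)
  then have "0 \<le> z" and "z < 5" by simp_all
  then have "z = 0 \<or> z = 1 \<or> z = 2 \<or> z = 3 \<or> z = 4" by arith
  then show ?case by auto
qed

lemma UNIV_5: "UNIV = {1, 2, 3, 4, 5::5}"
  using exhaust_5 by auto

lemma forall_5: "(\<forall>i::5. P i) \<longleftrightarrow> P 1 \<and> P 2 \<and> P 3 \<and> P 4 \<and> P 5"
  by (metis exhaust_5)

lemma sum_5: "sum f (UNIV::5 set) = f 1 + f 2 + f 3 + f 4 + f 5"
  unfolding UNIV_5 by (simp add: ac_simps)

lemma vector_5 [simp]:
  "(vector [a, b, c, d, e] :: 'a::zero^5)$1 = a"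
  "(vector [a, b, c, d, e] :: 'a::zero^5)$2 = b"
  "(vector [a, b, c, d, e] :: 'a::zero^5)$3 = c"
  "(vector [a, b, c, d, e] :: 'a::zero^5)$4 = d"
  "(vector [a, b, c, d, e] :: 'a::zero^5)$5 = e"
  unfolding vector_def by simp_all

lemma R_minus_mult:
  "R_minus \<theta> *v V = vector [cos \<theta> * V$1 + sin \<theta> * V$2, - sin \<theta> * V$1 + cos \<theta> * V$2, V$3, V$4, V$5]"
  by (simp add: vec_eq_iff forall_5 R_minus_def matrix_vector_mult_def sum_5)

lemma link_start_has_velocity:
  assumes "(Z has_vector_derivative V) (at t within S)"
  shows "((\<lambda>t. link_start l (Z t) i) has_vector_derivative link_start_vel l (Z t) V i) (at t within S)"
proof -
  have c: "((\<lambda>t. Z t $ k) has_real_derivative V $ k) (at t within S)" for k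
    using bounded_linear.has_vector_derivative[OF bounded_linear_vec_nth assms]
    by (simp add: has_real_derivative_iff_has_vector_derivative)
  have a: "((\<lambda>t. link_angle (Z t) j) has_real_derivative link_angle V j) (at t within S)" for j
    unfolding link_angle_def by (auto intro!: derivative_eq_intros c)
  have vec2: "((\<lambda>t. vector [f t, g t] :: real^2) has_vector_derivative vector [f', g']) (at t within S)"
    if "(f has_real_derivative f') (at t within S)" "(g has_real_derivative g') (at t within S)"
    for f g f' g'
  proof -
    have eq: "(vector [a, b] :: real^2) = a *\<^sub>R axis 1 1 + b *\<^sub>R axis 2 1" for a b
      by (simp add: vec_eq_iff forall_2 axis_def)
    show ?thesis
      unfolding eq using that
      by (auto intro!: derivative_eq_intros simp: has_real_derivative_iff_has_vector_derivative)
  qed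
  have e: "((\<lambda>t. e_par (link_angle (Z t) j)) has_vector_derivative
             link_angle V j *\<^sub>R e_perp (link_angle (Z t) j)) (at t within S)" for j
  proof -
    have "((\<lambda>t. e_par (link_angle (Z t) j)) has_vector_derivative
           vector [- sin (link_angle (Z t) j) * link_angle V j, cos (link_angle (Z t) j) * link_angle V j])
           (at t within S)"
      unfolding e_par_def by (intro vec2) (auto intro!: derivative_eq_intros a)
    moreover have "vector [- sin (link_angle (Z t) j) * link_angle V j, cos (link_angle (Z t) j) * link_angle V j]
        = link_angle V j *\<^sub>R e_perp (link_angle (Z t) j)"
      by (simp add: vec_eq_iff forall_2 e_perp_def)
    ultimately show ?thesis by simp
  qed
  have le: "((\<lambda>t. l *\<^sub>R e_par (link_angle (Z t) j)) has_vector_derivative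
             (l * link_angle V j) *\<^sub>R e_perp (link_angle (Z t) j)) (at t within S)" for j
    using bounded_linear.has_vector_derivative[OF bounded_linear_scaleR_right e] by simp
  show ?thesis
    unfolding link_start_def link_start_vel_def
    by (intro has_vector_derivative_add has_vector_derivative_sum le vec2 c)
qed

definition rot2 :: "real \<Rightarrow> real^2 \<Rightarrow> real^2" where
  "rot2 \<theta> v = vector [cos \<theta> * v$1 + sin \<theta> * v$2, - sin \<theta> * v$1 + cos \<theta> * v$2]"

lemma rot2_linear: "linear (rot2 \<theta>)"
  by (rule linearI) (simp_all add: rot2_def vec_eq_iff forall_2 algebra_simps)

lemmas rot2_simps = linear_add[OF rot2_linear] linear_diff[OF rot2_linear]
  linear_neg[OF rot2_linear] linear_scale[OF rot2_linear] linear_sum[OF rot2_linear]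

lemma rot2_inner: "rot2 \<theta> a \<bullet> rot2 \<theta> b = a \<bullet> b"
proof -
  have "(c * a1 + s * a2) * (c * b1 + s * b2) + (- s * a1 + c * a2) * (- s * b1 + c * b2)
      = (c\<^sup>2 + s\<^sup>2) * (a1 * b1 + a2 * b2)" for c s a1 a2 b1 b2 :: real
    by (simp add: algebra_simps power2_eq_square)
  from this[of "cos \<theta>" "a$1" "sin \<theta>" "a$2" "b$1" "b$2"] show ?thesis
    by (simp add: rot2_def inner_vec_def sum_2)
qed

lemma rot2_cross: "cross_z (rot2 \<theta> a) (rot2 \<theta> b) = cross_z a b"
proof -
  have "(c * a1 + s * a2) * (- s * b1 + c * b2) - (- s * a1 + c * a2) * (c * b1 + s * b2)
      = (c\<^sup>2 + s\<^sup>2) * (a1 * b2 - a2 * b1)" for c s a1 a2 b1 b2 :: real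
    by (simp add: algebra_simps power2_eq_square)
  from this[of "cos \<theta>" "a$1" "sin \<theta>" "a$2" "b$1" "b$2"] show ?thesis
    by (simp add: rot2_def cross_z_def)
qed

lemma rot2_e_par: "rot2 \<theta> (e_par \<phi>) = e_par (\<phi> - \<theta>)"
  and rot2_e_perp: "rot2 \<theta> (e_perp \<phi>) = e_perp (\<phi> - \<theta>)"
  by (simp_all add: rot2_def e_par_def e_perp_def vec_eq_iff forall_2 cos_diff sin_diff algebra_simps)

lemma drag_density_linear: "linear (\<lambda>V. drag_density l \<xi> \<eta> Z V i s)"
proof -
  have a: "link_angle (V + W) j = link_angle V j + link_angle W j"
    "link_angle (c *\<^sub>R V) j = c * link_angle V j" for V W c j
    by (simp_all add: link_angle_def algebra_simps)
  have v: "(vector [a + c, b + d] :: real^2) = vector [a, b] + vector [c, d]"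
    "(vector [k * a, k * b] :: real^2) = k *\<^sub>R vector [a, b]" for a b c d k :: real
    by (simp_all add: vec_eq_iff forall_2)
  have p: "point_vel l Z (V + W) i s = point_vel l Z V i s + point_vel l Z W i s"
    "point_vel l Z (c *\<^sub>R V) i s = c *\<^sub>R point_vel l Z V i s" for V W c
    by (simp_all add: point_vel_def link_start_vel_def a v algebra_simps sum.distrib scaleR_sum_right)
  show ?thesis
    by (rule linearI) (simp_all add: drag_density_def p algebra_simps inner_add_left)
qed

lemma drag_density_continuous: "continuous_on S (drag_density l \<xi> \<eta> Z V i)"
  unfolding drag_density_def point_vel_def by (intro continuous_intros)

lemma cross_z_continuous:
  "continuous_on S f \<Longrightarrow> continuous_on S g \<Longrightarrow> continuous_on S (\<lambda>s. cross_z (f s) (g s))"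
  unfolding cross_z_def by (intro continuous_intros)

lemma drag_vector_linear: "linear (drag_vector l \<xi> \<eta> Z)"
proof -
  note add = linear_add[OF drag_density_linear] and scale = linear_scale[OF drag_density_linear]
  have int: "drag_density l \<xi> \<eta> Z V i integrable_on {0..l}" for V i
    by (intro integrable_continuous_interval drag_density_continuous)
  have intc: "(\<lambda>s. cross_z (link_start l Z i + s *\<^sub>R e_par (link_angle Z i) - p)
                     (drag_density l \<xi> \<eta> Z V i s)) integrable_on {0..l}" for V i p
    by (intro integrable_continuous_interval cross_z_continuous drag_density_continuous continuous_intros)
  have cz: "cross_z a (b + c) = cross_z a b + cross_z a c" "cross_z a (k *\<^sub>R b) = k * cross_z a b"
    for a b c k by (simp_all add: cross_z_def algebra_simps)
  have f: "drag_force l \<xi> \<eta> Z (V + W) i = drag_force l \<xi> \<eta> Z V i + drag_force l \<xi> \<eta> Z W i"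
    "drag_force l \<xi> \<eta> Z (c *\<^sub>R V) i = c *\<^sub>R drag_force l \<xi> \<eta> Z V i" for V W c i
    using integral_add[OF int int] by (simp_all add: drag_force_def add scale cong: integral_cong)
  have t: "drag_torque l \<xi> \<eta> Z (V + W) i p = drag_torque l \<xi> \<eta> Z V i p + drag_torque l \<xi> \<eta> Z W i p"
    "drag_torque l \<xi> \<eta> Z (c *\<^sub>R V) i p = c * drag_torque l \<xi> \<eta> Z V i p" for V W c i p
    using integral_add[OF intc intc] by (simp_all add: drag_torque_def add scale cz)
  show ?thesis
    by (rule linearI)
      (simp_all add: drag_vector_def vec_eq_iff forall_5 f t sum.distrib inner_add_left
        flip: scaleR_sum_right sum_distrib_left)
qed

lemma drag_vector_reduce:
  "drag_vector l \<xi> \<eta> (vector [x, y, \<theta>, \<alpha>1, \<alpha>2]) V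
     = drag_vector l \<xi> \<eta> (vector [0, 0, 0, \<alpha>1, \<alpha>2]) (R_minus \<theta> *v V)"
proof -
  define Z where "Z = (vector [x, y, \<theta>, \<alpha>1, \<alpha>2] :: real^5)"
  define Y where "Y = (vector [0, 0, 0, \<alpha>1, \<alpha>2] :: real^5)"
  define W where "W = R_minus \<theta> *v V"
  have ang: "link_angle Z i = \<theta> + link_angle Y i" for i
    by (simp add: Z_def Y_def link_angle_def)
  have angV: "link_angle W i = link_angle V i" for i
    by (simp add: W_def R_minus_mult link_angle_def)
  have par: "rot2 \<theta> (e_par (link_angle Z i)) = e_par (link_angle Y i)"
    and perp: "rot2 \<theta> (e_perp (link_angle Z i)) = e_perp (link_angle Y i)" for i
    by (simp_all add: rot2_e_par rot2_e_perp ang)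
  have start: "rot2 \<theta> (link_start l Z i - link_start l Z j) = link_start l Y i - link_start l Y j" for i j
    by (simp add: link_start_def rot2_simps par)
  have vel0: "rot2 \<theta> (vector [V$1, V$2]) = vector [W$1, W$2]"
    by (simp add: rot2_def W_def R_minus_mult)
  have pv: "rot2 \<theta> (point_vel l Z V i s) = point_vel l Y W i s" for i s
    by (simp add: point_vel_def link_start_vel_def rot2_simps perp vel0 angV)
  have dens: "rot2 \<theta> (drag_density l \<xi> \<eta> Z V i s) = drag_density l \<xi> \<eta> Y W i s" for i s
    unfolding drag_density_def rot2_simps par perp pv[symmetric]
    by (simp add: rot2_inner flip: par perp)
  have int: "drag_density l \<xi> \<eta> Z V i integrable_on {0..l}" for i
    by (intro integrable_continuous_interval drag_density_continuous)
  have force: "rot2 \<theta> (drag_force l \<xi> \<eta> Z V i) = drag_force l \<xi> \<eta> Y W i" for i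
  proof -
    have "rot2 \<theta> \<circ> drag_density l \<xi> \<eta> Z V i = drag_density l \<xi> \<eta> Y W i"
      by (simp add: fun_eq_iff dens)
    then show ?thesis
      using integral_linear[OF int[of i] linear_conv_bounded_linear[THEN iffD1, OF rot2_linear[of \<theta>]]]
      by (simp add: drag_force_def)
  qed
  have torque: "drag_torque l \<xi> \<eta> Z V i (link_start l Z j) = drag_torque l \<xi> \<eta> Y W i (link_start l Y j)"
    for i j
  proof -
    have "cross_z (link_start l Z i + s *\<^sub>R e_par (link_angle Z i) - link_start l Z j)
              (drag_density l \<xi> \<eta> Z V i s)
        = cross_z (link_start l Y i + s *\<^sub>R e_par (link_angle Y i) - link_start l Y j)
              (drag_density l \<xi> \<eta> Y W i s)" for s
    proof -
      have "rot2 \<theta> (link_start l Z i + s *\<^sub>R e_par (link_angle Z i) - link_start l Z j)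
          = link_start l Y i + s *\<^sub>R e_par (link_angle Y i) - link_start l Y j"
        using start[of i j] by (simp add: rot2_simps par algebra_simps)
      then show ?thesis by (metis rot2_cross dens)
    qed
    then show ?thesis by (simp add: drag_torque_def)
  qed
  have sums: "rot2 \<theta> (\<Sum>i=1..3. drag_force l \<xi> \<eta> Z V i) = (\<Sum>i=1..3. drag_force l \<xi> \<eta> Y W i)"
    by (simp add: rot2_simps force)
  have "(\<Sum>i=1..3. drag_force l \<xi> \<eta> Z V i) \<bullet> e_par (link_angle Z 1)
      = (\<Sum>i=1..3. drag_force l \<xi> \<eta> Y W i) \<bullet> e_par (link_angle Y 1)"
    by (metis rot2_inner sums par)
  moreover have "(\<Sum>i=1..3. drag_force l \<xi> \<eta> Z V i) \<bullet> e_perp (link_angle Z 1)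
      = (\<Sum>i=1..3. drag_force l \<xi> \<eta> Y W i) \<bullet> e_perp (link_angle Y 1)"
    by (metis rot2_inner sums perp)
  ultimately have "drag_vector l \<xi> \<eta> Z V = drag_vector l \<xi> \<eta> Y W"
    by (simp only: drag_vector_def torque)
  then show ?thesis by (simp add: Z_def Y_def W_def)
qed

lemma drag_matrix_ex1:
  "\<exists>!A. \<forall>x y \<theta> V. drag_vector l \<xi> \<eta> (vector [x, y, \<theta>, \<alpha>1, \<alpha>2]) V = A *v (R_minus \<theta> *v V)"
proof (rule ex1I)
  have "drag_vector l \<xi> \<eta> (vector [0, 0, 0, \<alpha>1, \<alpha>2]) W
      = matrix (drag_vector l \<xi> \<eta> (vector [0, 0, 0, \<alpha>1, \<alpha>2])) *v W" for W
    by (rule matrix_works[symmetric]) (simp add: drag_vector_linear linear_matrix_vector_mul_eq)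
  then show "\<forall>x y \<theta> V. drag_vector l \<xi> \<eta> (vector [x, y, \<theta>, \<alpha>1, \<alpha>2]) V
      = matrix (drag_vector l \<xi> \<eta> (vector [0, 0, 0, \<alpha>1, \<alpha>2])) *v (R_minus \<theta> *v V)"
    by (metis drag_vector_reduce)
next
  fix A
  assume A: "\<forall>x y \<theta> V. drag_vector l \<xi> \<eta> (vector [x, y, \<theta>, \<alpha>1, \<alpha>2]) V = A *v (R_minus \<theta> *v V)"
  have "R_minus 0 *v V = V" for V
    by (simp add: R_minus_mult vec_eq_iff forall_5)
  with A have "drag_vector l \<xi> \<eta> (vector [0, 0, 0, \<alpha>1, \<alpha>2]) V = A *v V" for V
    by metis
  then show "A = matrix (drag_vector l \<xi> \<eta> (vector [0, 0, 0, \<alpha>1, \<alpha>2]))"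
    by (metis ext matrix_of_matrix_vector_mul)
qed

lemma drag_vector_eq:
  "drag_vector l \<xi> \<eta> Z V = drag_matrix l \<xi> \<eta> (Z$4) (Z$5) *v (R_minus (Z$3) *v V)"
proof -
  have "Z = vector [Z$1, Z$2, Z$3, Z$4, Z$5]"
    by (simp add: vec_eq_iff forall_5)
  moreover have "drag_vector l \<xi> \<eta> (vector [Z$1, Z$2, Z$3, Z$4, Z$5]) V
      = drag_matrix l \<xi> \<eta> (Z$4) (Z$5) *v (R_minus (Z$3) *v V)"
    using theI'[OF drag_matrix_ex1[of l \<xi> \<eta> "Z$4" "Z$5"]]
    unfolding drag_matrix_def by (elim allE)
  ultimately show ?thesis by (rule ssubst[where P = "\<lambda>Y. drag_vector l \<xi> \<eta> Y V = _"])
qed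

lemma invertible_R_minus: "invertible (R_minus \<theta>)"
proof -
  have "R_minus \<theta> ** R_minus (- \<theta>) = mat 1" for \<theta>
  proof -
    have "cos \<theta> * cos \<theta> + sin \<theta> * sin \<theta> = 1"
      by (metis power2_eq_square sin_cos_squared_add2)
    then show ?thesis
      by (simp add: vec_eq_iff forall_5 matrix_matrix_mult_def sum_5 mat_def R_minus_def algebra_simps)
  qed
  from this[of \<theta>] this[of "- \<theta>"] show ?thesis
    unfolding invertible_def by auto
qed

lemma swimmer_field_eq:
  assumes "swimmer_field l \<xi> \<eta> \<kappa> M1 M2 M3 \<alpha>0 q p u = (q', p')"
  shows "R_minus (p$1) *v state q' p' =
    F0 l \<xi> \<eta> \<kappa> \<alpha>0 (p$2) (p$3) + (u$1) *\<^sub>R F1 l \<xi> \<eta> M2 M3 (p$2) (p$3)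
    + (u$2) *\<^sub>R F2 l \<xi> \<eta> M1 M2 M3 (p$2) (p$3)"
proof -
  have "state (state_xy V) (state_angles V) = V" for V
    by (simp add: state_def state_xy_def state_angles_def vec_eq_iff forall_5)
  moreover have "R_minus (p$1) *v (matrix_inv (R_minus (p$1)) *v w) = w" for w
  proof -
    have "R_minus (p$1) ** matrix_inv (R_minus (p$1)) = mat 1"
      using someI_ex[OF invertible_R_minus[unfolded invertible_def]] unfolding matrix_inv_def by blast
    then show ?thesis by (simp add: matrix_vector_mul_assoc)
  qed
  ultimately show ?thesis
    using assms by (auto simp: swimmer_field_def Let_def)
qed

end

theory Submission
  imports Defs
begin

text \<open>
  The system is linearised at the equilibrium as \<open>z' = A z + B u\<close> and satisfies the partial Kalman condition
  already with \<open>B\<close> and \<open>A B\<close>: no nonzero covector on the \<open>(x, y)\<close>-plane annihilates both. Since the drag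
  matrix is symmetric, such a covector would produce a motion without torques and a pure translation with prescribed
  torques, whose balances force the ratio of the same two link angular velocities to be negative and positive,
  respectively. The nonlinear system then follows the linear one up to a quadratic error, so the endpoint map is close
  to a translation of the control parameter and Brouwer's theorem reaches every nearby target.
\<close>

text \<open>The inverse of the 5 by 5 drag matrix is never computed. The velocity enters only as the
  solution of a linear equation "drag of \<open>V\<close> equals load", and a lower bound on the
  dissipated power, uniform in the configuration, yields invertibility, the Lipschitz bounds and the
  quadratic remainder. The load vanishes at the equilibrium, so the linearisation may freeze the
  drag matrix there.

  The horizon is the prescribed \<open>\<epsilon>\<close>, so the \<open>A A B\<close> terms left
  over when only \<open>B\<close> and \<open>A B\<close> are used are not made small by a short time
  but by profiles concentrated near its end. Such profiles need large controls per unit of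
  displacement; this is paid for by small displacements. Hence the order of choice: tolerance
  \<open>\<sigma>\<close>, profiles, radius \<open>\<rho>\<close>, and last \<open>\<delta>\<close>.

  The bend enters through \<open>M3 * sin \<alpha>0\<close>, the size of the load that the parallel
  field exerts at equilibrium; it would be 0 for a straight swimmer. Being nonzero, it forces the
  third link not to rotate in the motions produced by an annihilating covector, which leaves only
  two angular velocities to compare.\<close>

section \<open>Integral equations\<close>

text \<open>The right-hand side of the hypothesis, multiplied by \<open>exp (- L * t)\<close>, has
  nonpositive derivative by that same hypothesis, so it stays below its initial value
  \<open>a\<close>.\<close>

lemma gronwall_integral:
  fixes \<phi> :: "real \<Rightarrow> real"
  assumes cont: "continuous_on {0..T} \<phi>" and "0 \<le> L"
    and le: "\<And>t. t \<in> {0..T} \<Longrightarrow> \<phi> t \<le> a + L * integral {0..t} \<phi>"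
    and t: "t \<in> {0..T}"
  shows "\<phi> t \<le> a * exp (L * t)"
proof -
  define g where "g s = (a + L * integral {0..s} \<phi>) * exp (- L * s)" for s
  have der: "(g has_real_derivative L * (\<phi> s - (a + L * integral {0..s} \<phi>)) * exp (- L * s)) (at s within {0..T})"
    if "s \<in> {0..T}" for s
    unfolding g_def[abs_def]
    by (rule derivative_eq_intros integral_has_real_derivative[OF cont that] refl)+ (simp add: algebra_simps)
  have "g t \<le> g 0"
  proof (rule DERIV_nonpos_imp_decreasing_open[where f = g and a = 0 and b = t])
    show "0 \<le> t" using t by simp
    show "continuous_on {0..t} g"
      using t by (intro DERIV_continuous_on[OF DERIV_subset[OF der]]) auto
    fix s assume s: "0 < s" "s < t"
    then have "(g has_real_derivative L * (\<phi> s - (a + L * integral {0..s} \<phi>)) * exp (- L * s)) (at s)"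
      using der[of s] t at_within_interior[of s "{0..T}"] by auto
    moreover have "L * (\<phi> s - (a + L * integral {0..s} \<phi>)) * exp (- L * s) \<le> 0"
      using le[of s] s t \<open>0 \<le> L\<close> by (intro mult_nonpos_nonneg mult_nonneg_nonpos) auto
    ultimately show "\<exists>y. (g has_real_derivative y) (at s) \<and> y \<le> 0" by blast
  qed
  then have "(a + L * integral {0..t} \<phi>) * exp (- L * t) * exp (L * t) \<le> a * exp (L * t)"
    unfolding g_def by (intro mult_right_mono) auto
  then show ?thesis
    using le[OF t] by (simp add: mult.assoc flip: exp_add)
qed

text \<open>The function \<open>d\<close> is the defect with which the two right-hand sides fail to
  come from the same Lipschitz field. Three uses follow: distance of a solution from the reference
  curve, Lipschitz dependence on the control parameter, and uniqueness (\<open>d = 0\<close>). Only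
  integrability of \<open>g\<close> and \<open>g'\<close> is assumed, so that Caratheodory solutions
  are covered.\<close>

lemma gronwall_diff:
  fixes z z' g g' :: "real \<Rightarrow> 'z::euclidean_space"
  assumes cont: "continuous_on {0..T} z" "continuous_on {0..T} z'"
    and int: "g integrable_on {0..T}" "g' integrable_on {0..T}"
    and z: "\<And>t. t \<in> {0..T} \<Longrightarrow> z t = z0 + integral {0..t} g"
    and z': "\<And>t. t \<in> {0..T} \<Longrightarrow> z' t = z0' + integral {0..t} g'"
    and d: "d integrable_on {0..T}" "\<And>t. t \<in> {0..T} \<Longrightarrow> 0 \<le> d t"
    and L: "0 \<le> L" "\<And>t. t \<in> {0..T} \<Longrightarrow> norm (g t - g' t) \<le> L * norm (z t - z' t) + d t"
    and t: "t \<in> {0..T}"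
  shows "norm (z t - z' t) \<le> (norm (z0 - z0') + integral {0..T} d) * exp (L * t)"
proof (rule gronwall_integral[OF _ L(1) _ t])
  show cn: "continuous_on {0..T} (\<lambda>t. norm (z t - z' t))"
    by (intro continuous_intros cont)
  fix t assume t: "t \<in> {0..T}"
  then have sub: "{0..t} \<subseteq> {0..T}" by auto
  have i: "g integrable_on {0..t}" "g' integrable_on {0..t}" "d integrable_on {0..t}"
    "(\<lambda>t. norm (z t - z' t)) integrable_on {0..t}"
    using int d(1) integrable_continuous_interval[OF cn] sub by (auto intro: integrable_on_subinterval)
  have iL: "(\<lambda>t. L * norm (z t - z' t)) integrable_on {0..t}"
    by (intro integrable_continuous_interval continuous_intros continuous_on_subset[OF cont(1) sub]
        continuous_on_subset[OF cont(2) sub])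
  have "norm (z t - z' t) = norm ((z0 - z0') + integral {0..t} (\<lambda>s. g s - g' s))"
    using z[OF t] z'[OF t] i by (simp add: integral_diff algebra_simps)
  also have "\<dots> \<le> norm (z0 - z0') + norm (integral {0..t} (\<lambda>s. g s - g' s))"
    by (rule norm_triangle_ineq)
  also have "norm (integral {0..t} (\<lambda>s. g s - g' s)) \<le> integral {0..t} (\<lambda>s. L * norm (z s - z' s) + d s)"
    using i iL L(2) sub
    by (intro Henstock_Kurzweil_Integration.integral_norm_bound_integral integrable_diff integrable_add) auto
  also have "\<dots> = L * integral {0..t} (\<lambda>s. norm (z s - z' s)) + integral {0..t} d"
    using i iL by (subst integral_add) auto
  also have "integral {0..t} d \<le> integral {0..T} d"
    using d i sub by (intro integral_subset_le) auto
  finally show "norm (z t - z' t) \<le> norm (z0 - z0') + integral {0..T} d + L * integral {0..t} (\<lambda>s. norm (z s - z' s))"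
    by simp
qed

lemma integral_exp_scaled:
  fixes K t :: real
  assumes "K > 0" "t \<ge> 0"
  shows "((\<lambda>s. exp (K * s)) has_integral (exp (K * t) - 1) / K) {0..t}"
proof -
  have "((\<lambda>s. exp (K * s)) has_integral exp (K * t) / K - exp (K * 0) / K) {0..t}"
    using assms
    by (intro fundamental_theorem_of_calculus)
      (auto intro!: derivative_eq_intros simp flip: has_real_derivative_iff_has_vector_derivative)
  then show ?thesis by (simp add: diff_divide_distrib)
qed

text \<open>
  The Picard operator is a contraction for the norm \<open>sup exp (- K t) * norm (z t)\<close> with \<open>K > L\<close>, so that no
  smallness of \<open>T\<close> is needed; \<open>\<zeta>\<close> below is \<open>exp (- K t) * z t\<close>.
\<close>

lemma picard_global:
  fixes f :: "real \<Rightarrow> 'z::euclidean_space \<Rightarrow> 'z"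
  assumes cont: "continuous_on ({0..T} \<times> UNIV) (\<lambda>(t, z). f t z)" and "0 \<le> T" "0 \<le> L"
    and lip: "\<And>t z z'. t \<in> {0..T} \<Longrightarrow> norm (f t z - f t z') \<le> L * norm (z - z')"
  shows "\<exists>z. continuous_on {0..T} z \<and> (\<forall>t\<in>{0..T}. z t = z0 + integral {0..t} (\<lambda>s. f s (z s)))"
proof -
  define K where "K = L + 1"
  have K: "K > 0" using \<open>0 \<le> L\<close> by (simp add: K_def)
  \<comment> \<open>Clamping time to \<open>{0..T}\<close> extends functions on the interval to
    bounded continuous functions on the whole line, where the complete metric space
    \<open>bcontfun\<close> is available for Banach's theorem.\<close>
  define c where "c t = max 0 (min T t)" for t :: real
  have c: "c t \<in> {0..T}" "0 \<le> c t" "c t \<le> T" for t using \<open>0 \<le> T\<close> by (auto simp: c_def)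
  have c_id: "c t = t" if "t \<in> {0..T}" for t using that by (auto simp: c_def)
  have cont_c: "continuous_on UNIV c" unfolding c_def by (intro continuous_intros)
  define I where "I \<zeta> s = f s (exp (K * s) *\<^sub>R \<zeta> s)" for \<zeta> :: "real \<Rightarrow> 'z" and s
  have cont_I: "continuous_on {0..T} (I \<zeta>)" if "continuous_on {0..T} \<zeta>" for \<zeta>
  proof -
    have "continuous_on {0..T} (\<lambda>s. (s, exp (K * s) *\<^sub>R \<zeta> s))"
      by (intro continuous_intros that)
    from continuous_on_compose2[OF cont this] show ?thesis by (auto simp: I_def[abs_def])
  qed
  define P where "P \<zeta> t = exp (- K * t) *\<^sub>R (z0 + integral {0..t} (I \<zeta>))" for \<zeta> t
  have cont_P: "continuous_on {0..T} (P \<zeta>)" if "continuous_on {0..T} \<zeta>" for \<zeta>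
    unfolding P_def
    by (intro continuous_intros indefinite_integral_continuous_1 integrable_continuous_interval cont_I that)
  have mem: "(\<lambda>t. P (apply_bcontfun \<zeta>) (c t)) \<in> bcontfun" for \<zeta>
  proof -
    let ?P = "P (apply_bcontfun \<zeta>)"
    have "continuous_on UNIV (\<lambda>t. ?P (c t))"
      by (rule continuous_on_compose2[OF cont_P cont_c]) (use c in auto)
    moreover have "bounded (?P ` {0..T})"
      by (intro compact_imp_bounded compact_continuous_image cont_P) auto
    then have "bounded (range (\<lambda>t. ?P (c t)))"
      by (rule bounded_subset) (use c in auto)
    ultimately show ?thesis by (simp add: bcontfun_def)
  qed
  define \<Phi> where "\<Phi> \<zeta> = Bcontfun (\<lambda>t. P (apply_bcontfun \<zeta>) (c t))" for \<zeta> :: "real \<Rightarrow>\<^sub>C 'z"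
  have \<Phi>: "apply_bcontfun (\<Phi> \<zeta>) t = P (apply_bcontfun \<zeta>) (c t)" for \<zeta> t
    unfolding \<Phi>_def by (simp add: Bcontfun_inverse mem)
  have contr: "dist (\<Phi> \<zeta>) (\<Phi> \<zeta>') \<le> L / K * dist \<zeta> \<zeta>'" for \<zeta> \<zeta>'
  proof (rule dist_bound)
    fix t
    let ?z = "apply_bcontfun \<zeta>" and ?z' = "apply_bcontfun \<zeta>'" and ?t = "c t"
    have i: "I ?z integrable_on {0..?t}" "I ?z' integrable_on {0..?t}"
      using c[of t] by (auto intro!: integrable_continuous_interval continuous_on_subset[OF cont_I])
    have bd: "norm (I ?z s - I ?z' s) \<le> L * dist \<zeta> \<zeta>' * exp (K * s)" if "s \<in> {0..?t}" for s
    proof -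
      have "norm (I ?z s - I ?z' s) \<le> L * norm (exp (K * s) *\<^sub>R ?z s - exp (K * s) *\<^sub>R ?z' s)"
        unfolding I_def using c[of t] that by (intro lip) auto
      also have "\<dots> = L * (exp (K * s) * dist (?z s) (?z' s))"
        by (simp add: dist_norm flip: scaleR_diff_right)
      also have "\<dots> \<le> L * (exp (K * s) * dist \<zeta> \<zeta>')"
        using \<open>0 \<le> L\<close> by (intro mult_left_mono dist_bounded) auto
      finally show ?thesis by (simp add: mult_ac)
    qed
    have hi: "((\<lambda>s. L * dist \<zeta> \<zeta>' * exp (K * s)) has_integral L * dist \<zeta> \<zeta>' * ((exp (K * ?t) - 1) / K)) {0..?t}"
      by (intro has_integral_mult_right integral_exp_scaled K c)
    have "dist (P ?z ?t) (P ?z' ?t) = norm (exp (- K * ?t) *\<^sub>R integral {0..?t} (\<lambda>s. I ?z s - I ?z' s))"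
      using i by (simp add: P_def dist_norm integral_diff flip: scaleR_diff_right)
    also have "\<dots> = exp (- K * ?t) * norm (integral {0..?t} (\<lambda>s. I ?z s - I ?z' s))"
      by simp
    also have "\<dots> \<le> exp (- K * ?t) * (L * dist \<zeta> \<zeta>' * ((exp (K * ?t) - 1) / K))"
      unfolding integral_unique[OF hi, symmetric] using i hi bd
      by (intro mult_left_mono Henstock_Kurzweil_Integration.integral_norm_bound_integral integrable_diff) auto
    also have "\<dots> = L / K * dist \<zeta> \<zeta>' * (1 - exp (- K * ?t))"
      using K by (simp add: field_simps exp_minus)
    also have "\<dots> \<le> L / K * dist \<zeta> \<zeta>' * 1"
      using K \<open>0 \<le> L\<close> by (intro mult_left_mono) auto
    finally show "dist (apply_bcontfun (\<Phi> \<zeta>) t) (apply_bcontfun (\<Phi> \<zeta>') t) \<le> L / K * dist \<zeta> \<zeta>'"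
      by (simp add: \<Phi>)
  qed
  have "\<exists>!\<zeta>. \<Phi> \<zeta> = \<zeta>"
    by (rule banach_fix_type[of "L / K"]) (use contr K \<open>0 \<le> L\<close> in \<open>auto simp: K_def\<close>)
  then obtain \<zeta> where \<zeta>: "\<Phi> \<zeta> = \<zeta>" by blast
  define z where "z t = exp (K * t) *\<^sub>R apply_bcontfun \<zeta> t" for t
  have I: "I (apply_bcontfun \<zeta>) = (\<lambda>s. f s (z s))"
    by (simp add: I_def z_def fun_eq_iff)
  have "z t = z0 + integral {0..t} (\<lambda>s. f s (z s))" if "t \<in> {0..T}" for t
  proof -
    have "apply_bcontfun \<zeta> t = P (apply_bcontfun \<zeta>) t"
      using \<Phi>[of \<zeta> t] that by (simp add: \<zeta> c_id)
    then have "z t = (exp (K * t) * exp (- K * t)) *\<^sub>R (z0 + integral {0..t} (I (apply_bcontfun \<zeta>)))"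
      by (simp add: z_def P_def)
    then show ?thesis by (simp add: I flip: exp_add)
  qed
  moreover have "continuous_on {0..T} z"
    unfolding z_def by (intro continuous_intros) auto
  ultimately show ?thesis by blast
qed

section \<open>The linear test for partial controllability\<close>

text \<open>The Kalman hypothesis says that the range of
  \<open>(v0, v1) \<mapsto> fst (B v0 + A (B v1))\<close> has trivial orthogonal complement, so this
  map is onto and has a linear right inverse. Linearity matters: the control and all error terms
  then scale with the norm of the wanted displacement.\<close>

lemma linear_inverse_from_kalman:
  fixes A :: "'a::euclidean_space \<times> 'b::euclidean_space \<Rightarrow> 'a \<times> 'b" and B :: "'c::euclidean_space \<Rightarrow> 'a \<times> 'b"
  assumes lin: "linear A" "linear B"
    and kalman: "\<forall>\<mu>. (\<forall>u. \<mu> \<bullet> fst (B u) = 0 \<and> \<mu> \<bullet> fst (A (B u)) = 0) \<longrightarrow> \<mu> = 0"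
  obtains V0 V1 :: "'a \<Rightarrow> 'c" where "linear V0" "linear V1" "\<And>w. fst (B (V0 w) + A (B (V1 w))) = w"
proof -
  define \<Phi> where "\<Phi> v = fst (B (fst v) + A (B (snd v)))" for v :: "'c \<times> 'c"
  have lin\<Phi>: "linear \<Phi>"
    by (rule linearI)
      (simp_all add: \<Phi>_def linear_add[OF lin(1)] linear_add[OF lin(2)] linear_scale[OF lin(1)]
        linear_scale[OF lin(2)] algebra_simps)
  have "range \<Phi> = UNIV"
  proof (rule ccontr)
    assume "range \<Phi> \<noteq> UNIV"
    moreover have "span (range \<Phi>) = range \<Phi>"
      by (intro span_eq_iff[THEN iffD2] linear_subspace_image[OF lin\<Phi>] subspace_UNIV)
    ultimately obtain \<mu> where \<mu>: "\<mu> \<noteq> 0" "\<forall>x \<in> range \<Phi>. \<mu> \<bullet> x = 0"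
      by (metis span_not_UNIV_orthogonal)
    have "\<mu> \<bullet> fst (B u) = 0" for u
      using \<mu>(2)[rule_format, OF rangeI, of "(u, 0)"] by (simp add: \<Phi>_def linear_0[OF lin(1)] linear_0[OF lin(2)])
    moreover have "\<mu> \<bullet> fst (A (B u)) = 0" for u
      using \<mu>(2)[rule_format, OF rangeI, of "(0, u)"] by (simp add: \<Phi>_def linear_0[OF lin(2)])
    ultimately show False using kalman \<mu>(1) by blast
  qed
  then obtain G where G: "linear G" "\<Phi> \<circ> G = id"
    using linear_surjective_right_inverse[OF lin\<Phi>] by blast
  show ?thesis
  proof
    show "linear (\<lambda>w. fst (G w))" "linear (\<lambda>w. snd (G w))"
      using G(1) by (auto intro!: linearI simp: linear_add linear_scale)
    show "fst (B (fst (G w)) + A (B (snd (G w)))) = w" for w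
      using fun_cong[OF G(2), of w] by (simp add: \<Phi>_def)
  qed
qed

lemma linear_maps_common_bound:
  fixes G :: "('a::euclidean_space \<Rightarrow> 'b::real_normed_vector) set"
  assumes "finite G" "\<And>g. g \<in> G \<Longrightarrow> linear g"
  shows "\<exists>D\<ge>0. \<forall>g\<in>G. \<forall>x. norm (g x) \<le> D * norm x"
  using assms
proof (induction G rule: finite_induct)
  case (insert g G)
  then obtain D where D: "D \<ge> 0" "\<forall>g\<in>G. \<forall>x. norm (g x) \<le> D * norm x" by auto
  obtain K where K: "\<forall>x. norm (g x) \<le> K * norm x"
    using linear_bounded[of g] insert.prems by auto
  have "norm (h x) \<le> max K D * norm x" if "h \<in> insert g G" for h x
  proof -
    have "norm (h x) \<le> (if h = g then K else D) * norm x" using D K that by auto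
    also have "\<dots> \<le> max K D * norm x" by (intro mult_right_mono) auto
    finally show ?thesis .
  qed
  then show ?case using D by (intro exI[of _ "max K D"]) auto
qed auto

lemma continuous_functions_common_bound:
  fixes G :: "(real \<Rightarrow> real) set"
  assumes "finite G" "\<And>g. g \<in> G \<Longrightarrow> continuous_on {a..b} g"
  shows "\<exists>K\<ge>0. \<forall>g\<in>G. \<forall>t\<in>{a..b}. \<bar>g t\<bar> \<le> K"
  using assms
proof (induction G rule: finite_induct)
  case (insert g G)
  then obtain D where D: "D \<ge> 0" "\<forall>g\<in>G. \<forall>t\<in>{a..b}. \<bar>g t\<bar> \<le> D" by auto
  have "bounded (g ` {a..b})"
    using insert.prems by (intro compact_imp_bounded compact_continuous_image) auto
  then obtain K where K: "\<forall>t\<in>{a..b}. \<bar>g t\<bar> \<le> K" by (auto simp: bounded_iff)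
  show ?case
    using D K by (intro exI[of _ "max K D"]) (auto intro: max.coboundedI1 max.coboundedI2)
qed auto

text \<open>With controls \<open>p''\<close> and \<open>q''\<close>, the directions \<open>B\<close>
  are weighted by \<open>p'\<close>, \<open>q'\<close> and the directions \<open>A B\<close> by
  \<open>p\<close>, \<open>q\<close>. The end values make \<open>p\<close> contribute exactly
  \<open>B\<close> and \<open>q\<close> exactly \<open>A B\<close>. High powers of
  \<open>t / T\<close> meet these end conditions while the \<open>L\<^sup>1\<close> norm tends to 0
  with growing degree; exponents at least 2 in \<open>p\<close> and \<open>q\<close> make both and
  their derivatives vanish at 0.\<close>

lemma steering_profiles:
  fixes T \<sigma> :: real
  assumes "0 < T" "0 < \<sigma>"
  obtains p p' p'' q q' q'' :: "real \<Rightarrow> real" where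
    "\<And>t. (p has_real_derivative p' t) (at t)" "\<And>t. (p' has_real_derivative p'' t) (at t)"
    "\<And>t. (q has_real_derivative q' t) (at t)" "\<And>t. (q' has_real_derivative q'' t) (at t)"
    "continuous_on UNIV p''" "continuous_on UNIV q''"
    "p 0 = 0" "p' 0 = 0" "q 0 = 0" "q' 0 = 0"
    "p T = 0" "p' T = 1" "q T = 1" "q' T = 0"
    "integral {0..T} (\<lambda>t. \<bar>p t\<bar> + \<bar>q t\<bar>) \<le> \<sigma>"
proof -
  \<comment> \<open>The integral computed below is at most
    \<open>(T\<^sup>2 + 2 * T) / (n + 4)\<close>.\<close>
  obtain n :: nat where n: "(T\<^sup>2 + 2 * T) / \<sigma> \<le> n"
    using real_arch_simple by blast
  define p where "p t = T * ((t / T) ^ (n + 3) - (t / T) ^ (n + 2))" for t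
  define p' where "p' t = (n + 3) * (t / T) ^ (n + 2) - (n + 2) * (t / T) ^ (n + 1)" for t
  define p'' where "p'' t = ((n + 3) * (n + 2) * (t / T) ^ (n + 1) - (n + 2) * (n + 1) * (t / T) ^ n) / T" for t
  define q where "q t = (n + 3) * (t / T) ^ (n + 2) - (n + 2) * (t / T) ^ (n + 3)" for t
  define q' where "q' t = (n + 3) * (n + 2) / T * ((t / T) ^ (n + 1) - (t / T) ^ (n + 2))" for t
  define q'' where "q'' t = (n + 3) * (n + 2) / T\<^sup>2 * ((n + 1) * (t / T) ^ n - (n + 2) * (t / T) ^ (n + 1))" for t
  have pw: "((\<lambda>t. (t / T) ^ Suc m) has_real_derivative (Suc m) * (t / T) ^ m / T) (at t)" for m t
    using DERIV_power[OF DERIV_cdivide[OF DERIV_ident, of T], where n = "Suc m" and x = t and s = UNIV] \<open>0 < T\<close>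
    by (simp add: field_simps)
  have pw3: "((\<lambda>t. (t / T) ^ (n + 3)) has_real_derivative (n + 3) * (t / T) ^ (n + 2) / T) (at t)"
    and pw2: "((\<lambda>t. (t / T) ^ (n + 2)) has_real_derivative (n + 2) * (t / T) ^ (n + 1) / T) (at t)"
    and pw1: "((\<lambda>t. (t / T) ^ (n + 1)) has_real_derivative (n + 1) * (t / T) ^ n / T) (at t)" for t
    using pw[of "n + 2" t] pw[of "n + 1" t] pw[of n t] by (simp_all add: numeral_3_eq_3 add_ac)
  have int_pw: "((\<lambda>t. (t / T) ^ m) has_integral T / (Suc m)) {0..T}" for m
  proof -
    have "((\<lambda>t. T / Suc m * (t / T) ^ Suc m) has_real_derivative (t / T) ^ m) (at t within {0..T})" for t
      using DERIV_cmult[OF pw, of "T / Suc m" m t] \<open>0 < T\<close>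
      by (simp add: has_field_derivative_at_within del: of_nat_Suc)
    then have "((\<lambda>t. (t / T) ^ m) has_integral T / (Suc m) * (T / T) ^ Suc m - T / (Suc m) * (0 / T) ^ Suc m) {0..T}"
      using \<open>0 < T\<close>
      by (intro fundamental_theorem_of_calculus) (auto simp flip: has_real_derivative_iff_has_vector_derivative)
    then show ?thesis using \<open>0 < T\<close> by simp
  qed
  \<comment> \<open>On the interval \<open>p\<close> is nonpositive and \<open>q\<close>
    nonnegative, so the absolute values are again polynomials.\<close>
  have sgn: "\<bar>p t\<bar> + \<bar>q t\<bar> = T * ((t / T) ^ (n + 2) - (t / T) ^ (n + 3))
      + ((n + 3) * (t / T) ^ (n + 2) - (n + 2) * (t / T) ^ (n + 3))" if "t \<in> {0..T}" for t
  proof -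
    have s: "0 \<le> t / T" "t / T \<le> 1" using that \<open>0 < T\<close> by auto
    have le: "(t / T) ^ (n + 3) \<le> (t / T) ^ (n + 2)" using s by (intro power_decreasing) auto
    have "(n + 2) * (t / T) ^ (n + 3) \<le> (n + 3) * (t / T) ^ (n + 2)"
      using le s by (intro mult_mono) auto
    then have "\<bar>q t\<bar> = q t" by (simp add: q_def)
    moreover have "\<bar>p t\<bar> = T * ((t / T) ^ (n + 2) - (t / T) ^ (n + 3))"
      using le \<open>0 < T\<close> by (simp add: p_def abs_mult)
    ultimately show ?thesis by (simp add: q_def)
  qed
  have "((\<lambda>t. T * ((t / T) ^ (n + 2) - (t / T) ^ (n + 3)) + ((n + 3) * (t / T) ^ (n + 2) - (n + 2) * (t / T) ^ (n + 3)))
      has_integral T * (T / Suc (n + 2) - T / Suc (n + 3)) + ((n + 3) * (T / Suc (n + 2)) - (n + 2) * (T / Suc (n + 3)))) {0..T}"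
    by (intro has_integral_add has_integral_diff has_integral_mult_right int_pw)
  then have "integral {0..T} (\<lambda>t. \<bar>p t\<bar> + \<bar>q t\<bar>)
      = T * (T / Suc (n + 2) - T / Suc (n + 3)) + ((n + 3) * (T / Suc (n + 2)) - (n + 2) * (T / Suc (n + 3)))"
    using sgn by (metis (no_types, lifting) has_integral_cong integral_unique)
  also have "\<dots> = T\<^sup>2 * (1 / ((n + 3) * (n + 4))) + 2 * T / (n + 4)"
  proof -
    have *: "T / (x + 3) - T / (x + 4) = T / ((x + 3) * (x + 4))"
      "(x + 3) * (T / (x + 3)) - (x + 2) * (T / (x + 4)) = 2 * T / (x + 4)" if "x \<ge> 0" for x :: real
      using that by (simp_all add: divide_simps) (simp_all add: algebra_simps)
    show ?thesis
      using *[of "real n"] by (simp add: power2_eq_square add_ac)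
  qed
  also have "\<dots> \<le> T\<^sup>2 * (1 / (n + 4)) + 2 * T / (n + 4)"
  proof -
    have "real (n + 4) \<le> real ((n + 3) * (n + 4))" unfolding of_nat_le_iff by simp
    then show ?thesis by (intro add_right_mono mult_left_mono frac_le) auto
  qed
  also have "\<dots> = (T\<^sup>2 + 2 * T) / (n + 4)" by (simp add: add_divide_distrib)
  also have "\<dots> \<le> \<sigma>"
  proof -
    have "T\<^sup>2 + 2 * T \<le> n * \<sigma>" using n \<open>0 < \<sigma>\<close> by (simp add: field_simps)
    also have "\<dots> \<le> (n + 4) * \<sigma>" using \<open>0 < \<sigma>\<close> by (intro mult_right_mono) auto
    finally show ?thesis by (simp add: field_simps)
  qed
  finally have int: "integral {0..T} (\<lambda>t. \<bar>p t\<bar> + \<bar>q t\<bar>) \<le> \<sigma>" .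
  show ?thesis
  proof (rule that[of p p' p'' q q' q''])
    show "(p has_real_derivative p' t) (at t)" for t
      unfolding p_def[abs_def]
      by (rule DERIV_cong[OF DERIV_cmult[OF DERIV_diff[OF pw3 pw2], of T]])
        (use \<open>0 < T\<close> in \<open>simp add: p'_def right_diff_distrib\<close>)
    show "(p' has_real_derivative p'' t) (at t)" for t
      unfolding p'_def[abs_def]
      by (rule DERIV_cong[OF DERIV_diff[OF DERIV_cmult[OF pw2] DERIV_cmult[OF pw1]]])
        (simp add: p''_def diff_divide_distrib add_divide_distrib algebra_simps)
    show "(q has_real_derivative q' t) (at t)" for t
      unfolding q_def[abs_def]
      by (rule DERIV_cong[OF DERIV_diff[OF DERIV_cmult[OF pw2] DERIV_cmult[OF pw3]]])
        (simp add: q'_def diff_divide_distrib add_divide_distrib algebra_simps)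
    show "(q' has_real_derivative q'' t) (at t)" for t
      unfolding q'_def[abs_def]
      by (rule DERIV_cong[OF DERIV_cmult[OF DERIV_diff[OF pw1 pw2]]])
        (simp add: q''_def diff_divide_distrib add_divide_distrib power2_eq_square algebra_simps)
    show "continuous_on UNIV p''" "continuous_on UNIV q''"
      unfolding p''_def[abs_def] q''_def[abs_def] by (intro continuous_intros; use \<open>0 < T\<close> in simp)+
  qed (use \<open>0 < T\<close> int in \<open>auto simp: p_def p'_def q_def q'_def\<close>)
qed

section \<open>From the linear test to the nonlinear endpoint map\<close>

lemma norm_proj: "norm (fst v) \<le> norm v" "norm (snd v) \<le> norm v"
  by (metis norm_fst_le norm_snd_le prod.collapse)+

lemma L2_control_continuous:
  assumes "continuous_on {0..T} u"
  shows "L2_control T u"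
  unfolding L2_control_def
proof
  show "u \<in> borel_measurable (lebesgue_on {0..T})"
    by (intro continuous_imp_measurable_on_sets_lebesgue assms) auto
  have "(\<lambda>t. (norm (u t))\<^sup>2) absolutely_integrable_on {0..T}"
    by (intro absolutely_integrable_continuous_real continuous_intros assms)
  then show "integrable (lebesgue_on {0..T}) (\<lambda>t. (norm (u t))\<^sup>2)"
    by (simp add: set_integrable_def integrable_restrict_space)
qed

text \<open>
  Under the control \<open>p'' V\<^sub>0 w + q'' V\<^sub>1 w\<close> the linear system \<open>z' = A z + B u\<close> follows the curve
  \<open>p' B V\<^sub>0 w + q' B V\<^sub>1 w + p A B V\<^sub>0 w + q A B V\<^sub>1 w\<close> up to an error driven by \<open>p\<close> and \<open>q\<close>, which are small in
  \<open>L\<^sup>1\<close>, and by the choice of \<open>V\<^sub>0, V\<^sub>1\<close> the curve displaces \<open>y\<^sub>1\<close> by exactly \<open>w\<close>. The nonlinear endpoint is thus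
  close to \<open>y\<^sub>1 + w\<close>, and Brouwer's theorem yields the \<open>w\<close> that hits the target. Projecting the state to a ball
  makes the field globally Lipschitz.
\<close>

theorem partial_controllability_linear_test:
  fixes f :: "'a::euclidean_space \<Rightarrow> 'b::euclidean_space \<Rightarrow> 'c::euclidean_space \<Rightarrow> 'a \<times> 'b"
    and A :: "'a \<times> 'b \<Rightarrow> 'a \<times> 'b" and B :: "'c \<Rightarrow> 'a \<times> 'b"
  assumes lin: "linear A" "linear B"
    and lip: "\<And>R. \<exists>L. \<forall>z\<in>cball (y1e, y2e) R. \<forall>z'\<in>cball (y1e, y2e) R. \<forall>u\<in>cball 0 1. \<forall>u'\<in>cball 0 1.
      norm (f (fst z) (snd z) u - f (fst z') (snd z') u') \<le> L * (norm (z - z') + norm (u - u'))"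
    and quad: "\<exists>C. \<forall>z\<in>cball (y1e, y2e) 1. \<forall>u\<in>cball 0 1.
      norm (f (fst z) (snd z) u - (A (z - (y1e, y2e)) + B u)) \<le> C * (norm (z - (y1e, y2e)) + norm u)\<^sup>2"
    and kalman: "\<forall>\<mu>. (\<forall>u. \<mu> \<bullet> fst (B u) = 0 \<and> \<mu> \<bullet> fst (A (B u)) = 0) \<longrightarrow> \<mu> = 0"
  shows "small_time_locally_partially_controllable f y1e y2e 0"
proof -
  define ze where "ze = (y1e, y2e)"
  define F where "F z u = f (fst z) (snd z) u" for z u
  have lipF: "\<exists>L\<ge>0. \<forall>z z' u u'. z \<in> cball ze R \<longrightarrow> z' \<in> cball ze R \<longrightarrow> norm u \<le> 1 \<longrightarrow> norm u' \<le> 1 \<longrightarrow>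
      norm (F z u - F z' u') \<le> L * (norm (z - z') + norm (u - u'))" for R
  proof -
    obtain L where L: "\<forall>z\<in>cball ze R. \<forall>z'\<in>cball ze R. \<forall>u\<in>cball 0 1. \<forall>u'\<in>cball 0 1.
      norm (F z u - F z' u') \<le> L * (norm (z - z') + norm (u - u'))"
      using lip unfolding ze_def F_def by blast
    show ?thesis
    proof (intro exI[of _ "max L 0"] conjI allI impI)
      fix z z' and u u' :: 'c
      assume zu: "z \<in> cball ze R" "z' \<in> cball ze R" "norm u \<le> 1" "norm u' \<le> 1"
      have "norm (F z u - F z' u') \<le> L * (norm (z - z') + norm (u - u'))"
        by (rule L[rule_format]) (use zu in \<open>simp_all del: mem_cball add: mem_cball_0\<close>)
      also have "\<dots> \<le> max L 0 * (norm (z - z') + norm (u - u'))" by (intro mult_right_mono) auto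
      finally show "norm (F z u - F z' u') \<le> max L 0 * (norm (z - z') + norm (u - u'))" .
    qed auto
  qed
  obtain L where L: "0 \<le> L" "\<And>z z' u u'. z \<in> cball ze 1 \<Longrightarrow> z' \<in> cball ze 1 \<Longrightarrow> norm u \<le> 1 \<Longrightarrow> norm u' \<le> 1 \<Longrightarrow>
      norm (F z u - F z' u') \<le> L * (norm (z - z') + norm (u - u'))"
    using lipF[of 1] by blast
  obtain C where C: "0 \<le> C" "\<And>z u. z \<in> cball ze 1 \<Longrightarrow> norm u \<le> 1 \<Longrightarrow>
      norm (F z u - (A (z - ze) + B u)) \<le> C * (norm (z - ze) + norm u)\<^sup>2"
  proof -
    obtain C where C: "\<forall>z\<in>cball ze 1. \<forall>u\<in>cball 0 1.
      norm (F z u - (A (z - ze) + B u)) \<le> C * (norm (z - ze) + norm u)\<^sup>2"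
      using quad unfolding ze_def F_def by blast
    show ?thesis
    proof (rule that[of "max C 0"])
      fix z and u :: 'c assume zu: "z \<in> cball ze 1" "norm u \<le> 1"
      have "norm (F z u - (A (z - ze) + B u)) \<le> C * (norm (z - ze) + norm u)\<^sup>2"
        by (rule C[rule_format]) (use zu in \<open>simp_all del: mem_cball add: mem_cball_0\<close>)
      also have "\<dots> \<le> max C 0 * (norm (z - ze) + norm u)\<^sup>2" by (intro mult_right_mono) auto
      finally show "norm (F z u - (A (z - ze) + B u)) \<le> max C 0 * (norm (z - ze) + norm u)\<^sup>2" .
    qed auto
  qed
  \<comment> \<open>At the equilibrium with zero control the quadratic estimate has right-hand side
    0.\<close>
  have eq0: "f y1e y2e 0 = 0"
    using C(2)[of ze 0] linear_0[OF lin(1)] linear_0[OF lin(2)] by (simp add: F_def ze_def)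

  define Pr where "Pr = closest_point (cball ze 1)"
  have Pr: "Pr z \<in> cball ze 1" "norm (Pr z - Pr z') \<le> norm (z - z')" for z z'
    using closest_point_in_set[of "cball ze 1"] closest_point_lipschitz[of "cball ze 1" z z']
    by (auto simp: Pr_def dist_norm simp del: mem_cball)
  have Pr_id: "Pr z = z" if "norm (z - ze) \<le> 1" for z
    using that by (simp add: Pr_def closest_point_self dist_norm norm_minus_commute)
  define Ft where "Ft z u = F (Pr z) u" for z u
  have Ft_lip: "norm (Ft z u - Ft z' u') \<le> L * (norm (z - z') + norm (u - u'))"
    if "norm u \<le> 1" "norm u' \<le> 1" for z z' u u'
  proof -
    have "norm (Ft z u - Ft z' u') \<le> L * (norm (Pr z - Pr z') + norm (u - u'))"
      unfolding Ft_def using that Pr by (intro L(2)) auto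
    also have "\<dots> \<le> L * (norm (z - z') + norm (u - u'))"
      using L(1) Pr by (intro mult_left_mono add_right_mono) auto
    finally show ?thesis .
  qed
  have Ft_cont: "continuous_on S (\<lambda>t. Ft (z t) (u t))"
    if "continuous_on S z" "continuous_on S u" "\<And>t. t \<in> S \<Longrightarrow> norm (u t) \<le> 1"
    for S :: "'s::topological_space set" and z u
  proof -
    have "(2 * L)-lipschitz_on (UNIV \<times> cball 0 1) (\<lambda>x. Ft (fst x) (snd x))"
    proof (rule lipschitz_onI)
      fix x y :: "('a \<times> 'b) \<times> 'c" assume xy: "x \<in> UNIV \<times> cball 0 1" "y \<in> UNIV \<times> cball 0 1"
      have "dist (Ft (fst x) (snd x)) (Ft (fst y) (snd y)) \<le> L * (norm (fst (x - y)) + norm (snd (x - y)))"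
        using Ft_lip[of "snd x" "snd y" "fst x" "fst y"] xy by (auto simp: dist_norm)
      also have "\<dots> \<le> L * (norm (x - y) + norm (x - y))"
        by (intro mult_left_mono add_mono norm_proj L(1))
      finally show "dist (Ft (fst x) (snd x)) (Ft (fst y) (snd y)) \<le> 2 * L * dist x y"
        by (simp add: dist_norm)
    qed (use L in auto)
    then have "continuous_on (UNIV \<times> cball 0 1) (\<lambda>x. Ft (fst x) (snd x))"
      by (rule lipschitz_on_continuous_on)
    moreover have "(\<lambda>t. (z t, u t)) ` S \<subseteq> UNIV \<times> cball 0 1" using that(3) by auto
    ultimately show ?thesis
      using continuous_on_compose2[OF _ continuous_on_Pair[OF that(1,2)]] by fastforce
  qed

  obtain V0 V1 :: "'a \<Rightarrow> 'c" where V: "linear V0" "linear V1" "\<And>w. fst (B (V0 w) + A (B (V1 w))) = w"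
    by (rule linear_inverse_from_kalman[OF lin kalman]) (rule that)
  have lin_comp: "linear (\<lambda>w. B (V w))" "linear (\<lambda>w. A (B (V w)))" "linear (\<lambda>w. A (A (B (V w))))" if "linear V" for V
    using linear_compose[OF that lin(2)] linear_compose[OF linear_compose[OF that lin(2)] lin(1)]
      linear_compose[OF linear_compose[OF linear_compose[OF that lin(2)] lin(1)] lin(1)]
    by (simp_all add: o_def)
  note linV = lin_comp[OF V(1)] lin_comp[OF V(2)]
  obtain D1 where D1: "0 \<le> D1" "\<And>w. norm (V0 w) \<le> D1 * norm w" "\<And>w. norm (V1 w) \<le> D1 * norm w"
    using linear_maps_common_bound[of "{V0, V1}"] V by auto
  have "\<exists>D\<ge>0. \<forall>g\<in>{\<lambda>w. B (V0 w), \<lambda>w. B (V1 w), \<lambda>w. A (B (V0 w)), \<lambda>w. A (B (V1 w)),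
      \<lambda>w. A (A (B (V0 w))), \<lambda>w. A (A (B (V1 w)))}. \<forall>w. norm (g w) \<le> D * norm w"
    by (rule linear_maps_common_bound) (use linV in auto)
  then obtain D2 where D2: "0 \<le> D2" "\<And>w. norm (B (V0 w)) \<le> D2 * norm w" "\<And>w. norm (B (V1 w)) \<le> D2 * norm w"
    "\<And>w. norm (A (B (V0 w))) \<le> D2 * norm w" "\<And>w. norm (A (B (V1 w))) \<le> D2 * norm w"
    "\<And>w. norm (A (A (B (V0 w)))) \<le> D2 * norm w" "\<And>w. norm (A (A (B (V1 w)))) \<le> D2 * norm w"
    by auto

  have "\<exists>\<delta>>0. \<forall>y10\<in>ball y1e \<delta>. \<forall>y20\<in>ball y2e \<delta>. \<forall>y1f\<in>ball y1e \<delta>.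
        \<exists>u. L2_control \<epsilon> u \<and> (AE t in lebesgue_on {0..\<epsilon>}. norm (u t - 0) \<le> \<epsilon>) \<and>
            (\<exists>y. solves_on \<epsilon> f u y10 y20 y) \<and> (\<forall>y. solves_on \<epsilon> f u y10 y20 y \<longrightarrow> fst (y \<epsilon>) = y1f)"
    if "\<epsilon> > 0" for \<epsilon>
  proof -
    define H where "H = exp (L * \<epsilon>)"
    have H: "H \<ge> 1" "exp (L * t) \<le> H" if "t \<in> {0..\<epsilon>}" for t
      using that L(1) \<open>\<epsilon> > 0\<close> by (auto simp: H_def intro: mult_left_mono)
    have H1: "H \<ge> 1" using H(1)[of 0] \<open>\<epsilon> > 0\<close> by simp
    \<comment> \<open>This gives \<open>H * D2 * \<sigma> \<le> 1 / 4\<close>: after amplification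
      by Gronwall the \<open>A A B\<close> terms cost at most a quarter of \<open>\<rho>\<close>.
      The value does not involve the profiles, whose size \<open>K\<close> is known only
      afterwards.\<close>
    define \<sigma> where "\<sigma> = 1 / (4 * H * (D2 + 1))"
    have "\<sigma> > 0" using H1 D2(1) by (simp add: \<sigma>_def)
    obtain p p' p'' q q' q'' :: "real \<Rightarrow> real" where
      der: "\<And>t. (p has_real_derivative p' t) (at t)" "\<And>t. (p' has_real_derivative p'' t) (at t)"
        "\<And>t. (q has_real_derivative q' t) (at t)" "\<And>t. (q' has_real_derivative q'' t) (at t)"
      and cont'': "continuous_on UNIV p''" "continuous_on UNIV q''"
      and at0: "p 0 = 0" "p' 0 = 0" "q 0 = 0" "q' 0 = 0"
      and ate: "p \<epsilon> = 0" "p' \<epsilon> = 1" "q \<epsilon> = 1" "q' \<epsilon> = 0"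
      and int_pq: "integral {0..\<epsilon>} (\<lambda>t. \<bar>p t\<bar> + \<bar>q t\<bar>) \<le> \<sigma>"
      using steering_profiles[OF \<open>\<epsilon> > 0\<close> \<open>\<sigma> > 0\<close>] by blast
    have cont: "continuous_on S p" "continuous_on S p'" "continuous_on S q" "continuous_on S q'"
      "continuous_on S p''" "continuous_on S q''" for S
      by (auto intro!: DERIV_continuous_on[OF has_field_derivative_at_within[OF der(1)]]
          DERIV_continuous_on[OF has_field_derivative_at_within[OF der(2)]]
          DERIV_continuous_on[OF has_field_derivative_at_within[OF der(3)]]
          DERIV_continuous_on[OF has_field_derivative_at_within[OF der(4)]] intro: continuous_on_subset[OF cont''(1)]
          continuous_on_subset[OF cont''(2)])
    have "\<exists>K\<ge>0. \<forall>g\<in>{p, p', p'', q, q', q''}. \<forall>t\<in>{0..\<epsilon>}. \<bar>g t\<bar> \<le> K"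
      by (rule continuous_functions_common_bound) (use cont in auto)
    then obtain K where K: "0 \<le> K" "\<And>t. t \<in> {0..\<epsilon>} \<Longrightarrow> \<bar>p t\<bar> \<le> K \<and> \<bar>p' t\<bar> \<le> K \<and> \<bar>p'' t\<bar> \<le> K \<and> \<bar>q t\<bar> \<le> K \<and> \<bar>q' t\<bar> \<le> K \<and> \<bar>q'' t\<bar> \<le> K"
      by auto
    define N where "N = 4 * K * (D1 + D2)"
    have N: "0 \<le> N" using K(1) D1(1) D2(1) by (simp add: N_def)
    have scale_bound: "norm (a *\<^sub>R v) \<le> K * (D1 + D2) * norm w"
      if "\<bar>a\<bar> \<le> K" "norm v \<le> D1 * norm w \<or> norm v \<le> D2 * norm w" for a w and v :: "'v::real_normed_vector"
    proof -
      have "norm v \<le> (D1 + D2) * norm w"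
        using that(2) D1(1) D2(1) by (auto simp: distrib_right intro: order_trans add_increasing add_increasing2)
      then have "\<bar>a\<bar> * norm v \<le> K * ((D1 + D2) * norm w)"
        using that(1) K(1) by (intro mult_mono) auto
      then show ?thesis by (simp add: mult_ac)
    qed
    define u where "u w t = p'' t *\<^sub>R V0 w + q'' t *\<^sub>R V1 w" for w t
    define zb where "zb w t = ze + ((p' t *\<^sub>R B (V0 w) + q' t *\<^sub>R B (V1 w)) + (p t *\<^sub>R A (B (V0 w)) + q t *\<^sub>R A (B (V1 w))))" for w t
    have u_bound: "norm (u w t) \<le> N * norm w" if "t \<in> {0..\<epsilon>}" for w t
    proof -
      have "norm (u w t) \<le> K * (D1 + D2) * norm w + K * (D1 + D2) * norm w"
        unfolding u_def using K(2)[OF that] D1 by (intro norm_triangle_mono scale_bound) auto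
      also have "\<dots> \<le> N * norm w"
        using K(1) D1(1) D2(1) by (auto simp: N_def)
      finally show ?thesis .
    qed
    have zb_bound: "norm (zb w t - ze) \<le> N * norm w" if "t \<in> {0..\<epsilon>}" for w t
    proof -
      have "norm (zb w t - ze) \<le> (K * (D1 + D2) * norm w + K * (D1 + D2) * norm w)
          + (K * (D1 + D2) * norm w + K * (D1 + D2) * norm w)"
        unfolding zb_def add_diff_cancel_left' using K(2)[OF that] D2 by (intro norm_triangle_mono scale_bound) auto
      also have "\<dots> = N * norm w" by (simp add: N_def)
      finally show ?thesis .
    qed
    have u_diff: "u w t - u w' t = u (w - w') t" for w w' t
      by (simp add: u_def linear_diff[OF V(1)] linear_diff[OF V(2)] algebra_simps)
    have u_cont: "continuous_on S (u w)" for S w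
      unfolding u_def[abs_def] by (intro continuous_intros cont)
    \<comment> \<open>This is the derivative of \<open>zb\<close>. It is written as the linear
      dynamics along \<open>zb\<close> minus the terms in \<open>A A B\<close>, which are the whole
      failure of \<open>zb\<close> to solve the linear system; \<open>g_eq\<close> shows that they
      cancel.\<close>
    define g where "g w t = B (u w t) + A (zb w t - ze) - (p t *\<^sub>R A (A (B (V0 w))) + q t *\<^sub>R A (A (B (V1 w))))" for w t
    have g_eq: "g w t = (p'' t *\<^sub>R B (V0 w) + q'' t *\<^sub>R B (V1 w)) + (p' t *\<^sub>R A (B (V0 w)) + q' t *\<^sub>R A (B (V1 w)))" for w t
      by (simp add: g_def u_def zb_def linear_add[OF lin(1)] linear_add[OF lin(2)] linear_scale[OF lin(1)] linear_scale[OF lin(2)])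
    have g_cont: "continuous_on S (g w)" for S w
      unfolding g_eq[abs_def] by (intro continuous_intros cont)
    have zb_cont: "continuous_on S (zb w)" for S w
      unfolding zb_def[abs_def] by (intro continuous_intros cont)
    have zb_int: "zb w t = ze + integral {0..t} (g w)" if "t \<in> {0..\<epsilon>}" for w t
    proof -
      have "(g w has_integral zb w t - zb w 0) {0..t}"
      proof (rule fundamental_theorem_of_calculus)
        show "(zb w has_vector_derivative g w s) (at s within {0..t})" for s
          unfolding zb_def[abs_def] g_eq
          by (auto intro!: derivative_eq_intros has_field_derivative_at_within[OF der(1)] has_field_derivative_at_within[OF der(2)]
              has_field_derivative_at_within[OF der(3)] has_field_derivative_at_within[OF der(4)])
      qed (use that in auto)
      then show ?thesis by (simp add: integral_unique zb_def[of w 0] at0)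
    qed

    \<comment> \<open>The first entry gives \<open>(N + 1) * \<rho> \<le> min 1 \<epsilon>\<close>:
      controls are admissible, and a solution within \<open>\<rho>\<close> of the reference curve
      stays in the unit ball. The second makes the quadratic error
      \<open>C * (2 * N * \<rho>)\<^sup>2\<close>, integrated and amplified, at most
      \<open>\<rho> / 4\<close>; the added 1 avoids division by 0.\<close>
    define \<rho> where "\<rho> = min (min 1 \<epsilon> / (N + 1)) (1 / (4 * (H * \<epsilon> * (4 * C * N\<^sup>2) + 1)))"
    have pos: "0 \<le> H * \<epsilon> * (4 * C * N\<^sup>2)" using H1 C(1) \<open>\<epsilon> > 0\<close> by simp
    then have "0 < 1 / (4 * (H * \<epsilon> * (4 * C * N\<^sup>2) + 1))" by (intro divide_pos_pos mult_pos_pos add_nonneg_pos) auto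
    moreover have "0 < min 1 \<epsilon> / (N + 1)" using N \<open>\<epsilon> > 0\<close> by simp
    ultimately have "\<rho> > 0" by (simp only: \<rho>_def min_less_iff_conj)
    have "\<rho> \<le> min 1 \<epsilon> / (N + 1)" by (simp add: \<rho>_def)
    then have "(N + 1) * \<rho> \<le> min 1 \<epsilon>" using N by (simp add: field_simps)
    then have \<rho>1: "N * \<rho> + \<rho> \<le> 1" "N * \<rho> + \<rho> \<le> \<epsilon>" by (auto simp: algebra_simps)
    have "\<rho> \<le> 1 / (4 * (H * \<epsilon> * (4 * C * N\<^sup>2) + 1))" by (simp add: \<rho>_def)
    then have "4 * (H * \<epsilon> * (4 * C * N\<^sup>2) + 1) * \<rho> \<le> 1"
      using pos by (simp add: pos_le_divide_eq mult.commute)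
    then have \<rho>2: "H * \<epsilon> * (4 * C * N\<^sup>2) * \<rho> \<le> 1 / 4"
      using \<open>\<rho> > 0\<close> by (simp add: algebra_simps)
    \<comment> \<open>Half of \<open>\<rho>\<close> is used up by the two error terms of size
      \<open>\<rho> / 4\<close>. The other half must cover the amplified initial error
      \<open>2 * H * \<delta>\<close> and the offset \<open>\<delta>\<close> of the target.\<close>
    define \<delta> where "\<delta> = \<rho> / (2 * (2 * H + 1))"
    have "\<delta> > 0" using \<open>\<rho> > 0\<close> H1 by (simp add: \<delta>_def)
    have "h * (\<rho> / (2 * h)) = \<rho> / 2" if "h \<noteq> 0" for h :: real using that by simp
    from this[of "2 * H + 1"] have "(2 * H + 1) * \<delta> = \<rho> / 2" unfolding \<delta>_def using H1 by linarith
    then have \<delta>: "2 * H * \<delta> + \<delta> = \<rho> / 2" by (simp add: algebra_simps)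
    have Nw: "N * norm w \<le> N * \<rho>" if "w \<in> cball 0 \<rho>" for w
      using that N by (intro mult_left_mono) auto
    have u1: "norm (u w t) \<le> 1" "norm (u w t) \<le> \<epsilon>" and zb1: "norm (zb w t - ze) \<le> N * \<rho>"
      if "w \<in> cball 0 \<rho>" "t \<in> {0..\<epsilon>}" for w t
      using u_bound[OF that(2), of w] zb_bound[OF that(2), of w] Nw[OF that(1)] \<rho>1 \<open>\<rho> > 0\<close> by linarith+

    have "\<exists>v. L2_control \<epsilon> v \<and> (AE t in lebesgue_on {0..\<epsilon>}. norm (v t - 0) \<le> \<epsilon>) \<and>
            (\<exists>y. solves_on \<epsilon> f v y10 y20 y) \<and> (\<forall>y. solves_on \<epsilon> f v y10 y20 y \<longrightarrow> fst (y \<epsilon>) = y1f)"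
      if y: "y10 \<in> ball y1e \<delta>" "y20 \<in> ball y2e \<delta>" "y1f \<in> ball y1e \<delta>" for y10 y20 y1f
    proof -
      define z0 where "z0 = (y10, y20)"
      have z0: "norm (z0 - ze) \<le> 2 * \<delta>"
        using y norm_Pair_le[of "y10 - y1e" "y20 - y2e"]
        by (simp add: z0_def ze_def dist_norm norm_minus_commute)
      have "\<forall>w\<in>cball 0 \<rho>. \<exists>z. continuous_on {0..\<epsilon>} z \<and> (\<forall>t\<in>{0..\<epsilon>}. z t = z0 + integral {0..t} (\<lambda>s. Ft (z s) (u w s)))"
      proof
        fix w :: 'a assume w: "w \<in> cball 0 \<rho>"
        show "\<exists>z. continuous_on {0..\<epsilon>} z \<and> (\<forall>t\<in>{0..\<epsilon>}. z t = z0 + integral {0..t} (\<lambda>s. Ft (z s) (u w s)))"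
        proof (rule picard_global[where f = "\<lambda>t z. Ft z (u w t)", OF _ _ L(1)])
          show "continuous_on ({0..\<epsilon>} \<times> UNIV) (\<lambda>(t, z). Ft z (u w t))"
            unfolding case_prod_unfold using u1[OF w]
            by (intro Ft_cont continuous_intros continuous_on_compose2[OF u_cont[of UNIV w]]) auto
          show "norm (Ft z (u w t) - Ft z' (u w t)) \<le> L * norm (z - z')" if "t \<in> {0..\<epsilon>}" for t z z'
            using Ft_lip[of "u w t" "u w t" z z'] u1[OF w that] by simp
        qed (use \<open>\<epsilon> > 0\<close> in auto)
      qed
      then obtain Z where Z_cont: "\<And>w. w \<in> cball 0 \<rho> \<Longrightarrow> continuous_on {0..\<epsilon>} (Z w)"
        and Z: "\<And>w t. w \<in> cball 0 \<rho> \<Longrightarrow> t \<in> {0..\<epsilon>} \<Longrightarrow> Z w t = z0 + integral {0..t} (\<lambda>s. Ft (Z w s) (u w s))"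
        unfolding bchoice_iff by metis
      have Ft_cont_Z: "continuous_on {0..\<epsilon>} (\<lambda>s. Ft (Z w s) (u w s))" if "w \<in> cball 0 \<rho>" for w
        using u1[OF that] by (intro Ft_cont Z_cont that u_cont) auto

      \<comment> \<open>The defect \<open>d\<close> is the quadratic remainder along
        \<open>zb\<close> plus the \<open>A A B\<close> terms. The spare \<open>\<delta>\<close> on
        the left is what lets the map \<open>T\<close> below send the ball into itself.\<close>
      have dev: "norm (Z w t - zb w t) + \<delta> \<le> \<rho>" if w: "w \<in> cball 0 \<rho>" and t: "t \<in> {0..\<epsilon>}" for w t
      proof -
        define d where "d s = C * (2 * (N * norm w))\<^sup>2 + D2 * norm w * (\<bar>p s\<bar> + \<bar>q s\<bar>)" for s
        have wn: "norm w \<le> \<rho>" using w by simp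
        have dint: "(d has_integral \<epsilon> *\<^sub>R (C * (2 * (N * norm w))\<^sup>2)
            + D2 * norm w * integral {0..\<epsilon>} (\<lambda>s. \<bar>p s\<bar> + \<bar>q s\<bar>)) {0..\<epsilon>}"
          unfolding d_def[abs_def] using \<open>\<epsilon> > 0\<close> has_integral_const_real[of "C * (2 * (N * norm w))\<^sup>2" 0 \<epsilon>]
          by (intro has_integral_add has_integral_mult_right integrable_integral integrable_continuous_interval
              continuous_intros cont) auto
        have "norm (Z w t - zb w t) \<le> (norm (z0 - ze) + integral {0..\<epsilon>} d) * exp (L * t)"
        proof (rule gronwall_diff[OF Z_cont[OF w] zb_cont _ _ Z[OF w] zb_int _ _ L(1) _ t])
          show "(\<lambda>s. Ft (Z w s) (u w s)) integrable_on {0..\<epsilon>}" "g w integrable_on {0..\<epsilon>}"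
            by (intro integrable_continuous_interval Ft_cont_Z w g_cont)+
          show "d integrable_on {0..\<epsilon>}" using dint by blast
          show "0 \<le> d s" for s using C(1) D2(1) by (simp add: d_def)
          fix s assume s: "s \<in> {0..\<epsilon>}"
          have "norm (zb w s - ze) \<le> 1" using zb1[OF w s] \<rho>1(1) \<open>\<rho> > 0\<close> by linarith
          then have Ft_zb: "Ft (zb w s) (u w s) = F (zb w s) (u w s)" and zb_mem: "zb w s \<in> cball ze 1"
            by (auto simp: Ft_def Pr_id dist_norm norm_minus_commute)
          have "norm (Ft (Z w s) (u w s) - Ft (zb w s) (u w s)) \<le> L * norm (Z w s - zb w s)"
            using Ft_lip[of "u w s" "u w s" "Z w s" "zb w s"] u1[OF w s] by simp
          moreover have "norm (Ft (zb w s) (u w s) - (A (zb w s - ze) + B (u w s))) \<le> C * (2 * (N * norm w))\<^sup>2"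
          proof -
            have "norm (Ft (zb w s) (u w s) - (A (zb w s - ze) + B (u w s))) \<le> C * (norm (zb w s - ze) + norm (u w s))\<^sup>2"
              unfolding Ft_zb by (rule C(2)[OF zb_mem u1(1)[OF w s]])
            also have "\<dots> \<le> C * (2 * (N * norm w))\<^sup>2"
              using C(1) zb_bound[OF s, of w] u_bound[OF s, of w] by (intro mult_left_mono power_mono) auto
            finally show ?thesis .
          qed
          moreover have "norm (p s *\<^sub>R A (A (B (V0 w))) + q s *\<^sub>R A (A (B (V1 w)))) \<le> D2 * norm w * (\<bar>p s\<bar> + \<bar>q s\<bar>)"
          proof -
            have "norm (p s *\<^sub>R A (A (B (V0 w))) + q s *\<^sub>R A (A (B (V1 w))))
                \<le> \<bar>p s\<bar> * (D2 * norm w) + \<bar>q s\<bar> * (D2 * norm w)"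
              using D2 by (intro norm_triangle_mono) (auto intro: mult_left_mono)
            then show ?thesis by (simp add: algebra_simps)
          qed
          moreover have "Ft (Z w s) (u w s) - g w s = (Ft (Z w s) (u w s) - Ft (zb w s) (u w s))
              + (Ft (zb w s) (u w s) - (A (zb w s - ze) + B (u w s)))
              + (p s *\<^sub>R A (A (B (V0 w))) + q s *\<^sub>R A (A (B (V1 w))))"
            by (simp add: g_def)
          ultimately show "norm (Ft (Z w s) (u w s) - g w s) \<le> L * norm (Z w s - zb w s) + d s"
            unfolding d_def by (smt (verit) norm_triangle_ineq)
        qed
        also have "\<dots> \<le> (2 * \<delta> + (\<epsilon> * (C * (2 * (N * \<rho>))\<^sup>2) + D2 * \<rho> * \<sigma>)) * H"
        proof (intro mult_mono add_mono z0 H(2) t)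
          have "integral {0..\<epsilon>} d = \<epsilon> * (C * (2 * (N * norm w))\<^sup>2) + D2 * norm w * integral {0..\<epsilon>} (\<lambda>s. \<bar>p s\<bar> + \<bar>q s\<bar>)"
            using integral_unique[OF dint] by simp
          also have "\<dots> \<le> \<epsilon> * (C * (2 * (N * \<rho>))\<^sup>2) + D2 * \<rho> * \<sigma>"
            using \<open>\<epsilon> > 0\<close> C(1) N wn D2(1) \<open>\<rho> > 0\<close> int_pq \<open>\<sigma> > 0\<close>
            by (intro add_mono mult_left_mono mult_mono power_mono) (auto intro!: integral_nonneg integrable_continuous_interval continuous_intros cont)
          finally show "integral {0..\<epsilon>} d \<le> \<epsilon> * (C * (2 * (N * \<rho>))\<^sup>2) + D2 * \<rho> * \<sigma>" .
          show "0 \<le> 2 * \<delta> + (\<epsilon> * (C * (2 * (N * \<rho>))\<^sup>2) + D2 * \<rho> * \<sigma>)"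
            using \<open>\<delta> > 0\<close> \<open>\<epsilon> > 0\<close> C(1) D2(1) \<open>\<rho> > 0\<close> \<open>\<sigma> > 0\<close> by simp
        qed auto
        also have "\<dots> = 2 * H * \<delta> + H * \<epsilon> * (4 * C * N\<^sup>2) * \<rho> * \<rho> + (H * D2 * \<sigma>) * \<rho>"
          by (simp add: algebra_simps power2_eq_square)
        also have "\<dots> \<le> 2 * H * \<delta> + 1 / 4 * \<rho> + 1 / 4 * \<rho>"
        proof (intro add_mono mult_right_mono \<rho>2)
          have "H * D2 * \<sigma> = D2 / (D2 + 1) * (1 / 4)" using H1 D2(1) by (simp add: \<sigma>_def)
          also have "\<dots> \<le> 1 * (1 / 4)" using D2(1) by (intro mult_right_mono) auto
          finally show "H * D2 * \<sigma> \<le> 1 / 4" by simp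
        qed (use \<open>\<rho> > 0\<close> H1 \<open>\<delta> > 0\<close> in auto)
        finally show ?thesis using \<delta> by simp
      qed

      \<comment> \<open>Brouwer's theorem needs continuity of the endpoint in
        \<open>w\<close>.\<close>
      have Z_Lip: "norm (Z w \<epsilon> - Z w' \<epsilon>) \<le> (\<epsilon> * (L * N) * H) * norm (w - w')" if w: "w \<in> cball 0 \<rho>" "w' \<in> cball 0 \<rho>" for w w'
      proof -
        have "norm (Z w \<epsilon> - Z w' \<epsilon>) \<le> (norm (z0 - z0) + integral {0..\<epsilon>} (\<lambda>s. L * (N * norm (w - w')))) * exp (L * \<epsilon>)"
        proof (rule gronwall_diff[OF Z_cont[OF w(1)] Z_cont[OF w(2)] _ _ Z[OF w(1)] Z[OF w(2)] _ _ L(1)])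
          show "(\<lambda>s. Ft (Z w s) (u w s)) integrable_on {0..\<epsilon>}" "(\<lambda>s. Ft (Z w' s) (u w' s)) integrable_on {0..\<epsilon>}"
            by (intro integrable_continuous_interval Ft_cont_Z w)+
          fix s assume s: "s \<in> {0..\<epsilon>}"
          have "norm (Ft (Z w s) (u w s) - Ft (Z w' s) (u w' s)) \<le> L * (norm (Z w s - Z w' s) + norm (u w s - u w' s))"
            by (intro Ft_lip u1 w s)
          also have "\<dots> \<le> L * (norm (Z w s - Z w' s) + N * norm (w - w'))"
            unfolding u_diff using L(1) by (intro mult_left_mono add_left_mono u_bound s) auto
          finally show "norm (Ft (Z w s) (u w s) - Ft (Z w' s) (u w' s)) \<le> L * norm (Z w s - Z w' s) + L * (N * norm (w - w'))"
            by (simp add: algebra_simps)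
        qed (use \<open>\<epsilon> > 0\<close> L(1) N in auto)
        then show ?thesis using \<open>\<epsilon> > 0\<close> by (simp add: H_def mult_ac)
      qed

      \<comment> \<open>A fixed point is a parameter whose trajectory ends at \<open>y1f\<close>. As
        the reference curve ends at \<open>y1e + w\<close>, the \<open>w\<close> cancels and
        \<open>T w\<close> consists only of the target offset and the deviation bounded by
        \<open>dev\<close>.\<close>
      define T where "T w = w - (fst (Z w \<epsilon>) - y1f)" for w
      have "T \<in> cball 0 \<rho> \<rightarrow> cball 0 \<rho>"
      proof
        fix w :: 'a assume w: "w \<in> cball 0 \<rho>"
        have "fst (zb w \<epsilon>) = y1e + w"
          using V(3)[of w] by (simp add: zb_def ate ze_def)
        then have "T w = (y1f - y1e) - fst (Z w \<epsilon> - zb w \<epsilon>)" by (simp add: T_def)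
        then have "norm (T w) \<le> norm (y1f - y1e) + norm (Z w \<epsilon> - zb w \<epsilon>)"
          using norm_triangle_ineq4[of "y1f - y1e" "fst (Z w \<epsilon> - zb w \<epsilon>)"] norm_proj(1)[of "Z w \<epsilon> - zb w \<epsilon>"] by simp
        also have "norm (y1f - y1e) \<le> \<delta>" using y(3) by (simp add: dist_norm norm_minus_commute)
        finally show "T w \<in> cball 0 \<rho>" using dev[OF w, of \<epsilon>] \<open>\<epsilon> > 0\<close> by simp
      qed
      moreover have "continuous_on (cball 0 \<rho>) T"
      proof -
        have "(\<epsilon> * (L * N) * H)-lipschitz_on (cball 0 \<rho>) (\<lambda>w. Z w \<epsilon>)"
          using Z_Lip \<open>\<epsilon> > 0\<close> L(1) N H1 by (intro lipschitz_onI) (auto simp: dist_norm)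
        then show ?thesis
          unfolding T_def[abs_def] by (intro continuous_intros lipschitz_on_continuous_on)
      qed
      ultimately obtain w where w: "w \<in> cball 0 \<rho>" "T w = w"
        using brouwer_ball[OF \<open>\<rho> > 0\<close>] by blast
      have hit: "fst (Z w \<epsilon>) = y1f" using w(2) by (simp add: T_def)
      have Ft_eq: "Ft (Z w s) (u w s) = f (fst (Z w s)) (snd (Z w s)) (u w s)" if "s \<in> {0..\<epsilon>}" for s
      proof -
        have "norm (Z w s - ze) \<le> norm (Z w s - zb w s) + norm (zb w s - ze)"
          by (rule norm_diff_triangle_le) auto
        also have "\<dots> \<le> 1" using dev[OF w(1) that] zb1[OF w(1) that] \<rho>1 \<open>\<delta> > 0\<close> by linarith
        finally show ?thesis by (simp add: Ft_def Pr_id F_def)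
      qed
      have "solves_on \<epsilon> f (u w) y10 y20 (Z w)"
        unfolding solves_on_def
      proof (intro conjI ballI)
        show "continuous_on {0..\<epsilon>} (Z w)" by (rule Z_cont[OF w(1)])
        have "continuous_on {0..\<epsilon>} (\<lambda>s. f (fst (Z w s)) (snd (Z w s)) (u w s))"
          using Ft_cont_Z[OF w(1)] by (rule continuous_on_eq) (rule Ft_eq)
        then show "(\<lambda>s. f (fst (Z w s)) (snd (Z w s)) (u w s)) absolutely_integrable_on {0..\<epsilon>}"
          by (rule absolutely_integrable_continuous_real)
        fix t assume t: "t \<in> {0..\<epsilon>}"
        have "integral {0..t} (\<lambda>s. Ft (Z w s) (u w s)) = integral {0..t} (\<lambda>s. f (fst (Z w s)) (snd (Z w s)) (u w s))"
          by (intro integral_cong Ft_eq) (use t in auto)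
        then show "Z w t = (y10, y20) + integral {0..t} (\<lambda>s. f (fst (Z w s)) (snd (Z w s)) (u w s))"
          using Z[OF w(1) t] by (simp add: z0_def)
      qed
      moreover have "fst (y \<epsilon>) = y1f" if y: "solves_on \<epsilon> f (u w) y10 y20 y" for y
      proof -
        have y_cont: "continuous_on {0..\<epsilon>} y"
          and y_int: "(\<lambda>s. F (y s) (u w s)) integrable_on {0..\<epsilon>}"
          and y_eq: "\<And>t. t \<in> {0..\<epsilon>} \<Longrightarrow> y t = z0 + integral {0..t} (\<lambda>s. F (y s) (u w s))"
          using y by (auto simp: solves_on_def F_def z0_def absolutely_integrable_on_def)
        \<comment> \<open>A competing solution follows the untruncated field and may a priori leave
          the unit ball. Both trajectories are bounded, so the Lipschitz hypothesis is applied on a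
          ball of radius \<open>R\<close> containing them; this is why it is required for every
          radius.\<close>
        have "bounded (y ` {0..\<epsilon>} \<union> Z w ` {0..\<epsilon>})"
          unfolding bounded_Un
          by (intro conjI compact_imp_bounded compact_continuous_image y_cont Z_cont w) auto
        then obtain R where "\<forall>x\<in>y ` {0..\<epsilon>} \<union> Z w ` {0..\<epsilon>}. dist ze x \<le> R"
          unfolding bounded_any_center[where a = ze] ..
        then have R: "y s \<in> cball ze R" "Z w s \<in> cball ze R" if "s \<in> {0..\<epsilon>}" for s
          using that by auto
        obtain L' where L': "0 \<le> L'" "\<And>z z' v v'. z \<in> cball ze R \<Longrightarrow> z' \<in> cball ze R \<Longrightarrow> norm v \<le> 1 \<Longrightarrow> norm v' \<le> 1 \<Longrightarrow>
            norm (F z v - F z' v') \<le> L' * (norm (z - z') + norm (v - v'))"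
          using lipF[of R] by blast
        have "norm (y \<epsilon> - Z w \<epsilon>) \<le> (norm (z0 - z0) + integral {0..\<epsilon>} (\<lambda>s. 0)) * exp (L' * \<epsilon>)"
        proof (rule gronwall_diff[OF y_cont Z_cont[OF w(1)] y_int _ y_eq Z[OF w(1)] _ _ L'(1)])
          show "(\<lambda>s. Ft (Z w s) (u w s)) integrable_on {0..\<epsilon>}"
            by (intro integrable_continuous_interval Ft_cont_Z w)
          fix s assume s: "s \<in> {0..\<epsilon>}"
          show "norm (F (y s) (u w s) - Ft (Z w s) (u w s)) \<le> L' * norm (y s - Z w s) + 0"
            using L'(2)[OF R[OF s] u1(1)[OF w(1) s] u1(1)[OF w(1) s]] Ft_eq[OF s] by (simp add: F_def)
        qed (use \<open>\<epsilon> > 0\<close> in auto)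
        then show ?thesis using hit by simp
      qed
      moreover have "L2_control \<epsilon> (u w)"
        by (intro L2_control_continuous u_cont)
      moreover have "AE t in lebesgue_on {0..\<epsilon>}. norm (u w t - 0) \<le> \<epsilon>"
        using u1[OF w(1)] by (intro AE_I2) auto
      ultimately show ?thesis by blast
    qed
    then show ?thesis using \<open>\<delta> > 0\<close> by blast
  qed
  then show ?thesis
    unfolding small_time_locally_partially_controllable_def using eq0 by blast
qed

section \<open>Drag forces and dissipation\<close>

lemma e_par_perp [simp]:
  "e_par \<phi> \<bullet> e_par \<phi> = 1" "e_perp \<phi> \<bullet> e_perp \<phi> = 1" "e_par \<phi> \<bullet> e_perp \<phi> = 0" "e_perp \<phi> \<bullet> e_par \<phi> = 0"
  by (simp_all add: e_par_def e_perp_def inner_vec_def sum_2 flip: power2_eq_square)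

lemma cross_z_e_par: "cross_z (e_par \<phi>) v = e_perp \<phi> \<bullet> v"
  by (simp add: cross_z_def e_par_def e_perp_def inner_vec_def sum_2)

lemma inner_e_frame: "v \<bullet> w = (v \<bullet> e_par \<phi>) * (w \<bullet> e_par \<phi>) + (v \<bullet> e_perp \<phi>) * (w \<bullet> e_perp \<phi>)"
proof -
  have "a1 * b1 + a2 * b2 = (a1 * c + a2 * s) * (b1 * c + b2 * s) + (a2 * c - a1 * s) * (b2 * c - b1 * s)"
    if "s\<^sup>2 + c\<^sup>2 = 1" for a1 a2 b1 b2 c s :: real
    using that by algebra
  from this[OF sin_cos_squared_add, of "v$1" "w$1" "v$2" "w$2" \<phi>] show ?thesis
    by (simp add: e_par_def e_perp_def inner_vec_def sum_2 algebra_simps)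
qed

lemma has_integral_quadratic:
  fixes a b c :: "'a::euclidean_space"
  assumes "0 \<le> l"
  shows "((\<lambda>s. a + s *\<^sub>R b + s\<^sup>2 *\<^sub>R c) has_integral l *\<^sub>R a + (l\<^sup>2 / 2) *\<^sub>R b + (l ^ 3 / 3) *\<^sub>R c) {0..l}"
proof -
  have "((\<lambda>s. a + s *\<^sub>R b + s\<^sup>2 *\<^sub>R c) has_integral
      (l *\<^sub>R a + (l\<^sup>2 / 2) *\<^sub>R b + (l ^ 3 / 3) *\<^sub>R c) - (0 *\<^sub>R a + (0\<^sup>2 / 2) *\<^sub>R b + (0 ^ 3 / 3) *\<^sub>R c)) {0..l}"
  proof (rule fundamental_theorem_of_calculus[OF assms])
    fix x
    have "((\<lambda>s. s\<^sup>2 / 2) has_real_derivative x) (at x within {0..l})"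
      "((\<lambda>s. s ^ 3 / 3) has_real_derivative x\<^sup>2) (at x within {0..l})"
      by (auto intro!: derivative_eq_intros)
    then show "((\<lambda>s. s *\<^sub>R a + (s\<^sup>2 / 2) *\<^sub>R b + (s ^ 3 / 3) *\<^sub>R c) has_vector_derivative a + x *\<^sub>R b + x\<^sup>2 *\<^sub>R c)
        (at x within {0..l})"
      by (auto intro!: derivative_eq_intros)
  qed
  then show ?thesis by simp
qed

text \<open>The torque is taken about the starting point of the link; torques about other points follow by transport.\<close>

definition link_force :: "real \<Rightarrow> real \<Rightarrow> real \<Rightarrow> real^5 \<Rightarrow> real^5 \<Rightarrow> nat \<Rightarrow> real^2" where
  "link_force l \<xi> \<eta> Z V i =
     - (l * \<xi> * (link_start_vel l Z V i \<bullet> e_par (link_angle Z i))) *\<^sub>R e_par (link_angle Z i)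
     - (\<eta> * (l * (link_start_vel l Z V i \<bullet> e_perp (link_angle Z i)) + l\<^sup>2 / 2 * link_angle V i)) *\<^sub>R e_perp (link_angle Z i)"

definition link_torque :: "real \<Rightarrow> real \<Rightarrow> real^5 \<Rightarrow> real^5 \<Rightarrow> nat \<Rightarrow> real" where
  "link_torque l \<eta> Z V i =
     - (\<eta> * (l\<^sup>2 / 2 * (link_start_vel l Z V i \<bullet> e_perp (link_angle Z i)) + l ^ 3 / 3 * link_angle V i))"

lemma drag_density_affine:
  "drag_density l \<xi> \<eta> Z V i s =
     (- (\<xi> * (link_start_vel l Z V i \<bullet> e_par (link_angle Z i))) *\<^sub>R e_par (link_angle Z i)
      - (\<eta> * (link_start_vel l Z V i \<bullet> e_perp (link_angle Z i))) *\<^sub>R e_perp (link_angle Z i))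
     + s *\<^sub>R (- (\<eta> * link_angle V i) *\<^sub>R e_perp (link_angle Z i))"
  by (simp add: drag_density_def point_vel_def inner_add_left algebra_simps)

lemma drag_force_eq:
  assumes "0 \<le> l"
  shows "drag_force l \<xi> \<eta> Z V i = link_force l \<xi> \<eta> Z V i"
proof -
  define D0 where "D0 = - (\<xi> * (link_start_vel l Z V i \<bullet> e_par (link_angle Z i))) *\<^sub>R e_par (link_angle Z i)
      - (\<eta> * (link_start_vel l Z V i \<bullet> e_perp (link_angle Z i))) *\<^sub>R e_perp (link_angle Z i)"
  define D1 where "D1 = - (\<eta> * link_angle V i) *\<^sub>R e_perp (link_angle Z i)"
  have "drag_force l \<xi> \<eta> Z V i = l *\<^sub>R D0 + (l\<^sup>2 / 2) *\<^sub>R D1"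
    unfolding drag_force_def drag_density_affine[abs_def] D0_def[symmetric] D1_def[symmetric]
    using integral_unique[OF has_integral_quadratic[OF assms, of D0 D1 0]] by simp
  then show ?thesis
    by (simp add: D0_def D1_def link_force_def algebra_simps)
qed

text \<open>The density is affine in \<open>s\<close> and the lever arm too, so the integrand is a
  quadratic polynomial. The part with the constant lever arm is the moment of the resultant force;
  the rest is the torque about the start of the link.\<close>

lemma drag_torque_eq:
  assumes "0 \<le> l"
  shows "drag_torque l \<xi> \<eta> Z V i p
    = cross_z (link_start l Z i - p) (link_force l \<xi> \<eta> Z V i) + link_torque l \<eta> Z V i"
proof -
  define D0 where "D0 = - (\<xi> * (link_start_vel l Z V i \<bullet> e_par (link_angle Z i))) *\<^sub>R e_par (link_angle Z i)
      - (\<eta> * (link_start_vel l Z V i \<bullet> e_perp (link_angle Z i))) *\<^sub>R e_perp (link_angle Z i)"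
  define D1 where "D1 = - (\<eta> * link_angle V i) *\<^sub>R e_perp (link_angle Z i)"
  let ?x = "link_start l Z i - p" and ?e = "e_par (link_angle Z i)"
  have "cross_z (link_start l Z i + s *\<^sub>R ?e - p) (D0 + s *\<^sub>R D1)
      = cross_z ?x D0 + s *\<^sub>R (cross_z ?x D1 + cross_z ?e D0) + s\<^sup>2 *\<^sub>R cross_z ?e D1" for s
    by (simp add: cross_z_def algebra_simps power2_eq_square)
  then have "drag_torque l \<xi> \<eta> Z V i p
      = l * cross_z ?x D0 + l\<^sup>2 / 2 * (cross_z ?x D1 + cross_z ?e D0) + l ^ 3 / 3 * cross_z ?e D1"
    unfolding drag_torque_def drag_density_affine D0_def[symmetric] D1_def[symmetric]
    using integral_unique[OF has_integral_quadratic[OF assms, of "cross_z ?x D0" "cross_z ?x D1 + cross_z ?e D0" "cross_z ?e D1"]]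
    by simp
  also have "\<dots> = cross_z ?x (l *\<^sub>R D0 + (l\<^sup>2 / 2) *\<^sub>R D1) + (l\<^sup>2 / 2 * cross_z ?e D0 + l ^ 3 / 3 * cross_z ?e D1)"
    by (simp add: cross_z_def field_simps)
  also have "l *\<^sub>R D0 + (l\<^sup>2 / 2) *\<^sub>R D1 = link_force l \<xi> \<eta> Z V i"
    by (simp add: D0_def D1_def link_force_def algebra_simps)
  also have "l\<^sup>2 / 2 * cross_z ?e D0 + l ^ 3 / 3 * cross_z ?e D1 = link_torque l \<eta> Z V i"
    by (simp add: D0_def D1_def link_torque_def cross_z_e_par inner_diff_right inner_commute algebra_simps)
  finally show ?thesis .
qed

lemma sum_1_3: "(\<Sum>i=1..3. f i) = f 1 + f 2 + f (3::nat)" and sum_2_3: "(\<Sum>i=2..3. f i) = f 2 + f (3::nat)"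
  by (simp_all add: numeral_3_eq_3 numeral_2_eq_2)

lemma link_interval: "{1..<1} = ({}::nat set)" "{1..<2} = {1::nat}" "{1..<3} = {1, 2::nat}"
  by auto

lemma drag_vector_explicit:
  fixes Z V :: "real^5" and l \<xi> \<eta> :: real
  assumes "0 \<le> l"
  defines "F \<equiv> link_force l \<xi> \<eta> Z V" and "\<tau> \<equiv> link_torque l \<eta> Z V"
    and "e \<equiv> \<lambda>i. e_par (link_angle Z i)" and "n \<equiv> \<lambda>i. e_perp (link_angle Z i)"
  shows "drag_vector l \<xi> \<eta> Z V = vector
    [(F 1 + F 2 + F 3) \<bullet> e 1, (F 1 + F 2 + F 3) \<bullet> n 1,
     \<tau> 1 + \<tau> 2 + \<tau> 3 + l * (n 1 \<bullet> (F 2 + F 3)) + l * (n 2 \<bullet> F 3),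
     \<tau> 2 + \<tau> 3 + l * (n 2 \<bullet> F 3), \<tau> 3]"
proof -
  have cz: "cross_z 0 v = 0" "cross_z (a *\<^sub>R u) v = a * cross_z u v" "cross_z (u + w) v = cross_z u v + cross_z w v" for a u v w
    by (simp_all add: cross_z_def algebra_simps)
  show ?thesis
    unfolding drag_vector_def drag_force_eq[OF assms(1)] drag_torque_eq[OF assms(1)] sum_1_3 sum_2_3 assms(2-)
    by (simp add: link_start_def link_interval cz cross_z_e_par inner_add_right algebra_simps del: One_nat_def)
qed

text \<open>The polarised power of the drag: for each link, the integral over \<open>s\<close> of
  \<xi> times the product of the tangential velocities plus \<eta> times the product of the normal
  velocities. The weights \<open>l\<close>, \<open>l\<^sup>2 / 2\<close>, \<open>l ^ 3 / 3\<close>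
  are the integrals of 1, \<open>s\<close>, \<open>s\<^sup>2\<close>.\<close>

definition dissipation :: "real \<Rightarrow> real \<Rightarrow> real \<Rightarrow> real^5 \<Rightarrow> real^5 \<Rightarrow> real^5 \<Rightarrow> real" where
  "dissipation l \<xi> \<eta> Z V W = (\<Sum>i=1..3.
     l * \<xi> * (link_start_vel l Z V i \<bullet> e_par (link_angle Z i)) * (link_start_vel l Z W i \<bullet> e_par (link_angle Z i))
     + \<eta> * (l * (link_start_vel l Z V i \<bullet> e_perp (link_angle Z i)) * (link_start_vel l Z W i \<bullet> e_perp (link_angle Z i))
        + l\<^sup>2 / 2 * ((link_start_vel l Z V i \<bullet> e_perp (link_angle Z i)) * link_angle W i
            + (link_start_vel l Z W i \<bullet> e_perp (link_angle Z i)) * link_angle V i)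
        + l ^ 3 / 3 * link_angle V i * link_angle W i))"

lemma dissipation_commute: "dissipation l \<xi> \<eta> Z V W = dissipation l \<xi> \<eta> Z W V"
  unfolding dissipation_def by (intro sum.cong refl) (simp add: algebra_simps)

text \<open>This exhibits the drag matrix as symmetric and negative definite.\<close>

lemma drag_power:
  assumes "0 \<le> l"
  shows "drag_vector l \<xi> \<eta> Z V \<bullet> (R_minus (Z$3) *v W) = - dissipation l \<xi> \<eta> Z V W"
proof -
  define F where "F = link_force l \<xi> \<eta> Z V"
  define \<tau> where "\<tau> = link_torque l \<eta> Z V"
  define e where "e i = e_par (link_angle Z i)" for i
  define n where "n i = e_perp (link_angle Z i)" for i
  define w where "w = (vector [W$1, W$2] :: real^2)"
  define b where "b = link_start_vel l Z W"
  have ang: "link_angle W 1 = W$3" "link_angle W 2 = W$3 + W$4" "link_angle W 3 = W$3 + W$4 + W$5"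
    by (simp_all add: link_angle_def)
  have b: "b 1 = w" "b 2 = w + (l * W$3) *\<^sub>R n 1" "b 3 = w + (l * W$3) *\<^sub>R n 1 + (l * (W$3 + W$4)) *\<^sub>R n 2"
    by (simp_all add: b_def link_start_vel_def link_interval w_def n_def ang add.assoc del: One_nat_def)
  have R: "R_minus (Z$3) *v W = vector [w \<bullet> e 1, w \<bullet> n 1, W$3, W$4, W$5]"
    by (simp add: R_minus_mult w_def e_def n_def e_par_def e_perp_def link_angle_def inner_vec_def sum_2 vec_eq_iff forall_5 algebra_simps)
  have "drag_vector l \<xi> \<eta> Z V \<bullet> (R_minus (Z$3) *v W)
      = ((F 1 + F 2 + F 3) \<bullet> e 1) * (w \<bullet> e 1) + ((F 1 + F 2 + F 3) \<bullet> n 1) * (w \<bullet> n 1)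
        + (\<tau> 1 + \<tau> 2 + \<tau> 3 + l * (n 1 \<bullet> (F 2 + F 3)) + l * (n 2 \<bullet> F 3)) * W$3
        + (\<tau> 2 + \<tau> 3 + l * (n 2 \<bullet> F 3)) * W$4 + \<tau> 3 * W$5"
    unfolding R drag_vector_explicit[OF assms] F_def[symmetric] \<tau>_def[symmetric] e_def[symmetric] n_def[symmetric]
    by (simp add: inner_vec_def sum_5)
  also have "((F 1 + F 2 + F 3) \<bullet> e 1) * (w \<bullet> e 1) + ((F 1 + F 2 + F 3) \<bullet> n 1) * (w \<bullet> n 1) = (F 1 + F 2 + F 3) \<bullet> w"
    using inner_e_frame[of "F 1 + F 2 + F 3" w "link_angle Z 1"] by (simp add: e_def n_def)
  \<comment> \<open>Summation by parts along the chain: torques about the successive joints paired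
    with relative angular rates become, link by link, force times velocity of the start plus torque
    times absolute angular velocity.\<close>
  also have "(F 1 + F 2 + F 3) \<bullet> w + (\<tau> 1 + \<tau> 2 + \<tau> 3 + l * (n 1 \<bullet> (F 2 + F 3)) + l * (n 2 \<bullet> F 3)) * W$3
        + (\<tau> 2 + \<tau> 3 + l * (n 2 \<bullet> F 3)) * W$4 + \<tau> 3 * W$5
      = (\<Sum>i=1..3. F i \<bullet> b i + \<tau> i * link_angle W i)"
    unfolding sum_1_3 b ang by (simp add: inner_add_right inner_add_left inner_commute algebra_simps)
  also have "\<dots> = - dissipation l \<xi> \<eta> Z V W"
    unfolding dissipation_def sum_negf[symmetric]
  proof (intro sum.cong refl)
    fix i
    show "F i \<bullet> b i + \<tau> i * link_angle W i = - (
      l * \<xi> * (link_start_vel l Z V i \<bullet> e_par (link_angle Z i)) * (link_start_vel l Z W i \<bullet> e_par (link_angle Z i))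
     + \<eta> * (l * (link_start_vel l Z V i \<bullet> e_perp (link_angle Z i)) * (link_start_vel l Z W i \<bullet> e_perp (link_angle Z i))
        + l\<^sup>2 / 2 * ((link_start_vel l Z V i \<bullet> e_perp (link_angle Z i)) * link_angle W i
            + (link_start_vel l Z W i \<bullet> e_perp (link_angle Z i)) * link_angle V i)
        + l ^ 3 / 3 * link_angle V i * link_angle W i))"
      unfolding F_def \<tau>_def b_def link_force_def link_torque_def
      by (simp add: inner_diff_left inner_commute algebra_simps)
  qed
  finally show ?thesis .
qed

text \<open>The dissipation of a single link is positive definite in its tangential, normal and
  angular velocity, with constants independent of the configuration. Summing over links and
  comparing with the power by Cauchy-Schwarz gives a bound uniform in \<open>Z\<close>.\<close>

lemma drag_coercive:
  assumes "l > 0" "\<xi> > 0" "\<eta> > 0"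
  shows "\<exists>K>0. \<forall>Z V. norm V \<le> K * norm (drag_vector l \<xi> \<eta> Z V)"
proof -
  \<comment> \<open>Completing the square:
    \<open>l * y\<^sup>2 + l\<^sup>2 * y * w + l ^ 3 / 3 * w\<^sup>2\<close> equals
    \<open>l / 8 * y\<^sup>2 + l ^ 3 / 21 * w\<^sup>2\<close> plus
    \<open>7 / 8 * l * (y + 4 / 7 * l * w)\<^sup>2\<close>.\<close>
  define c where "c = min (l * \<xi>) (min (\<eta> * l / 8) (\<eta> * l ^ 3 / 21))"
  have c: "c > 0" "c \<le> l * \<xi>" "c \<le> \<eta> * l / 8" "c \<le> \<eta> * l ^ 3 / 21"
    using assms by (auto simp: c_def)
  have link: "c * (x\<^sup>2 + y\<^sup>2 + w\<^sup>2) \<le> l * \<xi> * x * x + \<eta> * (l * y * y + l\<^sup>2 / 2 * (y * w + y * w) + l ^ 3 / 3 * w * w)" for x y w :: real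
  proof -
    have "c * (x\<^sup>2 + y\<^sup>2 + w\<^sup>2) \<le> l * \<xi> * x\<^sup>2 + \<eta> * l / 8 * y\<^sup>2 + \<eta> * l ^ 3 / 21 * w\<^sup>2"
      unfolding distrib_left using c by (intro add_mono mult_right_mono) auto
    moreover have "l * \<xi> * x * x + \<eta> * (l * y * y + l\<^sup>2 / 2 * (y * w + y * w) + l ^ 3 / 3 * w * w)
        - (l * \<xi> * x\<^sup>2 + \<eta> * l / 8 * y\<^sup>2 + \<eta> * l ^ 3 / 21 * w\<^sup>2) = \<eta> * l * (7 / 8) * (y + 4 / 7 * l * w)\<^sup>2"
      by (simp add: power2_eq_square power3_eq_cube algebra_simps)
    moreover have "0 \<le> \<eta> * l * (7 / 8) * (y + 4 / 7 * l * w)\<^sup>2" using assms by simp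
    ultimately show ?thesis by linarith
  qed
  have "norm V \<le> 4 / c * norm (drag_vector l \<xi> \<eta> Z V)" for Z V
  proof -
    define x where "x i = link_start_vel l Z V i \<bullet> e_par (link_angle Z i)" for i
    define y where "y i = link_start_vel l Z V i \<bullet> e_perp (link_angle Z i)" for i
    define w where "w = link_angle V"
    have w: "w 1 = V$3" "w 2 = V$3 + V$4" "w 3 = V$3 + V$4 + V$5"
      by (simp_all add: w_def link_angle_def)
    have R: "R_minus (Z$3) *v V = vector [x 1, y 1, V$3, V$4, V$5]"
      by (simp add: R_minus_mult x_def y_def e_par_def e_perp_def link_start_vel_def link_angle_def inner_vec_def sum_2 vec_eq_iff forall_5 algebra_simps)
    have "(norm V)\<^sup>2 = V$1 * V$1 + V$2 * V$2 + V$3 * V$3 + V$4 * V$4 + V$5 * V$5"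
      unfolding power2_norm_eq_inner by (simp add: inner_vec_def sum_5)
    also have "V$1 * V$1 + V$2 * V$2 = x 1 * x 1 + y 1 * y 1"
      using inner_e_frame[of "link_start_vel l Z V 1" "link_start_vel l Z V 1" "link_angle Z 1"]
      by (simp add: x_def y_def link_start_vel_def inner_vec_def sum_2)
    also have nR: "x 1 * x 1 + y 1 * y 1 + V$3 * V$3 + V$4 * V$4 + V$5 * V$5 = (norm (R_minus (Z$3) *v V))\<^sup>2"
      unfolding power2_norm_eq_inner R by (simp add: inner_vec_def sum_5)
    finally have nRV: "norm (R_minus (Z$3) *v V) = norm V"
      by simp
    have sq: "2 * (u * v) \<le> u * u + v * v" "- (2 * (u * v)) \<le> u * u + v * v" for u v :: real
      using sum_squares_ge_zero[of "u - v" 0] sum_squares_ge_zero[of "u + v" 0] by (simp_all add: algebra_simps)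
    have "(norm V)\<^sup>2 = x 1 * x 1 + y 1 * y 1 + V$3 * V$3 + V$4 * V$4 + V$5 * V$5"
      using nR nRV by simp
    also have "\<dots> = x 1 * x 1 + y 1 * y 1 + w 1 * w 1 + (w 2 - w 1) * (w 2 - w 1) + (w 3 - w 2) * (w 3 - w 2)"
      by (simp add: w del: One_nat_def)
    also have "\<dots> \<le> 4 * (\<Sum>i=1..3. (x i)\<^sup>2 + (y i)\<^sup>2 + (w i)\<^sup>2)"
    proof -
      \<comment> \<open>The angular velocity of the middle link occurs in two differences, each
        costing a factor 2; hence the 4.\<close>
      have gen: "X1 + Y1 + W1 + P + Q \<le> 4 * (X1 + Y1 + W1 + (X2 + Y2 + W2) + (X3 + Y3 + W3))"
        if "P \<le> 2 * W2 + 2 * W1" "Q \<le> 2 * W3 + 2 * W2" "0 \<le> X1" "0 \<le> Y1" "0 \<le> W1" "0 \<le> X2" "0 \<le> Y2" "0 \<le> W2"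
          "0 \<le> X3" "0 \<le> Y3" "0 \<le> W3" for P Q X1 Y1 W1 X2 Y2 W2 X3 Y3 W3 :: real
        using that by argo
      have sqw: "(w 2 - w 1) * (w 2 - w 1) \<le> 2 * (w 2 * w 2) + 2 * (w 1 * w 1)"
        "(w 3 - w 2) * (w 3 - w 2) \<le> 2 * (w 3 * w 3) + 2 * (w 2 * w 2)"
        using sq(2)[of "w 2" "w 1"] sq(2)[of "w 3" "w 2"] by (simp_all add: algebra_simps)
      show ?thesis
        unfolding sum_1_3 power2_eq_square by (rule gen[OF sqw]) simp_all
    qed
    also have "c * (4 * (\<Sum>i=1..3. (x i)\<^sup>2 + (y i)\<^sup>2 + (w i)\<^sup>2)) \<le> 4 * dissipation l \<xi> \<eta> Z V V"
      unfolding dissipation_def x_def[symmetric] y_def[symmetric] w_def[symmetric] mult.left_commute[of c]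
      unfolding sum_distrib_left[of c] by (intro mult_left_mono sum_mono link) auto
    finally have "c * (norm V)\<^sup>2 \<le> 4 * dissipation l \<xi> \<eta> Z V V" using c(1) by simp
    moreover have "- (drag_vector l \<xi> \<eta> Z V \<bullet> (R_minus (Z$3) *v V)) \<le> norm (drag_vector l \<xi> \<eta> Z V) * norm V"
      by (rule order_trans[OF abs_ge_minus_self])
        (rule Cauchy_Schwarz_ineq2[of "drag_vector l \<xi> \<eta> Z V" "R_minus (Z$3) *v V", unfolded nRV])
    moreover have "drag_vector l \<xi> \<eta> Z V \<bullet> (R_minus (Z$3) *v V) = - dissipation l \<xi> \<eta> Z V V"
      using assms by (intro drag_power) simp
    ultimately have "c * (norm V)\<^sup>2 \<le> 4 * (norm (drag_vector l \<xi> \<eta> Z V) * norm V)"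
      by linarith
    then have "(c * norm V) * norm V \<le> (4 * norm (drag_vector l \<xi> \<eta> Z V)) * norm V"
      by (simp only: power2_eq_square mult.assoc)
    then have "c * norm V \<le> 4 * norm (drag_vector l \<xi> \<eta> Z V)"
      using mult_right_le_imp_le[of "c * norm V" "norm V"] by (cases "V = 0") auto
    then show ?thesis using c(1) by (simp add: pos_le_divide_eq mult.commute)
  qed
  then show ?thesis using c(1) by (intro exI[of _ "4 / c"]) auto
qed

section \<open>Lipschitz estimates for the swimmer\<close>

text \<open>Boundedness is built in because only then are Lipschitz functions closed under products.
  One constant serves both estimates.\<close>

definition bounded_lipschitz :: "('p::metric_space \<Rightarrow> 'b::real_normed_vector) \<Rightarrow> bool" where
  "bounded_lipschitz f \<longleftrightarrow> (\<exists>K. \<forall>x y. norm (f x) \<le> K \<and> norm (f x - f y) \<le> K * dist x y)"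

lemma bounded_lipschitzE:
  assumes "bounded_lipschitz f"
  obtains K where "K \<ge> 0" "\<And>x. norm (f x) \<le> K" "\<And>x y. norm (f x - f y) \<le> K * dist x y"
proof -
  obtain K where K: "\<forall>x y. norm (f x) \<le> K \<and> norm (f x - f y) \<le> K * dist x y"
    using assms unfolding bounded_lipschitz_def by blast
  then have "K \<ge> 0" using norm_ge_zero order_trans by blast
  with K that show ?thesis by blast
qed

lemma bounded_lipschitz_const: "bounded_lipschitz (\<lambda>x. c)"
  unfolding bounded_lipschitz_def by (intro exI[of _ "norm c"]) simp

lemma bounded_lipschitz_add:
  assumes "bounded_lipschitz f" "bounded_lipschitz g"
  shows "bounded_lipschitz (\<lambda>x. f x + g x)"
proof -
  obtain K where K: "K \<ge> 0" "\<And>x. norm (f x) \<le> K" "\<And>x y. norm (f x - f y) \<le> K * dist x y"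
    by (rule bounded_lipschitzE[OF assms(1)]) (rule that)
  obtain L where L: "L \<ge> 0" "\<And>x. norm (g x) \<le> L" "\<And>x y. norm (g x - g y) \<le> L * dist x y"
    by (rule bounded_lipschitzE[OF assms(2)]) (rule that)
  have "norm (f x + g x) \<le> K + L" for x
    by (intro norm_triangle_mono K L)
  moreover have "norm (f x + g x - (f y + g y)) \<le> (K + L) * dist x y" for x y
    unfolding distrib_right add_diff_add by (intro norm_triangle_mono K L)
  ultimately show ?thesis unfolding bounded_lipschitz_def by blast
qed

lemma (in bounded_bilinear) bounded_lipschitz_bilinear:
  assumes "bounded_lipschitz f" "bounded_lipschitz g"
  shows "bounded_lipschitz (\<lambda>x. prod (f x) (g x))"
proof -
  obtain K where K: "K \<ge> 0" "\<And>x. norm (f x) \<le> K" "\<And>x y. norm (f x - f y) \<le> K * dist x y"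
    by (rule bounded_lipschitzE[OF assms(1)]) (rule that)
  obtain L where L: "L \<ge> 0" "\<And>x. norm (g x) \<le> L" "\<And>x y. norm (g x - g y) \<le> L * dist x y"
    by (rule bounded_lipschitzE[OF assms(2)]) (rule that)
  obtain C where C: "C \<ge> 0" "\<And>a b. norm (prod a b) \<le> norm a * norm b * C"
    using nonneg_bounded by blast
  have "norm (prod (f x) (g x)) \<le> 2 * K * L * C" for x
  proof -
    have "norm (prod (f x) (g x)) \<le> norm (f x) * norm (g x) * C" by (rule C)
    also have "\<dots> \<le> (2 * K) * L * C"
      using K(1) K(2)[of x] L(1) L(2)[of x] C(1) by (intro mult_mono) auto
    finally show ?thesis .
  qed
  moreover have "norm (prod (f x) (g x) - prod (f y) (g y)) \<le> 2 * K * L * C * dist x y" for x y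
  proof -
    have "prod (f x) (g x) - prod (f y) (g y) = prod (f x - f y) (g x) + prod (f y) (g x - g y)"
      by (simp add: diff_left diff_right)
    also have "norm \<dots> \<le> norm (f x - f y) * norm (g x) * C + norm (f y) * norm (g x - g y) * C"
      by (intro norm_triangle_mono C)
    also have "\<dots> \<le> (K * dist x y) * L * C + K * (L * dist x y) * C"
      using K L C(1) by (intro add_mono mult_mono) auto
    finally show ?thesis by (simp add: algebra_simps)
  qed
  ultimately show ?thesis unfolding bounded_lipschitz_def by blast
qed

lemmas bounded_lipschitz_scaleR = bounded_bilinear.bounded_lipschitz_bilinear[OF bounded_bilinear_scaleR]
lemmas bounded_lipschitz_inner = bounded_bilinear.bounded_lipschitz_bilinear[OF bounded_bilinear_inner]
lemmas bounded_lipschitz_mult = bounded_bilinear.bounded_lipschitz_bilinear[OF bounded_bilinear_mult]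

lemma bounded_lipschitz_minus: "bounded_lipschitz f \<Longrightarrow> bounded_lipschitz (\<lambda>x. - f x)"
  using bounded_lipschitz_scaleR[OF bounded_lipschitz_const[of "-1"]] by fastforce

lemma bounded_lipschitz_diff: "bounded_lipschitz f \<Longrightarrow> bounded_lipschitz g \<Longrightarrow> bounded_lipschitz (\<lambda>x. f x - g x)"
  using bounded_lipschitz_add[OF _ bounded_lipschitz_minus] by fastforce

lemma bounded_lipschitz_sin_cos:
  fixes g :: "'p::metric_space \<Rightarrow> real"
  assumes "\<And>x y. \<bar>g x - g y\<bar> \<le> C * dist x y"
  shows "bounded_lipschitz (\<lambda>x. sin (g x))" "bounded_lipschitz (\<lambda>x. cos (g x))"
proof -
  have C: "C * dist x y \<le> max 1 C * dist x y" for x y :: 'p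
    by (intro mult_right_mono) auto
  have "norm (sin a - sin b) \<le> 1 * norm (a - b)" "norm (cos a - cos b) \<le> 1 * norm (a - b)" for a b :: real
    by (rule field_differentiable_bound[of UNIV _ cos] field_differentiable_bound[of UNIV _ "\<lambda>x. - sin x"];
        auto intro!: derivative_eq_intros)+
  then have lip: "norm (sin (g x) - sin (g y)) \<le> max 1 C * dist x y" "norm (cos (g x) - cos (g y)) \<le> max 1 C * dist x y" for x y
    using assms[of x y] C[of x y] by (fastforce intro: order_trans)+
  have bd: "norm (sin a) \<le> max 1 C" "norm (cos a) \<le> max 1 C" for a :: real
    by (simp_all add: le_max_iff_disj)
  show "bounded_lipschitz (\<lambda>x. sin (g x))" "bounded_lipschitz (\<lambda>x. cos (g x))"
    unfolding bounded_lipschitz_def using lip bd by blast+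
qed

text \<open>Lipschitz bounds for each fixed \<open>v\<close> become uniform in \<open>v\<close> by
  expanding \<open>v\<close> in the finite basis and adding up the constants of the basis
  vectors.\<close>

lemma linear_family_lipschitz:
  fixes D :: "'p::metric_space \<Rightarrow> 'v::euclidean_space \<Rightarrow> 'w::real_normed_vector"
  assumes lin: "\<And>x. linear (D x)" and bl: "\<And>v. bounded_lipschitz (\<lambda>x. D x v)"
  shows "\<exists>C\<ge>0. \<forall>x y v. norm (D x v - D y v) \<le> C * dist x y * norm v"
proof -
  have "\<forall>b. \<exists>K\<ge>0. \<forall>x y. norm (D x b - D y b) \<le> K * dist x y"
    using bounded_lipschitzE[OF bl] by metis
  then obtain K where K: "\<And>b. K b \<ge> 0" "\<And>b x y. norm (D x b - D y b) \<le> K b * dist x y" by metis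
  have "norm (D x v - D y v) \<le> (\<Sum>b\<in>Basis. K b) * dist x y * norm v" for x y v
  proof -
    have exp: "D x v = (\<Sum>b\<in>Basis. (v \<bullet> b) *\<^sub>R D x b)" for x
      by (subst euclidean_representation[of v, symmetric]) (simp add: linear_sum[OF lin] linear_scale[OF lin])
    have "D x v - D y v = (\<Sum>b\<in>Basis. (v \<bullet> b) *\<^sub>R (D x b - D y b))"
      unfolding exp[of x] exp[of y] by (simp add: sum_subtractf scaleR_diff_right)
    also have "norm \<dots> \<le> (\<Sum>b\<in>Basis. norm v * (K b * dist x y))"
    proof (rule sum_norm_le)
      fix b :: 'v assume "b \<in> Basis"
      then show "norm ((v \<bullet> b) *\<^sub>R (D x b - D y b)) \<le> norm v * (K b * dist x y)"
        using K Basis_le_norm[of b v] by (simp add: mult_mono)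
    qed
    finally show ?thesis by (simp add: sum_distrib_left sum_distrib_right mult_ac)
  qed
  then show ?thesis using K(1) by (intro exI[of _ "\<Sum>b\<in>Basis. K b"]) (simp add: sum_nonneg)
qed

section \<open>Lipschitz dependence of the drag on the configuration\<close>

lemma bounded_lipschitz_e:
  "bounded_lipschitz (\<lambda>Z. e_par (link_angle Z i))" "bounded_lipschitz (\<lambda>Z. e_perp (link_angle Z i))"
proof -
  have "link_angle Z i - link_angle Y i = link_angle (Z - Y) i" for Z Y
    by (simp add: link_angle_def)
  moreover have "\<bar>link_angle W i\<bar> \<le> 3 * norm W" for W
    using component_le_norm_cart[of W 3] component_le_norm_cart[of W 4] component_le_norm_cart[of W 5]
    by (auto simp: link_angle_def)
  ultimately have "\<bar>link_angle Z i - link_angle Y i\<bar> \<le> 3 * dist Z Y" for Z Y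
    by (simp add: dist_norm)
  note bl = bounded_lipschitz_sin_cos[OF this]
  have eq: "e_par \<phi> = cos \<phi> *\<^sub>R axis 1 1 + sin \<phi> *\<^sub>R axis 2 1" "e_perp \<phi> = (- sin \<phi>) *\<^sub>R axis 1 1 + cos \<phi> *\<^sub>R axis 2 1" for \<phi>
    by (simp_all add: e_par_def e_perp_def vec_eq_iff forall_2 axis_def)
  show "bounded_lipschitz (\<lambda>Z. e_par (link_angle Z i))" "bounded_lipschitz (\<lambda>Z. e_perp (link_angle Z i))"
    unfolding eq by (intro bounded_lipschitz_add bounded_lipschitz_scaleR bounded_lipschitz_minus bounded_lipschitz_const bl)+
qed

lemmas bounded_lipschitz_intros = bounded_lipschitz_const bounded_lipschitz_e bounded_lipschitz_add bounded_lipschitz_diff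
  bounded_lipschitz_minus bounded_lipschitz_scaleR bounded_lipschitz_inner bounded_lipschitz_mult

lemma bounded_lipschitz_sum:
  "finite I \<Longrightarrow> (\<And>i. i \<in> I \<Longrightarrow> bounded_lipschitz (f i)) \<Longrightarrow> bounded_lipschitz (\<lambda>x. \<Sum>i\<in>I. f i x)"
  by (induction I rule: finite_induct) (auto intro: bounded_lipschitz_intros)

lemma drag_vector_lipschitz:
  assumes "0 \<le> l"
  shows "\<exists>C\<ge>0. \<forall>Y Z V. norm (drag_vector l \<xi> \<eta> Y V - drag_vector l \<xi> \<eta> Z V) \<le> C * dist Y Z * norm V"
proof (rule linear_family_lipschitz[OF drag_vector_linear])
  fix V
  have v: "bounded_lipschitz (\<lambda>Z. link_start_vel l Z V i)" for i
    unfolding link_start_vel_def by (intro bounded_lipschitz_intros bounded_lipschitz_sum finite_atLeastLessThan)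
  have F: "bounded_lipschitz (\<lambda>Z. link_force l \<xi> \<eta> Z V i)" and \<tau>: "bounded_lipschitz (\<lambda>Z. link_torque l \<eta> Z V i)" for i
    unfolding link_force_def link_torque_def by (intro bounded_lipschitz_intros v)+
  have eq: "(vector [a, b, c, d, e] :: real^5)
      = a *\<^sub>R axis 1 1 + b *\<^sub>R axis 2 1 + c *\<^sub>R axis 3 1 + d *\<^sub>R axis 4 1 + e *\<^sub>R axis 5 1" for a b c d e
    by (simp add: vec_eq_iff forall_5 axis_def)
  show "bounded_lipschitz (\<lambda>Z. drag_vector l \<xi> \<eta> Z V)"
    unfolding drag_vector_explicit[OF assms] eq by (intro bounded_lipschitz_intros F \<tau>)
qed

text \<open>Since \<open>D p (V - V')\<close> is
  \<open>(\<tau> - \<tau>') - (D p V' - D p' V')\<close>, coercivity of \<open>D p\<close> transfers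
  the regularity of \<open>D\<close> and of the right-hand side to the solution, without estimating
  an inverse matrix.\<close>

lemma linear_equation_perturbation:
  fixes D :: "'p::metric_space \<Rightarrow> 'v::real_normed_vector \<Rightarrow> 'w::real_normed_vector"
  assumes lin: "linear (D p)" and coercive: "\<And>V. norm V \<le> K * norm (D p V)" and "K \<ge> 0"
    and lip: "norm (D p V' - D p' V') \<le> C * dist p p' * norm V'"
    and eq: "D p V = \<tau>" "D p' V' = \<tau>'"
  shows "norm (V - V') \<le> K * (norm (\<tau> - \<tau>') + C * dist p p' * norm V')"
proof -
  have "norm (V - V') \<le> K * norm (D p (V - V'))" by (rule coercive)
  also have "D p (V - V') = (\<tau> - \<tau>') - (D p V' - D p' V')"
    using eq by (simp add: linear_diff[OF lin])
  also have "norm \<dots> \<le> norm (\<tau> - \<tau>') + C * dist p p' * norm V'"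
    using norm_triangle_ineq4 lip by (metis add_left_mono order_trans)
  finally show ?thesis using \<open>K \<ge> 0\<close> by (simp add: mult_left_mono)
qed

section \<open>The swimmer field as the solution of a linear load equation\<close>

lemma drag_matrix_mult: "drag_matrix l \<xi> \<eta> \<alpha>1 \<alpha>2 *v V = drag_vector l \<xi> \<eta> (vector [0, 0, 0, \<alpha>1, \<alpha>2]) V"
proof -
  have "R_minus 0 *v V = V" by (simp add: R_minus_mult vec_eq_iff forall_5)
  then show ?thesis by (simp add: drag_vector_eq)
qed

lemma invertible_drag_matrix:
  assumes "l > 0" "\<xi> > 0" "\<eta> > 0"
  shows "invertible (drag_matrix l \<xi> \<eta> \<alpha>1 \<alpha>2)"
proof -
  obtain K where K: "\<forall>Z V. norm V \<le> K * norm (drag_vector l \<xi> \<eta> Z V)"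
    using drag_coercive[OF assms] by blast
  have "V = 0" if "drag_matrix l \<xi> \<eta> \<alpha>1 \<alpha>2 *v V = 0" for V
    using K[rule_format, of V "vector [0, 0, 0, \<alpha>1, \<alpha>2]"] that by (simp add: drag_matrix_mult)
  then show ?thesis
    unfolding invertible_left_inverse matrix_left_invertible_ker by blast
qed

lemma matrix_inv_cancel:
  fixes A :: "real^'n^'n"
  assumes "invertible A"
  shows "A *v (matrix_inv A *v x) = x"
proof -
  have "A ** matrix_inv A = mat 1"
    using someI_ex[OF assms[unfolded invertible_def]] unfolding matrix_inv_def by blast
  then show ?thesis by (simp add: matrix_vector_mul_assoc)
qed

text \<open>The velocity \<open>Z'\<close> when the loads on the links balance the drag; \<open>p\<close> collects the angles.\<close>

definition swim_velocity :: "real \<Rightarrow> real \<Rightarrow> real \<Rightarrow> real^3 \<Rightarrow> real^5 \<Rightarrow> real^5" where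
  "swim_velocity l \<xi> \<eta> p \<tau> = matrix_inv (R_minus (p$1)) *v (matrix_inv (drag_matrix l \<xi> \<eta> (p$2) (p$3)) *v \<tau>)"

text \<open>The fields \<open>F0\<close>, \<open>F1\<close>, \<open>F2\<close> are the inverse drag
  matrix applied to explicit combinations of the axes 3, 4, 5. This definition and the next record
  those combinations; \<open>d\<close> is the displacement of the angles from rest.\<close>

definition elastic_load :: "real \<Rightarrow> real^3 \<Rightarrow> real^5" where
  "elastic_load \<kappa> d = - \<kappa> *\<^sub>R (d$2 *\<^sub>R axis 4 1 + d$3 *\<^sub>R axis 5 1)"

definition magnetic_load :: "real \<Rightarrow> real \<Rightarrow> real \<Rightarrow> real^3 \<Rightarrow> real^2 \<Rightarrow> real^5" where
  "magnetic_load M1 M2 M3 p u =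
     u$1 *\<^sub>R ((M2 * sin (p$2) + M3 * sin (p$2 + p$3)) *\<^sub>R (axis 3 1 + axis 4 1) + (M3 * sin (p$2 + p$3)) *\<^sub>R axis 5 1)
     + u$2 *\<^sub>R (- M1 *\<^sub>R axis 3 1 - (M2 * cos (p$2) + M3 * cos (p$2 + p$3)) *\<^sub>R (axis 3 1 + axis 4 1)
         - (M3 * cos (p$2 + p$3)) *\<^sub>R axis 5 1)"

definition split_state :: "real^5 \<Rightarrow> (real^2) \<times> (real^3)" where
  "split_state V = (state_xy V, state_angles V)"

lemma linear_split_state: "linear split_state"
  by (rule linearI) (simp_all add: split_state_def state_xy_def state_angles_def vec_eq_iff forall_2 forall_3)

lemma norm_split_state: "norm (split_state V) = norm V"
  unfolding norm_eq_sqrt_inner split_state_def inner_Pair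
  by (simp add: state_xy_def state_angles_def inner_vec_def sum_2 sum_3 sum_5)

lemma norm_split_state_diff: "norm (split_state V - split_state W) = norm (V - W)"
  by (simp add: norm_split_state flip: linear_diff[OF linear_split_state])

lemma linear_swim_velocity: "linear (swim_velocity l \<xi> \<eta> p)"
  unfolding swim_velocity_def
  by (rule linearI) (simp_all add: matrix_vector_right_distrib matrix_vector_mult_scaleR)

lemma linear_elastic_load: "linear (elastic_load \<kappa>)"
  by (rule linearI) (simp_all add: elastic_load_def algebra_simps)

lemma linear_magnetic_load: "linear (magnetic_load M1 M2 M3 p)"
  by (rule linearI) (simp_all add: magnetic_load_def algebra_simps)

text \<open>Column \<open>k\<close> of the inverse is the inverse applied to axis \<open>k\<close>.
  The angle \<open>\<theta>\<close> may be arbitrary because the springs read only components 2 and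
  3 of the displacement; later it is set to 0 or to the equilibrium orientation.\<close>

lemma swimmer_field_split:
  "swimmer_field l \<xi> \<eta> \<kappa> M1 M2 M3 \<alpha>0 q p u
    = split_state (swim_velocity l \<xi> \<eta> p (elastic_load \<kappa> (p - vector [\<theta>, 0, \<alpha>0]) + magnetic_load M1 M2 M3 p u))"
proof -
  have X: "X_col l \<xi> \<eta> k \<alpha>1 \<alpha>2 = matrix_inv (drag_matrix l \<xi> \<eta> \<alpha>1 \<alpha>2) *v axis k 1" for k \<alpha>1 \<alpha>2
    by (simp add: X_col_def matrix_vector_mul_component matrix_vector_mult_basis)
  show ?thesis
    unfolding swimmer_field_def Let_def split_state_def[symmetric] swim_velocity_def F0_def F1_def F2_def X
      elastic_load_def magnetic_load_def
    by (simp add: matrix_vector_right_distrib matrix_vector_mult_diff_distrib matrix_vector_mult_scaleR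
        linear_neg[OF matrix_vector_mul_linear] algebra_simps)
qed

lemma drag_swim_velocity:
  assumes "l > 0" "\<xi> > 0" "\<eta> > 0"
  shows "drag_vector l \<xi> \<eta> (state 0 p) (swim_velocity l \<xi> \<eta> p \<tau>) = \<tau>"
  by (simp add: drag_vector_eq state_def swim_velocity_def matrix_inv_cancel invertible_R_minus invertible_drag_matrix assms)

lemma dist_state: "dist (state 0 p) (state 0 p') = dist p p'"
  unfolding dist_norm norm_eq_sqrt_inner by (simp add: state_def inner_vec_def sum_3 sum_5)

lemma magnetic_load_lipschitz:
  "\<exists>K\<ge>0. \<forall>p p' u. norm (magnetic_load M1 M2 M3 p u) \<le> K * norm u \<and>
     norm (magnetic_load M1 M2 M3 p u - magnetic_load M1 M2 M3 p' u) \<le> K * dist p p' * norm u"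
proof -
  have comp: "\<bar>(p - p')$i\<bar> \<le> dist p p'" for p p' :: "real^3" and i
    using component_le_norm_cart[of "p - p'" i] by (simp add: dist_norm)
  have c2: "\<bar>p$2 - p'$2\<bar> \<le> 1 * dist p p'" and c23: "\<bar>(p$2 + p$3) - (p'$2 + p'$3)\<bar> \<le> 2 * dist p p'" for p p' :: "real^3"
    using comp[of p p' 2] comp[of p p' 3] by auto
  note bl = bounded_lipschitz_sin_cos[OF c2] bounded_lipschitz_sin_cos[OF c23]
  have "bounded_lipschitz (\<lambda>p. magnetic_load M1 M2 M3 p u)" for u
    unfolding magnetic_load_def by (intro bounded_lipschitz_intros bl)
  then obtain C where C: "C \<ge> 0" "\<forall>p p' u. norm (magnetic_load M1 M2 M3 p u - magnetic_load M1 M2 M3 p' u) \<le> C * dist p p' * norm u"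
    using linear_family_lipschitz[of "magnetic_load M1 M2 M3"] linear_magnetic_load by blast
  have sc: "\<bar>M * sin t\<bar> \<le> \<bar>M\<bar>" "\<bar>M * cos t\<bar> \<le> \<bar>M\<bar>" for M t :: real
    by (simp_all add: abs_mult mult_left_le)
  \<comment> \<open>Three nonzero entries, each bounded by twice the sum of the moments times
    \<open>norm u\<close>.\<close>
  have "norm (magnetic_load M1 M2 M3 p u) \<le> (6 * (\<bar>M1\<bar> + \<bar>M2\<bar> + \<bar>M3\<bar>)) * norm u" for p u
  proof -
    let ?m = "\<bar>M1\<bar> + \<bar>M2\<bar> + \<bar>M3\<bar>" and ?L = "magnetic_load M1 M2 M3 p u"
    have L: "?L$1 = 0" "?L$2 = 0"
      "?L$3 = u$1 * (M2 * sin (p$2) + M3 * sin (p$2 + p$3)) + u$2 * (- M1 - (M2 * cos (p$2) + M3 * cos (p$2 + p$3)))"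
      "?L$4 = u$1 * (M2 * sin (p$2) + M3 * sin (p$2 + p$3)) + u$2 * (- (M2 * cos (p$2) + M3 * cos (p$2 + p$3)))"
      "?L$5 = u$1 * (M3 * sin (p$2 + p$3)) + u$2 * (- (M3 * cos (p$2 + p$3)))"
      by (simp_all add: magnetic_load_def axis_def)
    have two: "\<bar>u$1 * a + u$2 * b\<bar> \<le> 2 * ?m * norm u" if "\<bar>a\<bar> \<le> ?m" "\<bar>b\<bar> \<le> ?m" for a b
    proof -
      have "\<bar>u$1 * a + u$2 * b\<bar> \<le> \<bar>u$1\<bar> * \<bar>a\<bar> + \<bar>u$2\<bar> * \<bar>b\<bar>"
        by (metis abs_mult abs_triangle_ineq)
      also have "\<dots> \<le> norm u * ?m + norm u * ?m"
        by (intro add_mono mult_mono component_le_norm_cart that) auto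
      finally show ?thesis by (simp add: algebra_simps)
    qed
    have "norm ?L \<le> (\<Sum>i\<in>UNIV. \<bar>?L$i\<bar>)" by (rule norm_le_l1_cart)
    also have "\<dots> = \<bar>?L$3\<bar> + \<bar>?L$4\<bar> + \<bar>?L$5\<bar>" by (simp add: sum_5 L(1,2))
    also have "\<dots> \<le> 2 * ?m * norm u + 2 * ?m * norm u + 2 * ?m * norm u"
      unfolding L(3-) using sc(1)[of M2 "p$2"] sc(2)[of M2 "p$2"] sc(1)[of M3 "p$2 + p$3"] sc(2)[of M3 "p$2 + p$3"]
      by (intro add_mono two) linarith+
    finally show ?thesis by (simp add: algebra_simps)
  qed
  note bd = this
  let ?K = "C + 6 * (\<bar>M1\<bar> + \<bar>M2\<bar> + \<bar>M3\<bar>)"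
  have "norm (magnetic_load M1 M2 M3 p u) \<le> ?K * norm u" for p u
    by (rule order_trans[OF bd]) (use C(1) in \<open>auto intro!: mult_right_mono\<close>)
  moreover have "norm (magnetic_load M1 M2 M3 p u - magnetic_load M1 M2 M3 p' u) \<le> ?K * dist p p' * norm u" for p p' u
    by (rule order_trans[OF C(2)[rule_format]]) (auto intro!: mult_right_mono)
  ultimately show ?thesis using C(1) by (intro exI[of _ ?K]) auto
qed

text \<open>Perturbation of the load equation, with load and drag both Lipschitz. The constant
  depends on \<open>R\<close> through the bound \<open>B\<close> on the velocity, as the elastic
  load grows with the displacement.\<close>

lemma swimmer_field_lipschitz:
  fixes l \<xi> \<eta> \<kappa> M1 M2 M3 \<alpha>0 :: real
  assumes pos: "l > 0" "\<xi> > 0" "\<eta> > 0"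
  shows "\<exists>L. \<forall>z\<in>cball ze R. \<forall>z'\<in>cball ze R. \<forall>u\<in>cball 0 1. \<forall>u'\<in>cball 0 1.
    norm (swimmer_field l \<xi> \<eta> \<kappa> M1 M2 M3 \<alpha>0 (fst z) (snd z) u - swimmer_field l \<xi> \<eta> \<kappa> M1 M2 M3 \<alpha>0 (fst z') (snd z') u')
      \<le> L * (norm (z - z') + norm (u - u'))"
proof -
  define pe :: "real^3" where "pe = vector [0, 0, \<alpha>0]"
  define S where "S = swim_velocity l \<xi> \<eta>"
  define D where "D p = drag_vector l \<xi> \<eta> (state 0 p)" for p
  define h where "h = magnetic_load M1 M2 M3"
  define E where "E = elastic_load \<kappa>"
  have DS: "D p (S p \<tau>) = \<tau>" for p \<tau> by (simp add: D_def S_def drag_swim_velocity pos)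
  obtain Kc where Kc: "Kc > 0" "\<And>p V. norm V \<le> Kc * norm (D p V)"
    using drag_coercive[OF pos] unfolding D_def by blast
  obtain C where C: "C \<ge> 0" "\<And>p p' V. norm (D p V - D p' V) \<le> C * dist p p' * norm V"
    using drag_vector_lipschitz[of l \<xi> \<eta>] pos unfolding D_def dist_state[symmetric] by (meson less_imp_le)
  obtain K where K: "K \<ge> 0" "\<And>p u. norm (h p u) \<le> K * norm u" "\<And>p p' u. norm (h p u - h p' u) \<le> K * dist p p' * norm u"
    using magnetic_load_lipschitz[of M1 M2 M3] unfolding h_def by blast
  obtain e where e: "e > 0" "\<And>d. norm (E d) \<le> e * norm d"
    using linear_bounded_pos[OF linear_elastic_load[of \<kappa>]] unfolding E_def by blast
  define \<tau> where "\<tau> p u = E (p - pe) + h p u" for p u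
  define B where "B = Kc * (e * (\<bar>R\<bar> + norm (snd ze - pe)) + K)"
  have B: "B \<ge> 0" using Kc(1) e(1) K(1) by (simp add: B_def)
  define L where "L = Kc * (e + K + C * B)"
  have "norm (S p (\<tau> p u) - S p' (\<tau> p' u')) \<le> L * (dist p p' + norm (u - u'))"
    if "norm u \<le> 1" "norm u' \<le> 1" "dist (snd ze) p' \<le> R" for p p' u u'
  proof -
    have "norm (p' - pe) \<le> \<bar>R\<bar> + norm (snd ze - pe)"
      using norm_triangle_ineq[of "p' - snd ze" "snd ze - pe"] that(3) by (simp add: dist_norm norm_minus_commute)
    then have "norm (\<tau> p' u') \<le> e * (\<bar>R\<bar> + norm (snd ze - pe)) + K * 1"
      unfolding \<tau>_def using e K that(2)
      by (intro norm_triangle_mono order_trans[OF e(2)] order_trans[OF K(2)] mult_left_mono) auto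
    then have "Kc * norm (D p' (S p' (\<tau> p' u'))) \<le> B"
      unfolding DS B_def using Kc(1) by (intro mult_left_mono) auto
    then have V': "norm (S p' (\<tau> p' u')) \<le> B" using Kc(2) order_trans by blast
    have "\<tau> p u - \<tau> p' u' = E (p - p') + (h p (u - u') + (h p u' - h p' u'))"
      unfolding \<tau>_def E_def h_def
      by (simp add: linear_diff[OF linear_elastic_load] linear_diff[OF linear_magnetic_load])
    also have "norm \<dots> \<le> e * dist p p' + (K * norm (u - u') + K * dist p p' * 1)"
      using K that(2) by (intro norm_triangle_mono e(2)[of "p - p'", folded dist_norm] K(2) order_trans[OF K(3)] mult_left_mono) auto
    finally have \<tau>: "norm (\<tau> p u - \<tau> p' u') \<le> e * dist p p' + (K * norm (u - u') + K * dist p p' * 1)" .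
    have "norm (S p (\<tau> p u) - S p' (\<tau> p' u'))
        \<le> Kc * (norm (\<tau> p u - \<tau> p' u') + C * dist p p' * norm (S p' (\<tau> p' u')))"
      by (rule linear_equation_perturbation[where D = D, OF _ Kc(2) _ C(2) DS DS])
        (use Kc(1) in \<open>auto simp: D_def drag_vector_linear\<close>)
    also have "\<dots> \<le> Kc * ((e * dist p p' + (K * norm (u - u') + K * dist p p' * 1)) + C * dist p p' * B)"
      using Kc(1) \<tau> V' C(1) by (intro mult_left_mono add_mono) auto
    also have "\<dots> = Kc * ((e + K + C * B) * dist p p' + K * norm (u - u'))" by (simp add: algebra_simps)
    also have "\<dots> \<le> Kc * ((e + K + C * B) * dist p p' + (e + K + C * B) * norm (u - u'))"
      using Kc(1) e(1) C(1) B by (intro mult_left_mono add_left_mono mult_right_mono) auto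
    finally show ?thesis by (simp add: L_def algebra_simps)
  qed note main = this
  have L: "L \<ge> 0" using Kc(1) e(1) K(1) C(1) B by (simp add: L_def)
  have f: "swimmer_field l \<xi> \<eta> \<kappa> M1 M2 M3 \<alpha>0 q p u = split_state (S p (\<tau> p u))" for q p u
    unfolding swimmer_field_split[where \<theta> = 0] S_def \<tau>_def E_def h_def pe_def ..
  have dist_snd: "dist (snd z) (snd z') \<le> dist z z'" for z z' :: "(real^2) \<times> (real^3)"
    by (rule dist_snd_le)
  show ?thesis
  proof (intro exI[of _ L] ballI)
    fix z z' :: "(real^2) \<times> (real^3)" and u u' :: "real^2"
    assume z: "z \<in> cball ze R" "z' \<in> cball ze R" and u: "u \<in> cball 0 1" "u' \<in> cball 0 1"
    have "dist (snd ze) (snd z') \<le> R" using z(2) dist_snd[of ze z'] by simp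
    then have "norm (S (snd z) (\<tau> (snd z) u) - S (snd z') (\<tau> (snd z') u')) \<le> L * (dist (snd z) (snd z') + norm (u - u'))"
      using u by (intro main) auto
    also have "\<dots> \<le> L * (norm (z - z') + norm (u - u'))"
      using L dist_snd[of z z'] by (intro mult_left_mono add_right_mono) (auto simp: dist_norm)
    finally show "norm (swimmer_field l \<xi> \<eta> \<kappa> M1 M2 M3 \<alpha>0 (fst z) (snd z) u - swimmer_field l \<xi> \<eta> \<kappa> M1 M2 M3 \<alpha>0 (fst z') (snd z') u')
      \<le> L * (norm (z - z') + norm (u - u'))"
      unfolding f norm_split_state_diff .
  qed
qed

text \<open>The inverse drag matrix and the rotation stay frozen at \<open>pe\<close>: the load is 0
  at equilibrium, so their derivatives would be multiplied by 0.\<close>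

definition linearised_drift :: "real \<Rightarrow> real \<Rightarrow> real \<Rightarrow> real \<Rightarrow> real^3 \<Rightarrow> (real^2) \<times> (real^3) \<Rightarrow> (real^2) \<times> (real^3)" where
  "linearised_drift l \<xi> \<eta> \<kappa> pe z = split_state (swim_velocity l \<xi> \<eta> pe (elastic_load \<kappa> (snd z)))"

definition linearised_control :: "real \<Rightarrow> real \<Rightarrow> real \<Rightarrow> real \<Rightarrow> real \<Rightarrow> real \<Rightarrow> real^3 \<Rightarrow> real^2 \<Rightarrow> (real^2) \<times> (real^3)" where
  "linearised_control l \<xi> \<eta> M1 M2 M3 pe u = split_state (swim_velocity l \<xi> \<eta> pe (magnetic_load M1 M2 M3 pe u))"

lemma linear_linearised: "linear (linearised_drift l \<xi> \<eta> \<kappa> pe)" "linear (linearised_control l \<xi> \<eta> M1 M2 M3 pe)"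
  unfolding linearised_drift_def linearised_control_def
  by (rule linearI; simp add: linear_add[OF linear_split_state] linear_add[OF linear_swim_velocity]
      linear_add[OF linear_elastic_load] linear_add[OF linear_magnetic_load]
      linear_scale[OF linear_split_state] linear_scale[OF linear_swim_velocity]
      linear_scale[OF linear_elastic_load] linear_scale[OF linear_magnetic_load])+

lemma swimmer_field_linearisation:
  fixes l \<xi> \<eta> \<kappa> M1 M2 M3 \<alpha>0 \<theta>e :: real and qe :: "real^2"
  assumes pos: "l > 0" "\<xi> > 0" "\<eta> > 0"
  defines "pe \<equiv> vector [\<theta>e, 0, \<alpha>0]"
  shows "\<exists>C. \<forall>z\<in>cball (qe, pe) 1. \<forall>u\<in>cball 0 1.
    norm (swimmer_field l \<xi> \<eta> \<kappa> M1 M2 M3 \<alpha>0 (fst z) (snd z) u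
        - (linearised_drift l \<xi> \<eta> \<kappa> pe (z - (qe, pe)) + linearised_control l \<xi> \<eta> M1 M2 M3 pe u))
      \<le> C * (norm (z - (qe, pe)) + norm u)\<^sup>2"
proof -
  define S where "S = swim_velocity l \<xi> \<eta>"
  define D where "D p = drag_vector l \<xi> \<eta> (state 0 p)" for p
  define h where "h = magnetic_load M1 M2 M3"
  define E where "E = elastic_load \<kappa>"
  have DS: "D p (S p \<tau>) = \<tau>" for p \<tau> by (simp add: D_def S_def drag_swim_velocity pos)
  obtain Kc where Kc: "Kc > 0" "\<And>p V. norm V \<le> Kc * norm (D p V)"
    using drag_coercive[OF pos] unfolding D_def by blast
  obtain C where C: "C \<ge> 0" "\<And>p p' V. norm (D p V - D p' V) \<le> C * dist p p' * norm V"
    using drag_vector_lipschitz[of l \<xi> \<eta>] pos unfolding D_def dist_state[symmetric] by (meson less_imp_le)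
  obtain K where K: "K \<ge> 0" "\<And>p u. norm (h p u) \<le> K * norm u" "\<And>p p' u. norm (h p u - h p' u) \<le> K * dist p p' * norm u"
    using magnetic_load_lipschitz[of M1 M2 M3] unfolding h_def by blast
  obtain e where e: "e > 0" "\<And>d. norm (E d) \<le> e * norm d"
    using linear_bounded_pos[OF linear_elastic_load[of \<kappa>]] unfolding E_def by blast
  define Q where "Q = Kc * (K + C * (Kc * (e + K)))"
  have Q: "Q \<ge> 0" using Kc(1) e(1) K(1) C(1) by (simp add: Q_def)
  have main: "norm (S p (E (p - pe) + h p u) - S pe (E (p - pe) + h pe u)) \<le> Q * (dist p pe + norm u)\<^sup>2" for p u
  proof -
    define s where "s = dist p pe + norm u"
    have s: "dist p pe \<le> s" "norm u \<le> s" "0 \<le> s" by (simp_all add: s_def)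
    have "norm (E (p - pe) + h pe u) \<le> e * s + K * s"
      using s e(1) K(1) by (intro norm_triangle_mono order_trans[OF e(2)] order_trans[OF K(2)] mult_left_mono) (auto simp: dist_norm)
    then have "norm (S pe (E (p - pe) + h pe u)) \<le> Kc * (e * s + K * s)"
      using Kc(1) Kc(2)[of "S pe (E (p - pe) + h pe u)" pe] unfolding DS
      by (meson mult_left_mono less_imp_le order_trans)
    then have V': "norm (S pe (E (p - pe) + h pe u)) \<le> Kc * (e + K) * s" by (simp add: algebra_simps)
    have "norm (S p (E (p - pe) + h p u) - S pe (E (p - pe) + h pe u))
        \<le> Kc * (norm ((E (p - pe) + h p u) - (E (p - pe) + h pe u)) + C * dist p pe * norm (S pe (E (p - pe) + h pe u)))"
      by (rule linear_equation_perturbation[where D = D, OF _ Kc(2) _ C(2) DS DS])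
        (use Kc(1) in \<open>auto simp: D_def drag_vector_linear\<close>)
    also have "\<dots> \<le> Kc * (K * s * s + C * s * (Kc * (e + K) * s))"
    proof (intro mult_left_mono add_mono)
      have "norm ((E (p - pe) + h p u) - (E (p - pe) + h pe u)) \<le> K * dist p pe * norm u" using K(3) by simp
      also have "\<dots> \<le> K * s * s" using s K(1) by (intro mult_mono) auto
      finally show "norm ((E (p - pe) + h p u) - (E (p - pe) + h pe u)) \<le> K * s * s" .
      show "C * dist p pe * norm (S pe (E (p - pe) + h pe u)) \<le> C * s * (Kc * (e + K) * s)"
        using s C(1) V' by (intro mult_mono) auto
    qed (use Kc(1) in auto)
    also have "\<dots> = Q * s\<^sup>2" by (simp add: Q_def power2_eq_square algebra_simps)
    finally show ?thesis by (simp add: s_def)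
  qed
  show ?thesis
  proof (intro exI[of _ Q] ballI)
    fix z :: "(real^2) \<times> (real^3)" and u :: "real^2"
    have "swimmer_field l \<xi> \<eta> \<kappa> M1 M2 M3 \<alpha>0 (fst z) (snd z) u = split_state (S (snd z) (E (snd z - pe) + h (snd z) u))"
      unfolding swimmer_field_split[where \<theta> = \<theta>e] S_def E_def h_def pe_def ..
    moreover have "linearised_drift l \<xi> \<eta> \<kappa> pe (z - (qe, pe)) + linearised_control l \<xi> \<eta> M1 M2 M3 pe u
        = split_state (S pe (E (snd z - pe) + h pe u))"
      by (simp add: linearised_drift_def linearised_control_def S_def E_def h_def
          linear_add[OF linear_split_state] linear_add[OF linear_swim_velocity])
    ultimately have "norm (swimmer_field l \<xi> \<eta> \<kappa> M1 M2 M3 \<alpha>0 (fst z) (snd z) u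
        - (linearised_drift l \<xi> \<eta> \<kappa> pe (z - (qe, pe)) + linearised_control l \<xi> \<eta> M1 M2 M3 pe u))
      \<le> Q * (dist (snd z) pe + norm u)\<^sup>2"
      using main by (simp only: norm_split_state_diff)
    also have "\<dots> \<le> Q * (norm (z - (qe, pe)) + norm u)\<^sup>2"
      using Q dist_snd_le[of z "(qe, pe)"] by (intro mult_left_mono power_mono add_right_mono) (auto simp: dist_norm)
    finally show "norm (swimmer_field l \<xi> \<eta> \<kappa> M1 M2 M3 \<alpha>0 (fst z) (snd z) u
        - (linearised_drift l \<xi> \<eta> \<kappa> pe (z - (qe, pe)) + linearised_control l \<xi> \<eta> M1 M2 M3 pe u))
      \<le> Q * (norm (z - (qe, pe)) + norm u)\<^sup>2" .
  qed
qed

section \<open>The Kalman condition at a bent equilibrium\<close>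

text \<open>Reciprocity: the power is a symmetric bilinear form in the two velocities, and the
  rotation is trivial at angle 0.\<close>

lemma drag_bent_symmetric:
  fixes l \<xi> \<eta> \<alpha>1 \<alpha>2 :: real
  assumes "0 \<le> l"
  defines "M \<equiv> drag_vector l \<xi> \<eta> (vector [0, 0, 0, \<alpha>1, \<alpha>2])"
  shows "M v \<bullet> w = M w \<bullet> v"
proof -
  have "R_minus 0 *v v = v" for v by (simp add: R_minus_mult vec_eq_iff forall_5)
  then show ?thesis
    using drag_power[OF assms(1), of \<xi> \<eta> "vector [0, 0, 0, \<alpha>1, \<alpha>2]" v w]
      drag_power[OF assms(1), of \<xi> \<eta> "vector [0, 0, 0, \<alpha>1, \<alpha>2]" w v]
      dissipation_commute[of l \<xi> \<eta> _ v w] by (simp add: M_def)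
qed

text \<open>Links 1 and 2 lie along the horizontal axis. Here \<open>y\<close> and \<open>q\<close>
  are the vertical and the link-normal velocity of the start of link 3, \<open>t1\<close>,
  \<open>t2\<close>, \<open>t3\<close> are torques about the links' own starts, and
  \<open>f2\<close>, \<open>f3\<close> are vertical forces. The tangential velocity of link 3 is
  eliminated in favour of \<open>y\<close> and \<open>q\<close>.\<close>

lemma drag_bent_torques:
  fixes x :: "real^5" and l \<xi> \<eta> \<alpha> :: real
  assumes "0 \<le> l"
  defines "y \<equiv> x$2 + l * x$3 + l * (x$3 + x$4)"
  defines "q \<equiv> - sin \<alpha> * x$1 + cos \<alpha> * y" and "w1 \<equiv> x$3" and "w2 \<equiv> x$3 + x$4" and "w3 \<equiv> x$3 + x$4 + x$5"
  defines "t1 \<equiv> - (\<eta> * (l\<^sup>2 / 2 * x$2 + l ^ 3 / 3 * w1))" and "t2 \<equiv> - (\<eta> * (l\<^sup>2 / 2 * (x$2 + l * w1) + l ^ 3 / 3 * w2))"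
    and "t3 \<equiv> - (\<eta> * (l\<^sup>2 / 2 * q + l ^ 3 / 3 * w3))"
    and "f2 \<equiv> - (\<eta> * (l * (x$2 + l * w1) + l\<^sup>2 / 2 * w2))"
    and "f3 \<equiv> - (l * \<xi> * (y - cos \<alpha> * q)) - \<eta> * (l * q + l\<^sup>2 / 2 * w3) * cos \<alpha>"
  shows "drag_vector l \<xi> \<eta> (vector [0, 0, 0, 0, \<alpha>]) x $ 3 = t1 + t2 + t3 + l * (f2 + f3) + l * f3"
    and "drag_vector l \<xi> \<eta> (vector [0, 0, 0, 0, \<alpha>]) x $ 4 = t2 + t3 + l * f3"
    and "drag_vector l \<xi> \<eta> (vector [0, 0, 0, 0, \<alpha>]) x $ 5 = t3"
proof -
  let ?Z = "vector [0, 0, 0, 0, \<alpha>] :: real^5"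
  have ang: "link_angle ?Z 1 = 0" "link_angle ?Z 2 = 0" "link_angle ?Z 3 = \<alpha>"
    "link_angle x 1 = w1" "link_angle x 2 = w2" "link_angle x 3 = w3"
    by (simp_all add: link_angle_def w1_def w2_def w3_def)
  have e0: "e_par 0 = vector [1, 0]" "e_perp 0 = vector [0, 1]"
    by (simp_all add: e_par_def e_perp_def)
  have b: "link_start_vel l ?Z x 1 = vector [x$1, x$2]" "link_start_vel l ?Z x 2 = vector [x$1, x$2 + l * w1]"
    "link_start_vel l ?Z x 3 = vector [x$1, y]"
    by (simp_all add: link_start_vel_def link_interval ang e0 vec_eq_iff forall_2 y_def w1_def w2_def del: One_nat_def)
  have inner2: "(vector [a, b] :: real^2) \<bullet> vector [c, d] = a * c + b * d" for a b c d
    by (simp add: inner_vec_def sum_2)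
  have q3: "(vector [x$1, y] :: real^2) \<bullet> e_perp \<alpha> = q"
    by (simp add: e_perp_def inner2 q_def)
  have "(sin \<alpha>)\<^sup>2 + (cos \<alpha>)\<^sup>2 = 1" by simp
  then have "(x$1 * cos \<alpha> + y * sin \<alpha>) * sin \<alpha> = y - cos \<alpha> * q"
    unfolding q_def by algebra
  then have p3: "((vector [x$1, y] :: real^2) \<bullet> e_par \<alpha>) * sin \<alpha> = y - cos \<alpha> * q"
    by (simp add: e_par_def inner2)
  have T: "link_torque l \<eta> ?Z x 1 = t1" "link_torque l \<eta> ?Z x 2 = t2" "link_torque l \<eta> ?Z x 3 = t3"
    unfolding link_torque_def b ang q3 e0 inner2 by (simp_all add: t1_def t2_def t3_def)
  have f2: "link_force l \<xi> \<eta> ?Z x 2 $ 2 = f2"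
    unfolding link_force_def b ang e0 inner2 by (simp add: f2_def)
  have "link_force l \<xi> \<eta> ?Z x 3 $ 2
      = - (l * \<xi> * (((vector [x$1, y] :: real^2) \<bullet> e_par \<alpha>) * sin \<alpha>)) - \<eta> * (l * q + l\<^sup>2 / 2 * w3) * cos \<alpha>"
    unfolding link_force_def b ang q3 by (simp add: e_par_def e_perp_def)
  then have f3: "link_force l \<xi> \<eta> ?Z x 3 $ 2 = f3"
    unfolding p3 f3_def .
  have n0: "e_perp 0 \<bullet> v = v$2" for v by (simp add: e0 inner_vec_def sum_2)
  show "drag_vector l \<xi> \<eta> ?Z x $ 3 = t1 + t2 + t3 + l * (f2 + f3) + l * f3"
    "drag_vector l \<xi> \<eta> ?Z x $ 4 = t2 + t3 + l * f3" "drag_vector l \<xi> \<eta> ?Z x $ 5 = t3"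
    unfolding drag_vector_explicit[OF assms(1)] vector_5 T ang n0 by (simp_all add: f2 f3)
qed

text \<open>A translation has two unknowns but three torque balances. These determine
  \<open>q\<close>, \<open>v\<close> and the moment \<open>G\<close> from \<open>a1\<close> and
  \<open>a2\<close>, and the drag law for \<open>G\<close> is then the compatibility
  condition.\<close>

lemma bent_translation_relation:
  fixes d :: "real^5" and l \<xi> \<eta> \<alpha> a1 a2 :: real
  assumes "0 < l" "0 < \<eta>" and d: "d$3 = 0" "d$4 = 0" "d$5 = 0"
  defines "T \<equiv> drag_vector l \<xi> \<eta> (vector [0, 0, 0, 0, \<alpha>]) d"
  assumes T: "T$3 = 0" "T$4 = a2 - a1" "T$5 = - a2"
  shows "2 * (\<xi> + \<eta>) * a1 = (3 * \<xi> + 7 / 2 * \<eta> - 2 * (\<xi> - \<eta>) * cos \<alpha>) * a2"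
proof -
  define q where "q = l\<^sup>2 * (- sin \<alpha> * d$1 + cos \<alpha> * d$2)"
  define v where "v = l\<^sup>2 * d$2"
  define G where "G = - (\<xi> * (v - cos \<alpha> * q)) - \<eta> * q * cos \<alpha>"
  have "0 \<le> l" using \<open>0 < l\<close> by simp
  note dt = drag_bent_torques[OF this, of \<xi> \<eta> \<alpha> d, folded T_def, unfolded d T, simplified]
  have 5: "\<eta> * q = 2 * a2" using dt(3) by (simp add: q_def algebra_simps)
  have 4: "- \<eta> * v / 2 - \<eta> * q / 2 + G = a2 - a1"
    using dt(2) by (simp add: q_def v_def G_def power2_eq_square field_simps)
  have 3: "- 2 * \<eta> * v - \<eta> * q / 2 + 2 * G = 0"
    using dt(1) by (simp add: q_def v_def G_def power2_eq_square field_simps)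
  have v: "\<eta> * v = 3 * a2 - 2 * a1" and G: "G = 7 / 2 * a2 - 2 * a1" using 3 4 5 by (simp_all add: field_simps)
  have "\<eta> * G = - (\<xi> * (\<eta> * v - cos \<alpha> * (\<eta> * q))) - \<eta> * (\<eta> * q) * cos \<alpha>"
    by (simp add: G_def algebra_simps)
  then show ?thesis unfolding v G 5 by (simp add: algebra_simps)
qed

text \<open>Link 3 does not rotate, so its vanishing torque means that its start has no normal
  velocity. The two other balances are linear in \<open>g$2\<close> and the two angular velocities.
  The first conclusion has positive coefficients, hence opposite signs; the others recover the
  translation once the rotations are known to vanish.\<close>

lemma bent_torque_free_relation:
  fixes g :: "real^5" and l \<xi> \<eta> \<alpha> :: real
  assumes "0 < l" "0 < \<eta>" and g5: "g$3 + g$4 + g$5 = 0"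
  defines "T \<equiv> drag_vector l \<xi> \<eta> (vector [0, 0, 0, 0, \<alpha>]) g"
  assumes T: "T$3 = 0" "T$4 = 0" "T$5 = 0"
  shows "(\<eta> + 2 * \<xi>) * g$3 + (3 * \<eta> + 10 * \<xi>) * (g$3 + g$4) = 0"
    and "6 * g$2 = - l * (5 * g$3 + (g$3 + g$4))"
    and "- sin \<alpha> * g$1 + cos \<alpha> * (g$2 + l * g$3 + l * (g$3 + g$4)) = 0"
proof -
  define a1 where "a1 = g$3"
  define a2 where "a2 = g$3 + g$4"
  have "0 \<le> l" using \<open>0 < l\<close> by simp
  note dt = drag_bent_torques[OF this, of \<xi> \<eta> \<alpha> g, folded T_def, unfolded g5 T, folded a2_def, folded a1_def]
  show q: "- sin \<alpha> * g$1 + cos \<alpha> * (g$2 + l * g$3 + l * (g$3 + g$4)) = 0"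
    using dt(3) assms(1,2) by (simp add: a1_def a2_def)
  define y where "y = g$2 / l"
  have y: "g$2 = l * y" using \<open>0 < l\<close> by (simp add: y_def)
  note dt' = dt[folded q[folded a2_def, folded a1_def], unfolded q[folded a2_def, folded a1_def], unfolded y]
  have "l ^ 3 * (\<eta> * ((y + a1) / 2 + a2 / 3) + \<xi> * (y + a1 + a2)) = 0"
    using dt'(2) by (simp add: power2_eq_square power3_eq_cube algebra_simps)
  then have 4: "\<eta> * ((y + a1) / 2 + a2 / 3) + \<xi> * (y + a1 + a2) = 0" using \<open>0 < l\<close> by simp
  have "l ^ 3 * (\<eta> * (y / 2 + a1 / 3 + (y + a1) / 2 + a2 / 3 + (y + a1) + a2 / 2) + 2 * \<xi> * (y + a1 + a2)) = 0"
    using dt'(1) by (simp add: power2_eq_square power3_eq_cube algebra_simps)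
  then have 3: "\<eta> * (y / 2 + a1 / 3 + (y + a1) / 2 + a2 / 3 + (y + a1) + a2 / 2) + 2 * \<xi> * (y + a1 + a2) = 0" using \<open>0 < l\<close> by simp
  \<comment> \<open>Subtracting twice the second balance removes every \<xi> term and determines
    \<open>y\<close>.\<close>
  have "\<eta> * (y + 5 / 6 * a1 + a2 / 6)
      = (\<eta> * (y / 2 + a1 / 3 + (y + a1) / 2 + a2 / 3 + (y + a1) + a2 / 2) + 2 * \<xi> * (y + a1 + a2))
        - 2 * (\<eta> * ((y + a1) / 2 + a2 / 3) + \<xi> * (y + a1 + a2))"
    by (simp add: field_simps)
  then have "\<eta> * (y + 5 / 6 * a1 + a2 / 6) = 0" unfolding 3 4 by simp
  then have y': "y = - (5 * a1 + a2) / 6" using \<open>0 < \<eta>\<close> by simp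
  show "(\<eta> + 2 * \<xi>) * g$3 + (3 * \<eta> + 10 * \<xi>) * (g$3 + g$4) = 0"
    using 4 unfolding y' a2_def[symmetric] unfolding a1_def[symmetric] by (simp add: field_simps)
  show "6 * g$2 = - l * (5 * g$3 + (g$3 + g$4))"
    unfolding y y' a2_def[symmetric] unfolding a1_def[symmetric] by (simp add: field_simps)
qed

text \<open>
  A covector \<open>\<mu>\<close> annihilating the first-order reachable directions yields, by symmetry of the drag matrix, a
  motion \<open>g\<close> under a force without torques and a motion \<open>h\<close> under the torques \<open>g$4\<close>, \<open>g$5\<close>, whose link angular
  velocities \<open>(\<omega>\<^sub>1, \<omega>\<^sub>2, 0)\<close> are both orthogonal to \<open>(M\<^sub>1, M\<^sub>2, 0)\<close>, hence proportional. Thus some \<open>h - k g\<close> is a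
  translation. The balance of \<open>g\<close> forces \<open>\<omega>\<^sub>1 / \<omega>\<^sub>2 < 0\<close>, the balance of the translation forces \<open>\<omega>\<^sub>1 / \<omega>\<^sub>2 > 0\<close>.
\<close>

lemma kalman_bent:
  fixes l \<xi> \<eta> \<kappa> M1 M2 M3 \<alpha>0 \<theta>e :: real and \<mu> :: "real^2"
  assumes pos: "l > 0" "\<xi> > 0" "\<eta> > 0" "\<kappa> > 0"
    and M: "M1 \<noteq> 0" "M2 \<noteq> 0" "M3 \<noteq> 0" and sin: "sin \<alpha>0 \<noteq> 0"
  defines "pe \<equiv> vector [\<theta>e, 0, \<alpha>0]"
  defines "A \<equiv> linearised_drift l \<xi> \<eta> \<kappa> pe" and "B \<equiv> linearised_control l \<xi> \<eta> M1 M2 M3 pe"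
  assumes ann: "\<forall>u. \<mu> \<bullet> fst (B u) = 0 \<and> \<mu> \<bullet> fst (A (B u)) = 0"
  shows "\<mu> = 0"
proof -
  define D where "D = drag_vector l \<xi> \<eta> (vector [0, 0, 0, 0, \<alpha>0])"
  define S where "S = swim_velocity l \<xi> \<eta> pe"
  define R where "R V = R_minus \<theta>e *v V" for V
  have DRS: "D (R (S \<tau>)) = \<tau>" for \<tau>
    using drag_swim_velocity[OF pos(1-3), of pe \<tau>] drag_vector_reduce[of l \<xi> \<eta> 0 0 \<theta>e 0 \<alpha>0 "S \<tau>"]
    by (simp add: D_def R_def S_def state_def pe_def)
  have sym: "D v \<bullet> w = D w \<bullet> v" for v w
    unfolding D_def using pos by (intro drag_bent_symmetric) simp
  have linD: "linear D" unfolding D_def by (rule drag_vector_linear)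
  have R45: "R V $ 4 = V$4" "R V $ 5 = V$5" for V by (simp_all add: R_def R_minus_mult)
  define r where "r = R (vector [\<mu>$1, \<mu>$2, 0, 0, 0])"
  have r: "r = vector [cos \<theta>e * \<mu>$1 + sin \<theta>e * \<mu>$2, - sin \<theta>e * \<mu>$1 + cos \<theta>e * \<mu>$2, 0, 0, 0]"
    by (simp add: r_def R_def R_minus_mult)
  define g where "g = R (S r)"
  \<comment> \<open>The springs read entries 4 and 5 of a response, so pairing with \<open>g\<close>
    after \<open>A\<close> is, up to the factor \<open>- \<kappa>\<close>, pairing that response
    with \<open>k\<close>.\<close>
  define k where "k = (vector [0, 0, 0, g$4, g$5] :: real^5)"
  define h where "h = R (S k)"
  have Dg: "D g = r" and Dh: "D h = k" by (simp_all add: g_def h_def DRS)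
  \<comment> \<open>By symmetry of \<open>D\<close> and orthogonality of the rotation, the component
    along \<mu> of the response to a load is the pairing of that load with the single vector
    \<open>g\<close>.\<close>
  have out: "\<mu> \<bullet> fst (split_state (S \<tau>)) = \<tau> \<bullet> g" for \<tau>
  proof -
    have "r \<bullet> R V = \<mu> \<bullet> state_xy V" for V
    proof -
      have "(c * m1 + s * m2) * (c * v1 + s * v2) + (- s * m1 + c * m2) * (- s * v1 + c * v2) = m1 * v1 + m2 * v2"
        if "s\<^sup>2 + c\<^sup>2 = 1" for c s m1 m2 v1 v2 :: real
        using that by algebra
      from this[OF sin_cos_squared_add, of \<theta>e "\<mu>$1" "\<mu>$2" "V$1" "V$2"] show ?thesis
        by (simp add: r R_def R_minus_mult state_xy_def inner_vec_def sum_2 sum_5)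
    qed
    then have "\<mu> \<bullet> fst (split_state (S \<tau>)) = D g \<bullet> R (S \<tau>)" by (simp add: split_state_def Dg)
    also have "\<dots> = \<tau> \<bullet> g" unfolding sym[of g] DRS ..
    finally show ?thesis .
  qed
  have g: "magnetic_load M1 M2 M3 pe u \<bullet> g = 0" for u
    using ann[rule_format, of u] out unfolding B_def linearised_control_def S_def by simp
  have h: "magnetic_load M1 M2 M3 pe u \<bullet> h = 0" for u
  proof -
    define \<tau> where "\<tau> = magnetic_load M1 M2 M3 pe u"
    have "0 = \<mu> \<bullet> fst (split_state (S (elastic_load \<kappa> (snd (split_state (S \<tau>))))))"
      using ann[rule_format, of u] unfolding A_def B_def linearised_control_def linearised_drift_def S_def \<tau>_def by simp
    also have "\<dots> = elastic_load \<kappa> (snd (split_state (S \<tau>))) \<bullet> g" by (rule out)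
    also have "\<dots> = - \<kappa> * (k \<bullet> R (S \<tau>))"
      by (simp add: elastic_load_def split_state_def state_angles_def k_def R45 inner_vec_def sum_5 axis_def algebra_simps)
    also have "k \<bullet> R (S \<tau>) = \<tau> \<bullet> h"
      unfolding Dh[symmetric] sym[of h] DRS ..
    finally show ?thesis using pos(4) by (simp add: \<tau>_def)
  qed
  \<comment> \<open>Entries 3 to 5 of the parallel-field load at equilibrium all equal
    \<open>M3 * sin \<alpha>0\<close>, so being orthogonal to it means zero angular velocity of link
    3. The transverse field then leaves the relation weighted by \<open>M1\<close> and
    \<open>M2\<close>.\<close>
  have load: "x$3 + x$4 + x$5 = 0 \<and> M1 * x$3 + M2 * (x$3 + x$4) = 0" if "\<And>u. magnetic_load M1 M2 M3 pe u \<bullet> x = 0" for x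
  proof -
    have "M3 * sin \<alpha>0 * (x$3 + x$4 + x$5) = 0"
      using that[of "vector [1, 0]"]
      by (simp add: magnetic_load_def pe_def inner_vec_def sum_5 axis_def algebra_simps)
    then have s: "x$3 + x$4 + x$5 = 0" using M sin by simp
    have "M1 * x$3 + M2 * (x$3 + x$4) + M3 * cos \<alpha>0 * (x$3 + x$4 + x$5) = 0"
      using that[of "vector [0, 1]"]
      by (simp add: magnetic_load_def pe_def inner_vec_def sum_5 axis_def algebra_simps)
    then show ?thesis using s by simp
  qed
  note g_load = load[of g, OF g] and h_load = load[of h, OF h]
  have Dg0: "drag_vector l \<xi> \<eta> (vector [0, 0, 0, 0, \<alpha>0]) g $ 3 = 0" "drag_vector l \<xi> \<eta> (vector [0, 0, 0, 0, \<alpha>0]) g $ 4 = 0"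
    "drag_vector l \<xi> \<eta> (vector [0, 0, 0, 0, \<alpha>0]) g $ 5 = 0"
    unfolding D_def[symmetric] Dg r by simp_all
  note free = bent_torque_free_relation[OF pos(1,3) conjunct1[OF g_load] Dg0]
  define a1 where "a1 = g$3"
  define a2 where "a2 = g$3 + g$4"
  have Ma: "M1 * a1 + M2 * a2 = 0" using g_load by (simp add: a1_def a2_def)
  have "a2 = 0"
  proof (rule ccontr)
    assume a2: "a2 \<noteq> 0"
    \<comment> \<open>The multiple of \<open>g\<close> is chosen to cancel the rotation of link 2;
      the relation with \<open>M1 \<noteq> 0\<close> cancels link 1, and link 3 is already at
      rest.\<close>
    define c where "c = (h$3 + h$4) / a2"
    define d where "d = h - c *\<^sub>R g"
    have c2: "h$3 + h$4 = c * a2" using a2 by (simp add: c_def)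
    have "M1 * h$3 = M1 * (c * a1)"
      using h_load Ma c2 by algebra
    then have c1: "h$3 = c * a1" using M(1) by simp
    have "h$4 = c * g$4" using c1 c2 by (simp add: a1_def a2_def algebra_simps)
    moreover have "h$5 = - (c * a2)" "g$5 = - a2" using g_load h_load c2 a2_def by linarith+
    ultimately have d0: "d$3 = 0" "d$4 = 0" "d$5 = 0"
      using c1 unfolding d_def a1_def by (simp_all add: algebra_simps)
    have Dd: "D d = k - c *\<^sub>R r"
      by (simp add: d_def linear_diff[OF linD] linear_scale[OF linD] Dg Dh)
    have Dd': "drag_vector l \<xi> \<eta> (vector [0, 0, 0, 0, \<alpha>0]) d $ 3 = 0"
      "drag_vector l \<xi> \<eta> (vector [0, 0, 0, 0, \<alpha>0]) d $ 4 = a2 - a1"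
      "drag_vector l \<xi> \<eta> (vector [0, 0, 0, 0, \<alpha>0]) d $ 5 = - a2"
      using g_load unfolding D_def[symmetric] Dd by (simp_all add: k_def r a1_def a2_def)
    have rel1: "2 * (\<xi> + \<eta>) * a1 = (3 * \<xi> + 7 / 2 * \<eta> - 2 * (\<xi> - \<eta>) * cos \<alpha>0) * a2"
      by (rule bent_translation_relation[OF pos(1,3) d0 Dd'])
    have rel2: "(\<eta> + 2 * \<xi>) * a1 + (3 * \<eta> + 10 * \<xi>) * a2 = 0"
      using free(1) by (simp add: a1_def a2_def)
    define P where "P = 3 * \<xi> + 7 / 2 * \<eta> - 2 * (\<xi> - \<eta>) * cos \<alpha>0"
    \<comment> \<open>These bounds give \<open>P \<ge> \<xi> + 3 / 2 * \<eta>\<close>, whichever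
      drag coefficient is larger.\<close>
    have "\<xi> * cos \<alpha>0 \<le> \<xi> * 1" "\<eta> * (- 1) \<le> \<eta> * cos \<alpha>0"
      using pos by (intro mult_left_mono; simp)+
    moreover have "P = 3 * \<xi> + 7 / 2 * \<eta> - 2 * (\<xi> * cos \<alpha>0) + 2 * (\<eta> * cos \<alpha>0)"
      by (simp add: P_def algebra_simps)
    ultimately have "P > 0" using pos by linarith
    \<comment> \<open>Eliminating \<open>a1\<close> between the two relations leaves
      \<open>a2\<close> times a sum of positive terms.\<close>
    have "((\<eta> + 2 * \<xi>) * P + 2 * (\<xi> + \<eta>) * (3 * \<eta> + 10 * \<xi>)) * a2
        = (\<eta> + 2 * \<xi>) * (2 * (\<xi> + \<eta>) * a1) + 2 * (\<xi> + \<eta>) * ((3 * \<eta> + 10 * \<xi>) * a2)"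
      unfolding rel1 P_def by (simp add: algebra_simps)
    also have "\<dots> = 2 * (\<xi> + \<eta>) * ((\<eta> + 2 * \<xi>) * a1 + (3 * \<eta> + 10 * \<xi>) * a2)"
      by (simp add: algebra_simps)
    also have "\<dots> = 0" unfolding rel2 by simp
    finally have "(\<eta> + 2 * \<xi>) * P + 2 * (\<xi> + \<eta>) * (3 * \<eta> + 10 * \<xi>) = 0" using a2 by simp
    moreover have "(\<eta> + 2 * \<xi>) * P + 2 * (\<xi> + \<eta>) * (3 * \<eta> + 10 * \<xi>) > 0"
      using pos \<open>P > 0\<close> by (intro add_pos_pos mult_pos_pos) auto
    ultimately show False by simp
  qed
  \<comment> \<open>Without rotation \<open>g\<close> is a translation; the torque-free balances
    give \<open>g$2 = 0\<close>, and \<open>sin \<alpha>0 \<noteq> 0\<close> then gives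
    \<open>g$1 = 0\<close>.\<close>
  then have a: "g$3 = 0" "g$4 = 0" using Ma M(1) by (simp_all add: a1_def a2_def)
  then have "g$5 = 0" "g$2 = 0" "g$1 = 0" using g_load free(2,3) sin by simp_all
  with a have "g = 0" by (simp add: vec_eq_iff forall_5)
  then have "r = 0" using Dg linear_0[OF linD] by simp
  then have "R_minus \<theta>e *v vector [\<mu>$1, \<mu>$2, 0, 0, 0] = 0" by (simp add: r_def R_def)
  then have "vector [\<mu>$1, \<mu>$2, 0, 0, 0] = (0 :: real^5)"
    using invertible_R_minus[of \<theta>e] unfolding invertible_left_inverse matrix_left_invertible_ker by blast
  then show "\<mu> = 0" by (simp add: vec_eq_iff forall_5 forall_2)
qed

theorem theorem3:
  fixes l \<xi> \<eta> \<kappa> M1 M2 M3 \<alpha>0 xe ye \<theta>e :: real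
  assumes "l > 0" "\<xi> > 0" "\<eta> > 0" "\<kappa> > 0"
    and "M1 \<noteq> 0" "M2 \<noteq> 0" "M3 \<noteq> 0"
    and "\<alpha>0 \<in> {-pi<..<pi}" "\<alpha>0 \<noteq> 0"
  shows "small_time_locally_partially_controllable
           (swimmer_field l \<xi> \<eta> \<kappa> M1 M2 M3 \<alpha>0)
           (vector [xe, ye]) (vector [\<theta>e, 0, \<alpha>0]) 0"
proof -
  have "sin \<alpha>0 \<noteq> 0"
  proof (cases "\<alpha>0 > 0")
    case True
    then show ?thesis using sin_gt_zero[of \<alpha>0] assms(8) by simp
  next
    case False
    then show ?thesis using sin_gt_zero[of "- \<alpha>0"] assms(8,9) by simp
  qed
  then have "\<forall>\<mu>. (\<forall>u. \<mu> \<bullet> fst (linearised_control l \<xi> \<eta> M1 M2 M3 (vector [\<theta>e, 0, \<alpha>0]) u) = 0 \<and>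
      \<mu> \<bullet> fst (linearised_drift l \<xi> \<eta> \<kappa> (vector [\<theta>e, 0, \<alpha>0])
          (linearised_control l \<xi> \<eta> M1 M2 M3 (vector [\<theta>e, 0, \<alpha>0]) u)) = 0) \<longrightarrow> \<mu> = 0"
    using kalman_bent[OF assms(1-7)] by blast
  then show ?thesis
    using partial_controllability_linear_test[OF linear_linearised swimmer_field_lipschitz[OF assms(1-3)]
        swimmer_field_linearisation[OF assms(1-3)]] by blast
qed

end
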